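(* Let $n\ge1$. Let, for every prime power $p^v$, a subset $A_{p^v}\subset(\mathbf{Z}/p^v\mathbf{Z})^n$ be given (possibly empty). Suppose there are constants $\alpha>0$, $x_0\ge2$ with $\sum_{p\le y,\ \rho(p)\ge1}\log p\ge\alpha y$ for all $y\ge x_0$. Let $x$ be sufficiently large in terms of $x_0$ and $\alpha$, and let $\delta$ satisfy $1/\log\log x\le\delta\le1/e$ and $$\sum_{p\in\mathcal{Q}(x)}\frac1p\frac{\lambda(p)}{\rho(p)}\le\delta\sum_{p\in\mathcal{Q}(x)}\frac1p,$$ the sums being over primes $p$ in $\mathcal{Q}(x)$. Then uniformly for integers $2\le k\le\alpha\delta\log\log x$, $$\frac{1}{|\mathcal{Q}_k(x)|}\sum_{q\in\mathcal{Q}_k(x)}\operatorname{disc}(\Delta_q)\ll\frac1\alpha\,\delta^{(k-1)/10},$$ where the implied constant depends only on $n$.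
   Context: For $q\ge1$, $A_q\subset(\mathbf{Z}/q\mathbf{Z})^n$ is the set of $x\bmod q$ with $x\bmod p^v\in A_{p^v}$ for every prime power $p^v$ exactly dividing $q$; $\rho(q)=|A_q|$ (multiplicative, $\rho(1)=1$). $\mathcal{Q}=\{q\ge1:\rho(q)\ge1\}$, $\mathcal{Q}(x)=\{q\in\mathcal{Q}:q\le x\}$; $\mathcal{Q}_k$ is the set of elements of $\mathcal{Q}$ with exactly $k$ distinct prime factors, $\mathcal{Q}_k(x)=\mathcal{Q}_k\cap[1,x]$. For a prime $p\in\mathcal{Q}$, $\lambda(p)=\max_H|H\cap A_p|$ over affine hyperplanes $H=\{x\in(\mathbf{Z}/p\mathbf{Z})^n:h\cdot x=a\}$, $h\ne0$. $\Delta_q=\frac1{\rho(q)}\sum_{a\in A_q}\delta_{\{a/q\}}$ on $(\mathbf{R}/\mathbf{Z})^n$, and $\operatorname{disc}(\Delta_q)=\sup_B|\Delta_q(B)-\operatorname{vol}(B)|$ over boxes $B$ of $(\mathbf{R}/\mathbf{Z})^n$ (projections of products of closed intervals with side lengths $\le1$). *)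

theory Defs
  imports "HOL-Analysis.Analysis" "HOL-Number_Theory.Number_Theory"
begin

text \<open>
  The ring of integers modulo \<open>q\<close> is represented by its least residues, so that elements of its
  \<open>n\<close>-th power are extensional functions on \<open>{..<n}\<close>. Likewise \<open>\<real>/\<int>\<close> is represented by
  \<open>[0,1)\<close>, with projection \<^const>\<open>frac\<close>.
\<close>

definition residue_vecs :: "nat \<Rightarrow> nat \<Rightarrow> (nat \<Rightarrow> nat) set" where
  "residue_vecs n q = ({..<n} \<rightarrow>\<^sub>E {..<q})"

definition reduce_vec :: "nat \<Rightarrow> nat \<Rightarrow> (nat \<Rightarrow> nat) \<Rightarrow> (nat \<Rightarrow> nat)" where
  "reduce_vec n m x = (\<lambda>i\<in>{..<n}. x i mod m)"

definition prime_power_family :: "nat \<Rightarrow> (nat \<Rightarrow> (nat \<Rightarrow> nat) set) \<Rightarrow> bool" where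
  "prime_power_family n A \<longleftrightarrow>
     (\<forall>p v. prime p \<and> v \<ge> 1 \<longrightarrow> A (p ^ v) \<subseteq> residue_vecs n (p ^ v))"

text \<open>
  The set \<open>A\<^sub>q\<close> for arbitrary \<open>q \<ge> 1\<close>; only the values of \<open>A\<close> at prime powers are used, and for
  a prime power \<open>q\<close> the result is \<open>A q\<close> whenever \<open>prime_power_family n A\<close> holds.
\<close>

definition crt_set :: "nat \<Rightarrow> (nat \<Rightarrow> (nat \<Rightarrow> nat) set) \<Rightarrow> nat \<Rightarrow> (nat \<Rightarrow> nat) set" where
  "crt_set n A q = {x \<in> residue_vecs n q. \<forall>p \<in> prime_factors q.
     reduce_vec n (p ^ multiplicity p q) x \<in> A (p ^ multiplicity p q)}"

definition rho :: "nat \<Rightarrow> (nat \<Rightarrow> (nat \<Rightarrow> nat) set) \<Rightarrow> nat \<Rightarrow> nat" where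
  "rho n A q = card (crt_set n A q)"

definition QQ :: "nat \<Rightarrow> (nat \<Rightarrow> (nat \<Rightarrow> nat) set) \<Rightarrow> nat set" where
  "QQ n A = {q. q \<ge> 1 \<and> rho n A q \<ge> 1}"

definition QQ_upto :: "nat \<Rightarrow> (nat \<Rightarrow> (nat \<Rightarrow> nat) set) \<Rightarrow> real \<Rightarrow> nat set" where
  "QQ_upto n A x = {q \<in> QQ n A. real q \<le> x}"

definition QQ_k_upto :: "nat \<Rightarrow> (nat \<Rightarrow> (nat \<Rightarrow> nat) set) \<Rightarrow> nat \<Rightarrow> real \<Rightarrow> nat set" where
  "QQ_k_upto n A k x = {q \<in> QQ_upto n A x. card (prime_factors q) = k}"

definition affine_hyperplanes :: "nat \<Rightarrow> nat \<Rightarrow> (nat \<Rightarrow> nat) set set" where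
  "affine_hyperplanes n p =
     {{x \<in> residue_vecs n p. [(\<Sum>i<n. h i * x i) = a] (mod p)} | h a.
        h \<in> residue_vecs n p \<and> (\<exists>i<n. h i \<noteq> 0) \<and> a < p}"

definition lam :: "nat \<Rightarrow> (nat \<Rightarrow> (nat \<Rightarrow> nat) set) \<Rightarrow> nat \<Rightarrow> nat" where
  "lam n A p = Max ((\<lambda>H. card (H \<inter> crt_set n A p)) ` affine_hyperplanes n p)"

definition torus_proj :: "nat \<Rightarrow> (nat \<Rightarrow> real) \<Rightarrow> (nat \<Rightarrow> real)" where
  "torus_proj n y = (\<lambda>i\<in>{..<n}. frac (y i))"

definition torus_boxes :: "nat \<Rightarrow> (nat \<Rightarrow> real) set set" where
  "torus_boxes n =
     {torus_proj n ` (\<Pi>\<^sub>E i\<in>{..<n}. {a i..b i}) | a b.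
        \<forall>i<n. a i \<le> b i \<and> b i - a i \<le> 1}"

text \<open>On subsets of \<open>[0,1)\<^sup>n\<close>, Lebesgue measure is the normalised Haar measure of the torus.\<close>

definition torus_vol :: "nat \<Rightarrow> (nat \<Rightarrow> real) set \<Rightarrow> real" where
  "torus_vol n B = measure (Pi\<^sub>M {..<n} (\<lambda>_. lborel)) B"

definition Delta ::
  "nat \<Rightarrow> (nat \<Rightarrow> (nat \<Rightarrow> nat) set) \<Rightarrow> nat \<Rightarrow> (nat \<Rightarrow> real) set \<Rightarrow> real" where
  "Delta n A q B = (1 / real (rho n A q)) *
     (\<Sum>a\<in>crt_set n A q. indicator B (torus_proj n (\<lambda>i. real (a i) / real q)))"

definition disc :: "nat \<Rightarrow> ((nat \<Rightarrow> real) set \<Rightarrow> real) \<Rightarrow> real" where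
  "disc n \<mu> = (SUP B\<in>torus_boxes n. \<bar>\<mu> B - torus_vol n B\<bar>)"

end

theory Submission
  imports Defs "HOL-Real_Asymp.Real_Asymp" "HOL-Computational_Algebra.Squarefree"
begin

text \<open>
  By the Erdos-Turan-Koksma inequality, the discrepancy of \<open>\<Delta>\<^sub>q\<close> is controlled by the Weyl sums
  \<open>W\<^sub>q(h)\<close> over frequencies \<open>h\<close> with \<open>\<bar>h\<bar> \<le> \<delta>\<^bsup>-2k\<^esup>\<close>. Write \<open>q = r c t\<close>, where \<open>t\<close> is the largest prime
  power exactly dividing \<open>q\<close> and \<open>r\<close> is the product of the other ones that are at most
  \<open>z = exp (ln x / (ln ln x)\<^sup>3)\<close>. Twisted multiplicativity bounds \<open>\<bar>W\<^sub>q(h)\<bar>\<close> by \<open>\<bar>W\<^sub>r(h u)\<bar>\<close> with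
  \<open>c t u \<equiv> 1 (mod r)\<close>. For fixed \<open>r c\<close>, Selberg's sieve shows that \<open>t\<close> does not favour any class
  modulo \<open>r\<close>, so one may average over \<open>u\<close>; by Cauchy-Schwarz and orthogonality this average is at
  most the square root of the collision probability of \<open>h \<cdot> x\<close> on \<open>A\<^sub>r\<close>, which is multiplicative and
  at most \<open>\<lambda>(p)/\<rho>(p)\<close> at a prime \<open>p\<close> not dividing \<open>h\<close>. Summing over \<open>r c\<close> gives
  \<open>(\<surd>\<delta> L + O(ln ln ln x))\<^bsup>k-1\<^esup> / (k-1)!\<close> with \<open>L\<close> the sum of \<open>1/p\<close> over the primes in \<open>Q(x)\<close>, whereas
  \<open>\<bar>Q\<^sub>k(x)\<bar>\<close> is at least of order \<open>\<alpha> (x / ln x) (L - O(ln ln ln x))\<^bsup>k-1\<^esup> / (k-1)!\<close>. As \<open>L\<close> is at least of order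
  \<open>\<alpha> ln ln x\<close>, the error terms are negligible, and the gap between \<open>\<delta>\<^bsup>1/2\<^esup>\<close> and \<open>\<delta>\<^bsup>1/10\<^esup>\<close> absorbs all
  factors polynomial in \<open>k\<close> and \<open>ln (1/\<delta>)\<close>.
\<close>

section \<open>Selberg's sieve in arithmetic progressions\<close>

text \<open>The sieve dictates the shape of the argument. A modulus \<open>r\<close> is admissible
  only up to \<open>Y powr (1/4)\<close>, with \<open>Y = x / (r c)\<close> the range of
  \<open>t\<close>. As \<open>t\<close> is the largest of \<open>k\<close> components and
  \<open>q > sqrt x\<close> may be assumed, \<open>t\<close> is at least
  \<open>y = x powr (1 / (2 k))\<close>; so up to \<open>k - 1\<close> components below
  \<open>z\<close> may enter \<open>r\<close> once \<open>z ^ (k - 1) \<le> y powr (1/4)\<close>.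
  Since \<open>k\<close> may be of order \<open>ln ln x\<close>, \<open>ln x / ln z\<close> has to
  grow like a power of \<open>ln ln x\<close> above the square. The price: nothing is saved at
  components above \<open>z\<close>, nor at primes dividing the frequency; both have reciprocal sums
  of order \<open>ln ln ln x\<close>. The second obstacle is uniformity in \<open>k\<close>. These
  errors sit inside a \<open>(k - 1)\<close>-th power, so upper and lower bounds are compared base
  to base before the power is taken: the base of the upper bound is at most \<delta>^(1/5) times
  that of the lower bound. The assumption \<delta> \<ge> 1 / \<open>ln ln x\<close> makes
  \<delta>^(1/5) L, of order at least \<alpha> (\<open>ln ln x\<close>)^(4/5), exceed all errors,
  and the upper limit on \<open>k\<close> keeps the lower base above \<open>k\<close>.\<close>

definition sieve_sets :: "nat \<Rightarrow> nat \<Rightarrow> nat set set" where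
  "sieve_sets r D = {S. finite S \<and> (\<forall>p\<in>S. prime p \<and> \<not> p dvd r) \<and> \<Prod>S \<le> D}"

definition sieve_mass :: "nat set set \<Rightarrow> real" where
  "sieve_mass F = (\<Sum>S\<in>F. 1 / (\<Prod>p\<in>S. real p - 1))"

text \<open>A squarefree sieve modulus d is encoded as its set of prime factors, so that gcd and lcm
  become intersection and union. In this encoding \<open>sieve_mass\<close> is the sum G of
  1/phi(d), and the weight is Selberg's optimal lambda_d = mu(d) d / G times the sum of 1/phi(u)
  over the multiples u of d.\<close>

definition selberg_weight :: "nat set set \<Rightarrow> nat set \<Rightarrow> real" where
  "selberg_weight F S = (-1) ^ card S * (\<Prod>p\<in>S. real p) / sieve_mass F *
     (\<Sum>U\<in>{U\<in>F. S \<subseteq> U}. 1 / (\<Prod>p\<in>U. real p - 1))"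

lemma sieve_sets_downward:
  assumes "S \<in> sieve_sets r D" "T \<subseteq> S"
  shows "T \<in> sieve_sets r D"
proof -
  have fin: "finite S" "finite T" using assms finite_subset by (auto simp: sieve_sets_def)
  have "\<Prod>S > 0" using assms by (intro prod_pos) (auto simp: sieve_sets_def prime_gt_0_nat)
  moreover have "\<Prod>T dvd \<Prod>S" using assms fin by (intro prod_dvd_prod_subset) auto
  ultimately have "\<Prod>T \<le> \<Prod>S" by (intro dvd_imp_le) auto
  thus ?thesis using assms fin by (auto simp: sieve_sets_def)
qed

lemma prod_primes_prime_factors:
  assumes "finite S" "\<And>p. p \<in> S \<Longrightarrow> prime (p::nat)"
  shows "prime_factors (\<Prod>S) = S"
proof -
  have "prime_factors (\<Prod>S) = (\<Union>p\<in>S. prime_factors p)"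
    using assms not_prime_0 by (subst prime_factors_prod) (auto, metis not_prime_0)
  also have "\<dots> = S" using assms by (auto simp: prime_prime_factors)
  finally show ?thesis .
qed

lemma sieve_sets_inj: "inj_on Prod (sieve_sets r D)"
proof (rule inj_onI)
  fix S T assume a: "S \<in> sieve_sets r D" "T \<in> sieve_sets r D" "\<Prod>S = \<Prod>T"
  have "S = prime_factors (\<Prod>S)" by (rule prod_primes_prime_factors[symmetric]) (use a in \<open>auto simp: sieve_sets_def\<close>)
  also have "\<dots> = prime_factors (\<Prod>T)" by (simp only: a(3))
  also have "\<dots> = T" by (rule prod_primes_prime_factors) (use a in \<open>auto simp: sieve_sets_def\<close>)
  finally show "S = T" .
qed

lemma sieve_sets_image: "Prod ` sieve_sets r D \<subseteq> {1..D}"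
proof (intro image_subsetI)
  fix S assume S: "S \<in> sieve_sets r D"
  have "\<Prod>S > 0" using S by (intro prod_pos) (auto simp: sieve_sets_def prime_gt_0_nat)
  moreover have "\<Prod>S \<le> D" using S by (simp add: sieve_sets_def)
  ultimately show "\<Prod>S \<in> {1..D}" by (metis One_nat_def Suc_leI atLeastAtMost_iff)
qed

lemma finite_sieve_sets: "finite (sieve_sets r D)"
  using sieve_sets_image sieve_sets_inj by (meson finite_atLeastAtMost inj_on_finite)

lemma card_sieve_sets: "card (sieve_sets r D) \<le> D"
  using card_inj_on_le[OF sieve_sets_inj sieve_sets_image] by simp

section \<open>Diagonalising Selberg's quadratic form\<close>

text \<open>Moebius inversion on the lattice of finite sets: after removing \<open>F\<close> the sum
  is the expansion of the product of (-1 + 1) over \<open>U - F\<close>, which is empty exactly when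
  \<open>F = U\<close>.\<close>

lemma alternating_sum_interval:
  assumes "finite U" "F \<subseteq> U"
  shows "(\<Sum>S\<in>{S. F \<subseteq> S \<and> S \<subseteq> U}. (-1) ^ card S) = (if F = U then (-1) ^ card F else (0::real))"
proof -
  have "(\<Sum>S\<in>{S. F \<subseteq> S \<and> S \<subseteq> U}. (-1) ^ card S) = (\<Sum>X\<in>Pow (U - F). (-1) ^ card F * (-1) ^ card X :: real)"
  proof (rule sum.reindex_bij_witness[of _ "\<lambda>X. F \<union> X" "\<lambda>S. S - F"])
    fix S assume "S \<in> {S. F \<subseteq> S \<and> S \<subseteq> U}"
    moreover from this have "finite S" using assms finite_subset by auto
    moreover have "card S = card F + card (S - F)"
      using calculation assms by (metis (no_types, lifting) card_Diff_subset card_mono finite_subset le_add_diff_inverse mem_Collect_eq)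
    ultimately show "(-1) ^ card F * (-1) ^ card (S - F) = ((-1) ^ card S :: real)"
      by (simp add: power_add)
  qed (use assms in auto)
  also have "\<dots> = (-1) ^ card F * (\<Sum>X\<in>Pow (U - F). (\<Prod>x\<in>X. -1) * (\<Prod>x\<in>(U - F) - X. 1))"
    by (simp add: sum_distrib_left)
  also have "(\<Sum>X\<in>Pow (U - F). (\<Prod>x\<in>X. -1) * (\<Prod>x\<in>(U - F) - X. 1)) = (\<Prod>x\<in>U-F. -1 + (1::real))"
    using assms by (intro prod_add[symmetric]) auto
  also have "\<dots> = (if F = U then 1 else 0)" using assms by auto
  finally show ?thesis by auto
qed

text \<open>The weights are defined as a sum over supersets precisely so that this second sum over
  supersets inverts it: after exchanging the order of summation only \<open>U = F\<close>
  survives.\<close>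

lemma selberg_diagonal:
  assumes fin: "finite \<F>" and finm: "\<And>S. S \<in> \<F> \<Longrightarrow> finite S"
    and down: "\<And>S T. S \<in> \<F> \<Longrightarrow> T \<subseteq> S \<Longrightarrow> T \<in> \<F>"
    and pr: "\<And>S p. S \<in> \<F> \<Longrightarrow> p \<in> S \<Longrightarrow> prime p"
    and F: "F \<in> \<F>"
  shows "(\<Sum>S\<in>{S\<in>\<F>. F \<subseteq> S}. selberg_weight \<F> S / (\<Prod>p\<in>S. real p))
           = (-1) ^ card F / (sieve_mass \<F> * (\<Prod>p\<in>F. real p - 1))"
proof -
  have nz: "(\<Prod>p\<in>S. real p) \<noteq> 0" if "S \<in> \<F>" for S
    using that finm[OF that] pr[OF that] by (auto simp: prod_zero_iff) (metis not_prime_0)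
  have "(\<Sum>S\<in>{S\<in>\<F>. F \<subseteq> S}. selberg_weight \<F> S / (\<Prod>p\<in>S. real p))
      = (\<Sum>S\<in>{S\<in>\<F>. F \<subseteq> S}. \<Sum>U\<in>{U\<in>\<F>. S \<subseteq> U}. (-1) ^ card S * (1 / sieve_mass \<F> * (1 / (\<Prod>p\<in>U. real p - 1))))"
  proof (intro sum.cong refl)
    fix S assume "S \<in> {S\<in>\<F>. F \<subseteq> S}"
    hence "selberg_weight \<F> S / (\<Prod>p\<in>S. real p) = (-1) ^ card S * (1 / sieve_mass \<F>) *
       (\<Sum>U\<in>{U\<in>\<F>. S \<subseteq> U}. 1 / (\<Prod>p\<in>U. real p - 1))"
      using nz[of S] by (simp add: selberg_weight_def)
    thus "selberg_weight \<F> S / (\<Prod>p\<in>S. real p) = (\<Sum>U\<in>{U\<in>\<F>. S \<subseteq> U}. (-1) ^ card S * (1 / sieve_mass \<F> * (1 / (\<Prod>p\<in>U. real p - 1))))"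
      by (simp only: sum_distrib_left mult.assoc)
  qed
  also have "\<dots> = (\<Sum>(S,U)\<in>(SIGMA S:{S\<in>\<F>. F \<subseteq> S}. {U\<in>\<F>. S \<subseteq> U}). (-1) ^ card S * (1 / sieve_mass \<F> * (1 / (\<Prod>p\<in>U. real p - 1))))"
    using fin by (subst sum.Sigma) auto
  also have "\<dots> = (\<Sum>(U,S)\<in>(SIGMA U:{U\<in>\<F>. F \<subseteq> U}. {S. F \<subseteq> S \<and> S \<subseteq> U}). (-1) ^ card S * (1 / sieve_mass \<F> * (1 / (\<Prod>p\<in>U. real p - 1))))"
    by (rule sum.reindex_bij_witness[of _ "\<lambda>(a,b). (b,a)" "\<lambda>(a,b). (b,a)"]) (use down in auto)
  also have "\<dots> = (\<Sum>U\<in>{U\<in>\<F>. F \<subseteq> U}. \<Sum>S\<in>{S. F \<subseteq> S \<and> S \<subseteq> U}. (-1) ^ card S * (1 / sieve_mass \<F> * (1 / (\<Prod>p\<in>U. real p - 1))))"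
    using fin finm by (subst sum.Sigma) (auto intro!: finite_subset[of "{S. F \<subseteq> S \<and> S \<subseteq> _}" "Pow _"])
  also have "\<dots> = (\<Sum>U\<in>{U\<in>\<F>. F \<subseteq> U}. (if F = U then (-1) ^ card F else 0) * (1 / sieve_mass \<F> * (1 / (\<Prod>p\<in>U. real p - 1))))"
  proof (intro sum.cong refl)
    fix U assume U: "U \<in> {U\<in>\<F>. F \<subseteq> U}"
    show "(\<Sum>S\<in>{S. F \<subseteq> S \<and> S \<subseteq> U}. (-1) ^ card S * (1 / sieve_mass \<F> * (1 / (\<Prod>p\<in>U. real p - 1))))
      = (if F = U then (-1) ^ card F else 0) * (1 / sieve_mass \<F> * (1 / (\<Prod>p\<in>U. real p - 1)))"
      using alternating_sum_interval[of U F] finm[of U] U by (simp only: sum_distrib_right[symmetric]) auto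
  qed
  also have "\<dots> = (\<Sum>U\<in>{U\<in>\<F>. F \<subseteq> U}. if F = U then (-1) ^ card F * (1 / sieve_mass \<F> * (1 / (\<Prod>p\<in>U. real p - 1))) else 0)"
    by (intro sum.cong) auto
  also have "\<dots> = (-1) ^ card F * (1 / sieve_mass \<F> * (1 / (\<Prod>p\<in>F. real p - 1)))"
    using fin F by (subst sum.delta') auto
  finally show ?thesis by (simp add: divide_simps)
qed

text \<open>1/lcm(d, d') equals gcd(d, d') / (d d'), and gcd is the sum of phi(f) over its divisors
  f. This turns the form into a sum of phi(f) y_f^2, with the y_f evaluated in
  \<open>selberg_diagonal\<close>.\<close>

lemma selberg_quadratic_form:
  assumes fin: "finite \<F>" and finm: "\<And>S. S \<in> \<F> \<Longrightarrow> finite S"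
    and down: "\<And>S T. S \<in> \<F> \<Longrightarrow> T \<subseteq> S \<Longrightarrow> T \<in> \<F>"
    and pr: "\<And>S p. S \<in> \<F> \<Longrightarrow> p \<in> S \<Longrightarrow> prime p"
    and G: "sieve_mass \<F> \<noteq> 0"
  shows "(\<Sum>S\<in>\<F>. \<Sum>T\<in>\<F>. selberg_weight \<F> S * selberg_weight \<F> T / (\<Prod>p\<in>S \<union> T. real p))
           = 1 / sieve_mass \<F>"
proof -
  let ?w = "selberg_weight \<F>"
  define \<phi> :: "nat set \<Rightarrow> real" where "\<phi> F = (\<Prod>p\<in>F. real p - 1)" for F
  define y where "y F = (\<Sum>S\<in>{S\<in>\<F>. F \<subseteq> S}. ?w S / (\<Prod>p\<in>S. real p))" for F
  have nz: "(\<Prod>p\<in>S. real p) \<noteq> 0" if "S \<in> \<F>" for S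
    using that finm[OF that] pr[OF that] by (auto simp: prod_zero_iff) (metis not_prime_0)
  have phinz: "\<phi> S \<noteq> 0" if "S \<in> \<F>" for S
    using that finm[OF that] pr[OF that] by (auto simp: prod_zero_iff \<phi>_def) (metis not_prime_1 One_nat_def)
  \<comment> \<open>The product over the intersection, written with factors (p - 1) + 1 and
    expanded, is the sum of phi over all its subsets; downward closure lets these subsets range over
    the whole family.\<close>
  have gcd: "1 / (\<Prod>p\<in>S \<union> T. real p) = (\<Sum>F\<in>\<F>. (if F \<subseteq> S then 1 / (\<Prod>p\<in>S. real p) else 0) * (if F \<subseteq> T then 1 / (\<Prod>p\<in>T. real p) else 0) * \<phi> F)"
    if ST: "S \<in> \<F>" "T \<in> \<F>" for S T
  proof -
    have fS: "finite S" "finite T" using ST finm by auto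
    have un: "(\<Prod>p\<in>S \<union> T. real p) \<noteq> 0" using ST fS pr[OF ST(1), of 0] pr[OF ST(2), of 0] by (auto simp: prod_zero_iff)
    have "(\<Prod>p\<in>S. real p) * (\<Prod>p\<in>T. real p) = (\<Prod>p\<in>S \<union> T. real p) * (\<Prod>p\<in>S \<inter> T. real p)"
      using fS by (simp add: prod.union_inter)
    hence "1 / (\<Prod>p\<in>S \<union> T. real p) = (\<Prod>p\<in>S \<inter> T. real p) * (1 / (\<Prod>p\<in>S. real p) * (1 / (\<Prod>p\<in>T. real p)))"
      using un nz[OF ST(1)] nz[OF ST(2)] nz[OF down[OF ST(1), of "S \<inter> T"]] by (simp add: field_simps)
    also have "(\<Prod>p\<in>S \<inter> T. real p) = (\<Prod>p\<in>S \<inter> T. (real p - 1) + 1)" by simp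
    also have "\<dots> = (\<Sum>F\<in>Pow (S \<inter> T). \<phi> F)"
      using fS by (subst prod_add) (auto simp: \<phi>_def)
    also have "\<dots> = (\<Sum>F\<in>{F\<in>\<F>. F \<subseteq> S \<and> F \<subseteq> T}. \<phi> F)"
      using ST down by (intro sum.cong) auto
    also have "\<dots> = (\<Sum>F\<in>\<F>. if F \<subseteq> S \<and> F \<subseteq> T then \<phi> F else 0)"
      using fin by (simp add: sum.If_cases Int_def)
    also have "\<dots> * (1 / (\<Prod>p\<in>S. real p) * (1 / (\<Prod>p\<in>T. real p))) = (\<Sum>F\<in>\<F>. (if F \<subseteq> S then 1 / (\<Prod>p\<in>S. real p) else 0) * (if F \<subseteq> T then 1 / (\<Prod>p\<in>T. real p) else 0) * \<phi> F)"
      unfolding sum_distrib_right by (intro sum.cong) auto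
    finally show ?thesis .
  qed
  have "(\<Sum>S\<in>\<F>. \<Sum>T\<in>\<F>. ?w S * ?w T / (\<Prod>p\<in>S \<union> T. real p))
     = (\<Sum>S\<in>\<F>. \<Sum>T\<in>\<F>. \<Sum>F\<in>\<F>. (if F \<subseteq> S then ?w S / (\<Prod>p\<in>S. real p) else 0) * (if F \<subseteq> T then ?w T / (\<Prod>p\<in>T. real p) else 0) * \<phi> F)"
  proof (intro sum.cong refl)
    fix S T assume ST: "S \<in> \<F>" "T \<in> \<F>"
    have "?w S * ?w T / (\<Prod>p\<in>S \<union> T. real p) = ?w S * ?w T * (1 / (\<Prod>p\<in>S \<union> T. real p))" by simp
    also have "\<dots> = (\<Sum>F\<in>\<F>. (if F \<subseteq> S then ?w S / (\<Prod>p\<in>S. real p) else 0) * (if F \<subseteq> T then ?w T / (\<Prod>p\<in>T. real p) else 0) * \<phi> F)"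
      unfolding gcd[OF ST] sum_distrib_left by (intro sum.cong) auto
    finally show "?w S * ?w T / (\<Prod>p\<in>S \<union> T. real p) = \<dots>" .
  qed
  also have "\<dots> = (\<Sum>F\<in>\<F>. \<Sum>S\<in>\<F>. \<Sum>T\<in>\<F>. (if F \<subseteq> S then ?w S / (\<Prod>p\<in>S. real p) else 0) * (if F \<subseteq> T then ?w T / (\<Prod>p\<in>T. real p) else 0) * \<phi> F)"
    by (subst sum.swap[of _ \<F> \<F>], subst (2) sum.swap) (rule refl)
  also have "\<dots> = (\<Sum>F\<in>\<F>. (\<Sum>S\<in>\<F>. if F \<subseteq> S then ?w S / (\<Prod>p\<in>S. real p) else 0) * (\<Sum>T\<in>\<F>. if F \<subseteq> T then ?w T / (\<Prod>p\<in>T. real p) else 0) * \<phi> F)"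
    by (intro sum.cong refl, simp only: sum_product) (simp add: sum_distrib_right)
  also have "\<dots> = (\<Sum>F\<in>\<F>. y F * y F * \<phi> F)"
    using fin by (simp add: y_def sum.If_cases Int_def)
  also have "\<dots> = (\<Sum>F\<in>\<F>. 1 / sieve_mass \<F> ^ 2 * (1 / \<phi> F))"
  proof (intro sum.cong refl)
    fix F assume F: "F \<in> \<F>"
    have "y F = (-1) ^ card F / (sieve_mass \<F> * \<phi> F)"
      unfolding y_def \<phi>_def by (rule selberg_diagonal) (use fin finm down pr F in auto)
    moreover have "((-1) ^ card F) * ((-1) ^ card F) = (1::real)" by (simp flip: power_mult_distrib)
    ultimately have "y F * y F = 1 / (sieve_mass \<F> * \<phi> F)\<^sup>2"
      by (simp add: power2_eq_square)
    thus "y F * y F * \<phi> F = 1 / sieve_mass \<F> ^ 2 * (1 / \<phi> F)"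
      using phinz[OF F] G by (simp add: power2_eq_square)
  qed
  also have "\<dots> = 1 / sieve_mass \<F> ^ 2 * sieve_mass \<F>"
    unfolding sieve_mass_def[of \<F>] \<phi>_def by (simp add: sum_distrib_left)
  finally show ?thesis using G by (simp add: power2_eq_square)
qed

lemma sieve_phi_ge_1:
  assumes "S \<in> sieve_sets r D"
  shows "(\<Prod>p\<in>S. real p - 1) \<ge> 1"
proof (rule prod_ge_1)
  fix p assume "p \<in> S"
  hence "prime p" using assms by (auto simp: sieve_sets_def)
  hence "p \<ge> 2" by (rule prime_ge_2_nat)
  thus "1 \<le> real p - 1" by linarith
qed

lemma empty_in_sieve_sets: "D \<ge> 1 \<Longrightarrow> {} \<in> sieve_sets r D"
  by (auto simp: sieve_sets_def)

lemma sieve_mass_ge_1: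
  assumes "D \<ge> 1"
  shows "sieve_mass (sieve_sets r D) \<ge> 1"
proof -
  have "(\<Sum>S\<in>{{}}. 1 / (\<Prod>p\<in>S. real p - 1)) \<le> sieve_mass (sieve_sets r D)"
    unfolding sieve_mass_def
  proof (rule sum_mono2[OF finite_sieve_sets])
    show "{{}} \<subseteq> sieve_sets r D" using empty_in_sieve_sets[OF assms] by auto
  next
    fix S assume "S \<in> sieve_sets r D - {{}}"
    thus "0 \<le> 1 / (\<Prod>p\<in>S. real p - 1)" using sieve_phi_ge_1[of S r D] by auto
  qed
  thus ?thesis by simp
qed

lemma abs_selberg_weight_le:
  assumes "D \<ge> 1" "S \<in> sieve_sets r D"
  shows "\<bar>selberg_weight (sieve_sets r D) S\<bar> \<le> real D"
proof -
  let ?F = "sieve_sets r D"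
  have G: "sieve_mass ?F \<ge> 1" using sieve_mass_ge_1 assms by auto
  have nn: "0 \<le> 1 / (\<Prod>p\<in>U. real p - 1)" if "U \<in> ?F" for U
    using sieve_phi_ge_1[OF that] by auto
  let ?s = "\<Sum>U\<in>{U\<in>?F. S \<subseteq> U}. 1 / (\<Prod>p\<in>U. real p - 1)"
  have s: "0 \<le> ?s" "?s \<le> sieve_mass ?F"
    unfolding sieve_mass_def by (rule sum_nonneg, use nn in auto, rule sum_mono2[OF finite_sieve_sets], use nn in auto)
  have D: "(\<Prod>p\<in>S. real p) \<le> real D" "(\<Prod>p\<in>S. real p) \<ge> 0"
    using assms by (auto simp: sieve_sets_def simp flip: of_nat_prod)
  have "\<bar>selberg_weight ?F S\<bar> = (\<Prod>p\<in>S. real p) * (?s / sieve_mass ?F)"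
    unfolding selberg_weight_def using s G D by (simp add: abs_mult abs_prod)
  also have "\<dots> \<le> real D * 1"
    using s G D by (intro mult_mono) (auto simp: divide_simps)
  finally show ?thesis by simp
qed

lemma selberg_weight_empty:
  assumes "D \<ge> 1"
  shows "selberg_weight (sieve_sets r D) {} = 1"
proof -
  have "(\<Sum>U\<in>{U\<in>sieve_sets r D. {} \<subseteq> U}. 1 / (\<Prod>p\<in>U. real p - 1)) = sieve_mass (sieve_sets r D)"
    by (simp add: sieve_mass_def)
  thus ?thesis using sieve_mass_ge_1[OF assms, of r] unfolding selberg_weight_def by simp
qed

lemma card_residue_class:
  assumes "c < e"
  shows "card {m. m < N \<and> m mod e = c} = (N + (e - 1 - c)) div e"
proof -
  have "{m. m < N \<and> m mod e = c} = (\<lambda>j. c + e * j) ` {..<(N + (e - 1 - c)) div e}"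
  proof (intro equalityI subsetI)
    fix m assume m: "m \<in> {m. m < N \<and> m mod e = c}"
    define k where "k = m div e"
    have eq: "m = c + e * k" using mod_mult_div_eq[of m e] m by (auto simp: k_def)
    have "m < N" using m by auto
    hence "k * e + e \<le> N + (e - 1 - c)" using eq assms by (simp add: mult.commute)
    hence "(k + 1) * e \<le> N + (e - 1 - c)" by simp
    hence "k + 1 \<le> (N + (e - 1 - c)) div e" using assms by (simp only: less_eq_div_iff_mult_less_eq)
    hence "k < (N + (e - 1 - c)) div e" by simp
    thus "m \<in> (\<lambda>j. c + e * j) ` {..<(N + (e - 1 - c)) div e}" using eq by force
  next
    fix m assume "m \<in> (\<lambda>j. c + e * j) ` {..<(N + (e - 1 - c)) div e}"
    then obtain j where j: "m = c + e * j" "j + 1 \<le> (N + (e - 1 - c)) div e" by fastforce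
    hence "(j + 1) * e \<le> N + (e - 1 - c)" using assms by (simp add: less_eq_div_iff_mult_less_eq)
    hence "j * e + e \<le> N + (e - 1 - c)" by simp
    hence "m < N" using j(1) assms by (simp add: mult.commute)
    thus "m \<in> {m. m < N \<and> m mod e = c}" using j assms by auto
  qed
  moreover have "inj_on (\<lambda>j. c + e * j) A" for A using assms by (auto intro!: inj_onI)
  ultimately show ?thesis by (simp add: card_image)
qed

text \<open>As \<open>r\<close> is invertible modulo \<open>e\<close>, the divisibility confines
  \<open>m\<close> to a single residue class modulo \<open>e\<close>.\<close>

lemma card_linear_divisible:
  assumes "coprime e r" "e \<ge> 1"
  shows "\<bar>real (card {m. m < N \<and> e dvd b + r * m}) - real N / real e\<bar> \<le> 1"
proof -
  obtain u where u: "[r * u = 1] (mod e)" using cong_solve_coprime_nat[of r e] assms by (auto simp: coprime_commute)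
  \<comment> \<open>\<open>d\<close> represents -b modulo \<open>e\<close> as a natural number;
    \<open>c\<close> then solves \<open>r * c\<close> = -b modulo \<open>e\<close>.\<close>
  define d where "d = e - b mod e"
  define c where "c = (d * u) mod e"
  have ce: "c < e" using assms by (simp add: c_def)
  have "[c = d * u] (mod e)" by (simp add: c_def)
  hence "[b + r * c = b + r * (d * u)] (mod e)" by (intro cong_add cong_mult cong_refl)
  also have "b + r * (d * u) = b + d * (r * u)" by (simp add: mult_ac)
  also have "[\<dots> = b + d * 1] (mod e)" using u by (intro cong_add cong_mult cong_refl)
  also have "[b + d * 1 = b mod e + d] (mod e)"
    by (simp add: cong_def mod_simps)
  also have "b mod e + d = e" using assms by (simp add: d_def less_imp_le)
  finally have c: "[b + r * c = e] (mod e)" .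
  have iff: "e dvd b + r * m \<longleftrightarrow> m mod e = c" for m
  proof -
    have "e dvd b + r * m \<longleftrightarrow> [b + r * m = b + r * c] (mod e)"
      using c by (metis cong_0_iff cong_dvd_iff cong_sym cong_trans cong_def mod_self dvd_eq_mod_eq_0)
    also have "\<dots> \<longleftrightarrow> [m = c] (mod e)" using assms
      by (simp add: cong_add_lcancel_nat cong_mult_lcancel_nat coprime_commute)
    also have "\<dots> \<longleftrightarrow> m mod e = c" using ce by (simp add: cong_def)
    finally show ?thesis .
  qed
  have "card {m. m < N \<and> e dvd b + r * m} = (N + (e - 1 - c)) div e"
    using card_residue_class[OF ce] iff by simp
  moreover have "real ((N + (e - 1 - c)) div e) \<le> real N / real e + 1"
  proof -
    have "real ((N + (e - 1 - c)) div e) \<le> real (N + (e - 1 - c)) / real e"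
      using floor_divide_of_nat_eq[of "N + (e - 1 - c)" e, where ?'a=real] by linarith
    also have "\<dots> \<le> (real N + real e) / real e" using ce by (intro divide_right_mono) auto
    also have "\<dots> = real N / real e + 1" using assms by (simp add: add_divide_distrib)
    finally show ?thesis .
  qed
  moreover have "real N / real e - 1 \<le> real ((N + (e - 1 - c)) div e)"
  proof -
    have "real N / real e - 1 \<le> real (N + (e - 1 - c)) / real e - 1" by (auto intro!: divide_right_mono)
    also have "\<dots> \<le> real ((N + (e - 1 - c)) div e)"
      using floor_divide_of_nat_eq[of "N + (e - 1 - c)" e, where ?'a=real] by linarith
    finally show ?thesis .
  qed
  ultimately show ?thesis by linarith
qed

lemma prod_primes_dvd:
  assumes "finite S" "\<And>p. p \<in> S \<Longrightarrow> prime (p::nat)" "\<And>p. p \<in> S \<Longrightarrow> p dvd n"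
  shows "\<Prod>S dvd n"
  using assms
proof (induction S rule: finite_induct)
  case (insert p S)
  have "coprime p (\<Prod>S)" using insert by (intro prod_coprime_right primes_coprime) auto
  thus ?case using insert by (simp add: divides_mult)
qed auto

text \<open>The square of the sum of the weights over the \<open>S\<close> with \<Prod>S dividing
  \<open>b + r * m\<close> is non-negative for every \<open>m\<close> and equals 1 on the sifted
  set. Summing it over all \<open>m < N\<close> yields the quadratic form, plus an error of at most
  1 for each pair of sets.\<close>

lemma selberg_sieve:
  assumes "D \<ge> 1"
  shows "real (card {m. m < N \<and> (\<forall>p. prime p \<longrightarrow> p \<le> D \<longrightarrow> \<not> p dvd r \<longrightarrow> \<not> p dvd b + r * m)})
           \<le> real N / sieve_mass (sieve_sets r D) + real D ^ 4"
proof -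
  let ?F = "sieve_sets r D" and ?w = "selberg_weight (sieve_sets r D)"
  define A where "A = {m. m < N \<and> (\<forall>p. prime p \<longrightarrow> p \<le> D \<longrightarrow> \<not> p dvd r \<longrightarrow> \<not> p dvd b + r * m)}"
  have finF: "finite ?F" by (rule finite_sieve_sets)
  have G: "sieve_mass ?F \<ge> 1" using sieve_mass_ge_1 assms by auto
  define I where "I S m = (if \<Prod>S dvd b + r * m then 1 else 0 :: real)" for S m
  \<comment> \<open>A prime in a sieve set is at most the product \<open>D\<close>-bounded by
    definition, hence cannot divide a sifted number; only the empty set contributes, with weight
    1.\<close>
  have one: "(\<Sum>S\<in>?F. ?w S * I S m) = 1" if "m \<in> A" for m
  proof -
    have "(\<Sum>S\<in>?F. ?w S * I S m) = (\<Sum>S\<in>{{}}. ?w S * I S m)"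
    proof (rule sum.mono_neutral_right[OF finF])
      show "{{}} \<subseteq> ?F" using empty_in_sieve_sets[OF assms] by auto
      show "\<forall>S\<in>?F - {{}}. ?w S * I S m = 0"
      proof
        fix S assume S: "S \<in> ?F - {{}}"
        then obtain p where p: "p \<in> S" by auto
        have fS: "finite S" using S by (auto simp: sieve_sets_def)
        have pd: "p dvd \<Prod>S" using dvd_prodI[OF fS p, of "\<lambda>x. x"] by simp
        have "\<Prod>S \<ge> 1" using sieve_sets_image[of r D] S by force
        hence "p \<le> \<Prod>S" using pd by (intro dvd_imp_le) auto
        hence "p \<le> D" "prime p" "\<not> p dvd r" using S p by (auto simp: sieve_sets_def)
        hence "\<not> p dvd b + r * m" using that by (auto simp: A_def)
        thus "?w S * I S m = 0" using pd by (auto simp: I_def)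
      qed
    qed
    thus ?thesis using selberg_weight_empty[OF assms] by (simp add: I_def)
  qed
  have dvd_iff: "\<Prod>S dvd n \<and> \<Prod>T dvd n \<longleftrightarrow> \<Prod>(S \<union> T) dvd n" if "S \<in> ?F" "T \<in> ?F" for S T n
  proof
    assume n: "\<Prod>S dvd n \<and> \<Prod>T dvd n"
    show "\<Prod>(S \<union> T) dvd n"
    proof (rule prod_primes_dvd)
      show "finite (S \<union> T)" "\<And>p. p \<in> S \<union> T \<Longrightarrow> prime p" using that by (auto simp: sieve_sets_def)
      fix p assume "p \<in> S \<union> T"
      hence "p dvd \<Prod>S \<or> p dvd \<Prod>T" using that dvd_prodI[of S p "\<lambda>x. x"] dvd_prodI[of T p "\<lambda>x. x"]
        by (auto simp: sieve_sets_def)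
      thus "p dvd n" using n dvd_trans by blast
    qed
  next
    assume n: "\<Prod>(S \<union> T) dvd n"
    have f: "finite (S \<union> T)" using that by (auto simp: sieve_sets_def)
    show "\<Prod>S dvd n \<and> \<Prod>T dvd n"
      using dvd_trans[OF prod_dvd_prod_subset[OF f, of S "\<lambda>x. x"] n] dvd_trans[OF prod_dvd_prod_subset[OF f, of T "\<lambda>x. x"] n]
      by simp
  qed
  have cnt: "(\<Sum>m<N. I S m * I T m) \<le> real N / (\<Prod>p\<in>S \<union> T. real p) + 1 \<and>
             (\<Sum>m<N. I S m * I T m) \<ge> real N / (\<Prod>p\<in>S \<union> T. real p) - 1" 
    if ST: "S \<in> ?F" "T \<in> ?F" for S T
  proof -
    have "(\<Sum>m<N. I S m * I T m) = (\<Sum>m<N. if \<Prod>(S \<union> T) dvd b + r * m then 1 else 0)"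
      using dvd_iff[OF ST] by (intro sum.cong) (auto simp: I_def)
    also have "\<dots> = real (card {m. m < N \<and> \<Prod>(S \<union> T) dvd b + r * m})"
      by (simp add: sum.If_cases Int_def lessThan_def)
    finally have eq: "(\<Sum>m<N. I S m * I T m) = real (card {m. m < N \<and> \<Prod>(S \<union> T) dvd b + r * m})" .
    have "coprime (\<Prod>(S \<union> T)) r" using ST
      by (intro prod_coprime_left) (auto simp: sieve_sets_def prime_imp_coprime)
    moreover have "\<Prod>(S \<union> T) > 0" using ST by (intro prod_pos) (auto simp: sieve_sets_def prime_gt_0_nat)
    ultimately show ?thesis unfolding eq
      using card_linear_divisible[of "\<Prod>(S \<union> T)" r N b] by (auto simp: abs_le_iff)
  qed
  have "real (card A) = (\<Sum>m\<in>A. (\<Sum>S\<in>?F. ?w S * I S m)\<^sup>2)" using one by simp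
  also have "\<dots> \<le> (\<Sum>m<N. (\<Sum>S\<in>?F. ?w S * I S m)\<^sup>2)"
    by (rule sum_mono2) (auto simp: A_def)
  also have "\<dots> = (\<Sum>m<N. \<Sum>S\<in>?F. \<Sum>T\<in>?F. ?w S * ?w T * (I S m * I T m))"
    unfolding power2_eq_square sum_product by (intro sum.cong refl) (simp only: mult_ac)
  also have "\<dots> = (\<Sum>S\<in>?F. \<Sum>T\<in>?F. \<Sum>m<N. ?w S * ?w T * (I S m * I T m))"
    by (subst sum.swap, rule sum.cong[OF refl], rule sum.swap)
  also have "\<dots> = (\<Sum>S\<in>?F. \<Sum>T\<in>?F. ?w S * ?w T * (\<Sum>m<N. I S m * I T m))"
    by (simp add: sum_distrib_left)
  also have "\<dots> \<le> (\<Sum>S\<in>?F. \<Sum>T\<in>?F. ?w S * ?w T * (real N / (\<Prod>p\<in>S \<union> T. real p)) + \<bar>?w S\<bar> * \<bar>?w T\<bar>)"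
  proof (intro sum_mono)
    fix S T assume ST: "S \<in> ?F" "T \<in> ?F"
    define a where "a = ?w S * ?w T"
    define c where "c = (\<Sum>m<N. I S m * I T m)"
    define d where "d = real N / (\<Prod>p\<in>S \<union> T. real p)"
    have cd: "\<bar>c - d\<bar> \<le> 1" using cnt[OF ST, folded c_def d_def] by linarith
    have "a * (c - d) \<le> \<bar>a\<bar> * \<bar>c - d\<bar>" by (metis abs_ge_self abs_mult)
    also have "\<dots> \<le> \<bar>a\<bar> * 1" using cd by (intro mult_left_mono) auto
    finally have "a * c \<le> a * d + \<bar>a\<bar>" by (simp add: right_diff_distrib)
    thus "?w S * ?w T * (\<Sum>m<N. I S m * I T m) \<le> ?w S * ?w T * (real N / (\<Prod>p\<in>S \<union> T. real p)) + \<bar>?w S\<bar> * \<bar>?w T\<bar>"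
      by (simp only: a_def c_def d_def abs_mult)
  qed
  also have "\<dots> = real N * (\<Sum>S\<in>?F. \<Sum>T\<in>?F. ?w S * ?w T / (\<Prod>p\<in>S \<union> T. real p)) + (\<Sum>S\<in>?F. \<bar>?w S\<bar>) * (\<Sum>S\<in>?F. \<bar>?w S\<bar>)"
    by (simp add: sum.distrib sum_distrib_left sum_product algebra_simps)
  also have "(\<Sum>S\<in>?F. \<Sum>T\<in>?F. ?w S * ?w T / (\<Prod>p\<in>S \<union> T. real p)) = 1 / sieve_mass ?F"
    by (rule selberg_quadratic_form[OF finF _ sieve_sets_downward]) (use G in \<open>auto simp: sieve_sets_def\<close>)
  also have "(\<Sum>S\<in>?F. \<bar>?w S\<bar>) * (\<Sum>S\<in>?F. \<bar>?w S\<bar>) \<le> (real D * real D) * (real D * real D)"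
  proof -
    have "(\<Sum>S\<in>?F. \<bar>?w S\<bar>) \<le> (\<Sum>S\<in>?F. real D)" using abs_selberg_weight_le[OF assms] by (intro sum_mono)
    also have "\<dots> \<le> real D * real D" using card_sieve_sets[of r D] by (auto intro!: mult_right_mono)
    finally show ?thesis by (intro mult_mono) (auto intro: sum_nonneg)
  qed
  finally have "real (card A) \<le> real N * (1 / sieve_mass ?F) + real D * real D * (real D * real D)" by simp
  moreover have "real D * real D * (real D * real D) = real D ^ 4" by (simp add: power4_eq_xxxx)
  ultimately show ?thesis unfolding A_def by simp
qed

section \<open>Lower bound for the sieve mass\<close>

lemma sum_inverse_squares_le: "(\<Sum>a=1..D. 1 / real a ^ 2) \<le> 2"
proof -
  have "(\<Sum>a=1..D. 1 / real a ^ 2) \<le> 2 - 1 / real D" if "D \<ge> 1" for D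
    using that
  proof (induction D rule: dec_induct)
    case (step D)
    have "(\<Sum>a=1..Suc D. 1 / real a ^ 2) = (\<Sum>a=1..D. 1 / real a ^ 2) + 1 / real (Suc D) ^ 2"
      using step by simp
    also have "\<dots> \<le> 2 - 1 / real D + 1 / (real D * real (Suc D))"
      using step by (intro add_mono step.IH divide_left_mono) (auto simp: power2_eq_square)
    also have "\<dots> = 2 - 1 / real (Suc D)"
    proof -
      have "real D > 0" "real (Suc D) > 0" using step by auto
      thus ?thesis by (simp add: divide_simps del: of_nat_Suc) (simp add: algebra_simps)
    qed
    finally show ?case .
  qed auto
  note bound = this
  show ?thesis
  proof (cases "D \<ge> 1")
    case True
    have "0 \<le> 1 / real D" by simp
    with bound[OF True] show ?thesis by linarith
  qed simp
qed

lemma prod_prime_factors_squarefree: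
  assumes "squarefree (n::nat)"
  shows "\<Prod>(prime_factors n) = n"
proof -
  have n: "n > 0" using assms by (metis not_squarefree_0 gr0I)
  have "(\<Prod>p\<in>prime_factors n. p ^ multiplicity p n) = n"
    using n by (simp add: prod_prime_factors)
  moreover have "multiplicity p n = 1" if "p \<in> prime_factors n" for p
  proof -
    have "n \<noteq> 0" using n by simp
    hence "multiplicity p n \<le> 1" using assms squarefree_factorial_semiring''[of n] that by auto
    thus ?thesis using that by (simp add: prime_factors_multiplicity)
  qed
  ultimately show ?thesis by simp
qed

text \<open>Each \<open>n \<le> D\<close> is its squarefree part times a square, and the squarefree
  part splits into a factor prime to \<open>r\<close> and one composed of primes dividing
  \<open>r\<close>. The harmonic sum up to \<open>D\<close> is thus dominated by a product of three
  sums: the sieve mass (as 1/p is at most 1/(p - 1)), the Euler product over the primes of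
  \<open>r\<close>, and the sum of inverse squares, which is at most 2.\<close>

lemma sieve_mass_lower_bound:
  assumes "r \<ge> 1"
  shows "ln (real D + 1) \<le> 2 * (\<Prod>p\<in>prime_factors r. 1 + 1 / real p) * sieve_mass (sieve_sets r D)"
proof -
  let ?F = "sieve_sets r D"
  define S where "S n = prime_factors (squarefree_part n) - prime_factors r" for n :: nat
  define T where "T n = prime_factors (squarefree_part n) \<inter> prime_factors r" for n :: nat
  define g :: "nat set \<times> nat set \<times> nat \<Rightarrow> nat" where "g = (\<lambda>(S,T,a). \<Prod>S * \<Prod>T * a\<^sup>2)"
  define f where "f n = (S n, T n, square_part n)" for n :: nat
  have gf: "g (f n) = n" for n
  proof -
    have "\<Prod>(S n) * \<Prod>(T n) = \<Prod>(prime_factors (squarefree_part n))"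
      unfolding S_def T_def by (subst prod.union_disjoint[symmetric]) (auto intro!: prod.cong)
    also have "\<dots> = squarefree_part n" by (rule prod_prime_factors_squarefree) auto
    finally show ?thesis using squarefree_decompose[of n] by (simp add: f_def g_def)
  qed
  have maps: "f n \<in> ?F \<times> Pow (prime_factors r) \<times> {1..D}" if n: "n \<in> {1..D}" for n
  proof -
    have pos: "n \<noteq> 0" using n by auto
    have sn: "\<Prod>(S n) * (\<Prod>(T n) * (square_part n)\<^sup>2) = n" using gf[of n] by (simp add: f_def g_def mult_ac)
    have "\<Prod>(S n) dvd n" using sn by (metis dvd_triv_left)
    hence SD: "\<Prod>(S n) \<le> D" using n by (meson atLeastAtMost_iff dvd_imp_le le_trans less_le_trans zero_less_one)
    have "square_part n dvd n" using square_part_square_dvd[of n] by (metis dvd_mult_left power2_eq_square)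
    hence aD: "square_part n \<le> D" using n by (meson atLeastAtMost_iff dvd_imp_le le_trans less_le_trans zero_less_one)
    have "square_part n \<noteq> 0" using pos by (simp add: square_part_0_iff)
    hence a1: "square_part n \<ge> 1" by linarith
    have "S n \<in> ?F" unfolding sieve_sets_def mem_Collect_eq
    proof (intro conjI ballI SD)
      show "finite (S n)" by (simp add: S_def)
      fix p assume "p \<in> S n"
      thus "prime p" "\<not> p dvd r" using assms by (auto simp: S_def in_prime_factors_iff)
    qed
    moreover have "T n \<in> Pow (prime_factors r)" by (auto simp: T_def)
    ultimately show ?thesis unfolding f_def using aD a1 by (simp only: mem_Sigma_iff atLeastAtMost_iff)
  qed
  have "ln (real D + 1) \<le> harm D" by (rule ln_le_harm)
  also have "\<dots> = (\<Sum>n\<in>{1..D}. 1 / real (g (f n)))" by (simp add: gf harm_def inverse_eq_divide)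
  also have "\<dots> = (\<Sum>t\<in>f ` {1..D}. 1 / real (g t))"
    using gf by (subst sum.reindex) (auto intro!: inj_onI, metis)
  also have "\<dots> \<le> (\<Sum>t\<in>?F \<times> Pow (prime_factors r) \<times> {1..D}. 1 / real (g t))"
  proof (rule sum_mono2)
    show "f ` {1..D} \<subseteq> ?F \<times> Pow (prime_factors r) \<times> {1..D}" using maps by (rule image_subsetI)
  qed (use finite_sieve_sets in auto)
  also have "\<dots> = (\<Sum>S\<in>?F. \<Sum>T\<in>Pow (prime_factors r). \<Sum>a\<in>{1..D}. 1 / real (g (S,T,a)))"
    by (simp only: sum.cartesian_product) (simp add: case_prod_unfold)
  also have "\<dots> = (\<Sum>S\<in>?F. \<Sum>T\<in>Pow (prime_factors r). \<Sum>a\<in>{1..D}. 1 / (\<Prod>p\<in>S. real p) * (1 / (\<Prod>p\<in>T. real p) * (1 / real a ^ 2)))"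
    by (simp add: g_def mult_ac)
  also have "\<dots> = (\<Sum>S\<in>?F. 1 / (\<Prod>p\<in>S. real p)) * ((\<Sum>T\<in>Pow (prime_factors r). 1 / (\<Prod>p\<in>T. real p)) * (\<Sum>a\<in>{1..D}. 1 / real a ^ 2))"
    by (simp only: sum_distrib_left[symmetric] sum_distrib_right[symmetric])
  also have "(\<Sum>T\<in>Pow (prime_factors r). 1 / (\<Prod>p\<in>T. real p)) = (\<Prod>p\<in>prime_factors r. 1 + 1 / real p)"
  proof -
    have "(\<Prod>p\<in>prime_factors r. 1 / real p + 1) = (\<Sum>T\<in>Pow (prime_factors r). (\<Prod>p\<in>T. 1 / real p) * (\<Prod>p\<in>prime_factors r - T. 1))"
      by (rule prod_add) auto
    thus ?thesis by (simp add: add.commute prod_dividef)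
  qed
  also have "(\<Sum>S\<in>?F. 1 / (\<Prod>p\<in>S. real p)) * ((\<Prod>p\<in>prime_factors r. 1 + 1 / real p) * (\<Sum>a\<in>{1..D}. 1 / real a ^ 2))
     \<le> sieve_mass ?F * ((\<Prod>p\<in>prime_factors r. 1 + 1 / real p) * 2)"
  proof (intro mult_mono mult_nonneg_nonneg prod_nonneg sum_inverse_squares_le sum_nonneg)
    show "(\<Sum>S\<in>?F. 1 / (\<Prod>p\<in>S. real p)) \<le> sieve_mass ?F" unfolding sieve_mass_def
    proof (rule sum_mono)
      fix S assume S: "S \<in> ?F"
      have "(\<Prod>p\<in>S. real p - 1) \<le> (\<Prod>p\<in>S. real p)"
        using S by (intro prod_mono) (auto simp: sieve_sets_def dest!: prime_ge_1_nat)
      thus "1 / (\<Prod>p\<in>S. real p) \<le> 1 / (\<Prod>p\<in>S. real p - 1)"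
        using sieve_phi_ge_1[OF S] by (intro divide_left_mono mult_pos_pos) linarith+
    qed
    show "0 \<le> sieve_mass ?F" unfolding sieve_mass_def
      using sieve_phi_ge_1[of _ r D] by (intro sum_nonneg) (metis divide_nonneg_nonneg order_trans zero_le_one)
  qed auto
  finally show ?thesis by (simp add: mult_ac)
qed

section \<open>A Brun-Titchmarsh inequality for prime powers\<close>

lemma card_non_prime_primepows:
  assumes "Y \<ge> 1"
  shows "real (card {t. primepow t \<and> \<not> prime t \<and> real t \<le> Y}) \<le> sqrt Y * log 2 Y"
    and "finite {t::nat. primepow t \<and> \<not> prime t \<and> real t \<le> Y}"
proof -
  let ?A = "{t::nat. primepow t \<and> \<not> prime t \<and> real t \<le> Y}"
  let ?B = "{1..nat \<lfloor>sqrt Y\<rfloor>} \<times> {1..nat \<lfloor>log 2 Y\<rfloor>}"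
  have sub: "?A \<subseteq> (\<lambda>(p,v). p ^ v) ` ?B"
  proof
    fix t assume t: "t \<in> ?A"
    then obtain p v where pv: "prime p" "v > 0" "t = p ^ v" by (auto simp: primepow_def)
    have v: "v \<ge> 2" using pv t by (metis (mono_tags, lifting) One_nat_def Suc_leI le_neq_implies_less mem_Collect_eq numeral_2_eq_2 power_one_right)
    have p: "p \<ge> 2" using pv prime_ge_2_nat by auto
    have tY: "real p ^ v \<le> Y" using t pv by simp
    have "real p ^ 2 \<le> real p ^ v" using v p by (intro power_increasing) auto
    hence "real p \<le> sqrt Y" using tY by (intro real_le_rsqrt) linarith
    moreover have "2 ^ v \<le> Y"
      using power_mono[of 2 "real p" v] p tY by linarith
    hence "real v \<le> log 2 Y" using assms by (subst le_log_iff) (auto simp: powr_realpow)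
    ultimately show "t \<in> (\<lambda>(p,v). p ^ v) ` ?B" using pv p v
      by (auto intro!: image_eqI[of _ _ "(p,v)"] simp: le_nat_iff le_floor_iff intro: le_nat_floor)
  qed
  show "finite ?A" using finite_subset[OF sub] by auto
  have "card ?A \<le> card ?B" using surj_card_le[OF _ sub] by auto
  hence "real (card ?A) \<le> real (nat \<lfloor>sqrt Y\<rfloor>) * real (nat \<lfloor>log 2 Y\<rfloor>)"
    by (simp flip: of_nat_mult)
  also have "\<dots> \<le> sqrt Y * log 2 Y" using assms
    by (intro mult_mono) (auto simp: zero_le_log_cancel_iff)
  finally show "real (card ?A) \<le> sqrt Y * log 2 Y" .
qed

text \<open>This is the Brun-Titchmarsh inequality for prime powers, with the product of 1 + 1/p in
  the place of r/phi(r). The threshold is the argument, so that a single \<open>Y0\<close>, fixed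
  once and independent of all other data, can be handed through the proof.\<close>

definition progression_bound :: "real \<Rightarrow> bool" where
  "progression_bound Y0 \<longleftrightarrow> Y0 \<ge> 2 \<and> (\<forall>Y\<ge>Y0. \<forall>r b. 1 \<le> r \<longrightarrow> real r \<le> Y powr (1/4) \<longrightarrow> coprime b r \<longrightarrow>
     real (card {t. primepow t \<and> real t \<le> Y \<and> [t = b] (mod r)})
       \<le> 33 * (Y / (real r * ln Y)) * (\<Prod>p\<in>prime_factors r. 1 + 1 / real p))"

lemma progression_boundD:
  assumes "progression_bound Y0"
  shows "Y0 \<ge> 2" "\<And>Y r b. Y \<ge> Y0 \<Longrightarrow> 1 \<le> r \<Longrightarrow> real r \<le> Y powr (1/4) \<Longrightarrow> coprime b r \<Longrightarrow>
     real (card {t. primepow t \<and> real t \<le> Y \<and> [t = b] (mod r)})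
       \<le> 33 * (Y / (real r * ln Y)) * (\<Prod>p\<in>prime_factors r. 1 + 1 / real p)"
  using assms by (auto simp: progression_bound_def)

lemma card_primepows_in_progression_le:
  "\<exists>Y0. progression_bound Y0"
proof -
  have "eventually (\<lambda>Y::real. Y \<ge> 2 \<and> 1 + 2 * sqrt Y + sqrt Y * log 2 Y \<le> Y powr (3/4) / ln Y) at_top"
    by (intro eventually_conj eventually_ge_at_top) real_asymp
  then obtain Y1 where Y1: "\<And>Y. Y \<ge> Y1 \<Longrightarrow> Y \<ge> 2 \<and> 1 + 2 * sqrt Y + sqrt Y * log 2 Y \<le> Y powr (3/4) / ln Y"
    unfolding eventually_at_top_linorder by auto
  show ?thesis unfolding progression_bound_def
  proof (rule exI[of _ "max 2 Y1"], intro conjI allI impI)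
    fix Y :: real and r b :: nat
    assume Y: "max 2 Y1 \<le> Y" and r: "1 \<le> r" "real r \<le> Y powr (1/4)" and cop: "coprime b r"
    have Y2: "Y \<ge> 2" using Y by auto
    have lnY: "ln Y > 0" using Y2 by simp
    define P where "P = (\<Prod>p\<in>prime_factors r. 1 + 1 / real p)"
    have P: "P \<ge> 1" unfolding P_def by (intro prod_ge_1) auto
    \<comment> \<open>With this level the remainder \<open>D ^ 4\<close> is at most
      \<open>sqrt Y\<close>, below the main term because \<open>r \<le> Y powr (1/4)\<close> leaves
      \<open>Y / real r\<close> at least \<open>Y powr (3/4)\<close>.\<close>
    define D where "D = nat \<lfloor>Y powr (1/8)\<rfloor>"
    have D: "real D \<le> Y powr (1/8)" "Y powr (1/8) \<le> real D + 1" "D \<ge> 1"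
      using Y2 ge_one_powr_ge_zero[of Y "1/8"] unfolding D_def by (auto simp: le_nat_iff le_floor_iff)
    define N where "N = nat \<lfloor>Y / real r\<rfloor> + 1"
    have Yr: "Y powr (3/4) \<le> Y / real r"
    proof -
      have "Y powr (3/4) * real r \<le> Y powr (3/4) * Y powr (1/4)" using r by (intro mult_left_mono) auto
      also have "\<dots> = Y" using Y2 by (simp flip: powr_add)
      finally show ?thesis using r by (simp add: field_simps)
    qed
    have "1 \<le> Y powr (3/4)" using Y2 by (intro ge_one_powr_ge_zero) auto
    hence N: "real N \<le> 2 * (Y / real r)" unfolding N_def using Yr by linarith
    define A where "A = {t. primepow t \<and> real t \<le> Y \<and> [t = b] (mod r)}"
    define B where "B = {m. m < N \<and> (\<forall>p. prime p \<longrightarrow> p \<le> D \<longrightarrow> \<not> p dvd r \<longrightarrow> \<not> p dvd (b mod r) + r * m)}"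
    \<comment> \<open>A prime above \<open>D\<close> has no prime factor up to \<open>D\<close>, so
      its quotient by \<open>r\<close> is counted by the sieve; everything else is a prime up to
      \<open>D\<close> or a proper prime power.\<close>
    have sub: "A \<subseteq> {t. primepow t \<and> \<not> prime t \<and> real t \<le> Y} \<union> {..D} \<union> (\<lambda>m. b mod r + r * m) ` B"
    proof
      fix t assume t: "t \<in> A"
      show "t \<in> {t. primepow t \<and> \<not> prime t \<and> real t \<le> Y} \<union> {..D} \<union> (\<lambda>m. b mod r + r * m) ` B"
      proof (cases "prime t \<and> t > D")
        case True
        have tb: "t mod r = b mod r" using t by (auto simp: A_def cong_def)
        have eq: "t = b mod r + r * (t div r)" using mod_mult_div_eq[of t r] tb by simp
        have "real (t div r) \<le> real t / real r"
          using floor_divide_of_nat_eq[of t r, where ?'a=real] by linarith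
        also have "\<dots> \<le> Y / real r" using t by (intro divide_right_mono) (auto simp: A_def)
        finally have "t div r < N" unfolding N_def by (simp add: le_nat_floor less_Suc_eq_le)
        moreover have "\<not> p dvd t" if "prime p" "p \<le> D" for p
          using True that by (metis primes_dvd_imp_eq leD)
        ultimately have "t div r \<in> B" unfolding B_def using eq by auto
        thus ?thesis using eq by blast
      qed (use t in \<open>auto simp: A_def\<close>)
    qed
    have finB: "finite B" unfolding B_def by auto
    have "real (card A) \<le> real (card ({t. primepow t \<and> \<not> prime t \<and> real t \<le> Y} \<union> {..D} \<union> (\<lambda>m. b mod r + r * m) ` B))"
      using card_non_prime_primepows(2)[of Y] Y2 finB by (intro of_nat_mono card_mono[OF _ sub]) auto
    also have "\<dots> \<le> real (card {t::nat. primepow t \<and> \<not> prime t \<and> real t \<le> Y} + card {..D} + card B)"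
      by (intro of_nat_mono order.trans[OF card_Un_le] add_mono card_image_le finB order_refl)
    also have "\<dots> \<le> sqrt Y * log 2 Y + (real D + 1) + (real N / sieve_mass (sieve_sets r D) + real D ^ 4)"
      using card_non_prime_primepows(1)[of Y] Y2 selberg_sieve[OF D(3), of N r "b mod r"] by (simp add: B_def)
    also have "real D + 1 \<le> sqrt Y + 1"
    proof -
      have "Y powr (1/8) \<le> Y powr (1/2)" using Y2 by (intro powr_mono) auto
      thus ?thesis using D Y2 by (simp add: powr_half_sqrt)
    qed
    also have "real D ^ 4 \<le> sqrt Y"
    proof -
      have "real D ^ 4 \<le> (Y powr (1/8)) ^ 4" using D by (intro power_mono) auto
      also have "\<dots> = Y powr (1/8 * 4)" using Y2 by (subst powr_power) auto
      also have "\<dots> = sqrt Y" using Y2 by (simp add: powr_half_sqrt)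
      finally show ?thesis .
    qed
    finally have "real (card A) \<le> (1 + 2 * sqrt Y + sqrt Y * log 2 Y) + real N / sieve_mass (sieve_sets r D)"
      by simp
    also have "\<dots> \<le> 33 * (Y / (real r * ln Y)) * P"
    proof -
      have "1 + 2 * sqrt Y + sqrt Y * log 2 Y \<le> Y powr (3/4) / ln Y" using Y1[of Y] Y by auto
      also have "\<dots> \<le> (Y / real r) / ln Y * 1" using divide_right_mono[OF Yr, of "ln Y"] lnY by simp
      also have "\<dots> \<le> (Y / real r) / ln Y * P" using P lnY Y2 by (intro mult_left_mono) auto
      finally have 1: "1 + 2 * sqrt Y + sqrt Y * log 2 Y \<le> (Y / real r) / ln Y * P" .
      define G where "G = sieve_mass (sieve_sets r D)"
      have G: "G \<ge> 1" using sieve_mass_ge_1[OF D(3)] by (simp add: G_def)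
      \<comment> \<open>The constant is 33 = 2 * 16 + 1: a factor 2 from \<open>N\<close>, 16 = 8 *
        2 from the level \<open>Y powr (1/8)\<close> and the mass bound, and 1 for all lower-order
        terms.\<close>
      have "ln Y / 8 = ln (Y powr (1/8))" using Y2 by (simp add: ln_powr)
      also have "\<dots> \<le> ln (real D + 1)" using D(2) Y2 by (subst ln_le_cancel_iff) auto
      also have "\<dots> \<le> 2 * P * G" using sieve_mass_lower_bound[OF r(1), of D] by (simp add: P_def G_def)
      finally have "ln Y \<le> 16 * P * G" by simp
      hence "1 / G \<le> 16 * P / ln Y" using lnY G by (simp add: field_simps)
      hence "real N * (1 / G) \<le> (2 * (Y / real r)) * (16 * P / ln Y)" using N Y2 G by (intro mult_mono) auto
      moreover have "(2 * (Y / real r)) * (16 * P / ln Y) + (Y / real r) / ln Y * P = 33 * (Y / (real r * ln Y)) * P"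
        by (simp add: algebra_simps)
      moreover have "real N / G = real N * (1 / G)" by simp
      ultimately show ?thesis using 1 unfolding G_def[symmetric] by linarith
    qed
    finally show "real (card {t. primepow t \<and> real t \<le> Y \<and> [t = b] (mod r)})
       \<le> 33 * (Y / (real r * ln Y)) * (\<Prod>p\<in>prime_factors r. 1 + 1 / real p)"
       by (simp add: A_def P_def)
  qed auto
qed

section \<open>Weyl sums and the Chinese Remainder Theorem\<close>

text \<open>The twist \<open>u\<close> is kept apart from the frequency \<open>h\<close> because the
  average is later taken over \<open>u\<close> modulo \<open>q\<close> with \<open>h\<close>
  fixed.\<close>

definition weyl :: "nat \<Rightarrow> (nat \<Rightarrow> (nat \<Rightarrow> nat) set) \<Rightarrow> nat \<Rightarrow> (nat \<Rightarrow> int) \<Rightarrow> nat \<Rightarrow> complex" where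
  "weyl n A q h u = (\<Sum>a\<in>crt_set n A q. cis (2 * pi * (real_of_int (int u * (\<Sum>i<n. h i * int (a i))) / real q)))
      / of_nat (rho n A q)"

text \<open>The probability that two independent uniform points of A_q take the same value under
  \<open>h\<close> modulo \<open>q\<close>; equivalently, the mean square of the Weyl sums over all
  twists.\<close>

definition collision_ratio :: "nat \<Rightarrow> (nat \<Rightarrow> (nat \<Rightarrow> nat) set) \<Rightarrow> (nat \<Rightarrow> int) \<Rightarrow> nat \<Rightarrow> real" where
  "collision_ratio n A h q =
     real (card {(x, y) \<in> crt_set n A q \<times> crt_set n A q.
                   [(\<Sum>i<n. h i * int (x i)) = (\<Sum>i<n. h i * int (y i))] (mod int q)})
     / (real (rho n A q))\<^sup>2"

lemma finite_crt_set: "finite (crt_set n A q)"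
proof -
  have "finite (residue_vecs n q)" unfolding residue_vecs_def by (intro finite_PiE) auto
  thus ?thesis by (rule finite_subset[rotated]) (auto simp: crt_set_def)
qed

lemma cis_cong_mod:
  assumes "[k = l] (mod int q)" "q \<ge> 1"
  shows "cis (2 * pi * (real_of_int k / real q)) = cis (2 * pi * (real_of_int l / real q))"
proof -
  obtain j where "k = l + int q * j" using assms(1) by (metis cong_iff_lin cong_sym)
  hence "2 * pi * (real_of_int k / real q) = 2 * pi * (real_of_int l / real q) + 2 * pi * real_of_int j"
    using assms(2) by (simp add: field_simps)
  moreover have "cis (2 * pi * real_of_int j) = 1" by (rule cis_multiple_2pi) auto
  ultimately show ?thesis by (simp flip: cis_mult)
qed

lemma reduce_vec_reduce_vec:
  "d dvd m \<Longrightarrow> reduce_vec n d (reduce_vec n m x) = reduce_vec n d x"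
  by (auto simp: reduce_vec_def mod_mod_cancel)

lemma reduce_vec_residue_vecs: "m \<ge> 1 \<Longrightarrow> reduce_vec n m x \<in> residue_vecs n m"
  by (auto simp: reduce_vec_def residue_vecs_def)

lemma multiplicity_coprime_mult:
  assumes "coprime r s" "prime (p::nat)" "p dvd r" "r \<ge> 1" "s \<ge> 1"
  shows "multiplicity p (r * s) = multiplicity p r"
proof -
  have "\<not> p dvd s" using assms by (metis coprime_common_divisor not_prime_unit)
  hence "multiplicity p s = 0" by (rule not_dvd_imp_multiplicity_0)
  thus ?thesis using assms by (subst prime_elem_multiplicity_mult_distrib) auto
qed

lemma crt_set_mult_iff:
  assumes cop: "coprime r s" and "r \<ge> 1" "s \<ge> 1" and x: "x \<in> residue_vecs n (r * s)"
  shows "x \<in> crt_set n A (r * s) \<longleftrightarrow> reduce_vec n r x \<in> crt_set n A r \<and> reduce_vec n s x \<in> crt_set n A s"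
proof -
  have pf: "prime_factors (r * s) = prime_factors r \<union> prime_factors s"
    using assms by (intro prime_factors_product) auto
  have 1: "multiplicity p (r * s) = multiplicity p r" if "p \<in> prime_factors r" for p
    using that assms by (intro multiplicity_coprime_mult) (auto simp: in_prime_factors_iff)
  have 2: "multiplicity p (r * s) = multiplicity p s" if "p \<in> prime_factors s" for p
    using that assms multiplicity_coprime_mult[of s r p] by (auto simp: in_prime_factors_iff coprime_commute mult.commute)
  have "(\<forall>p\<in>prime_factors (r * s). reduce_vec n (p ^ multiplicity p (r * s)) x \<in> A (p ^ multiplicity p (r * s)))
    \<longleftrightarrow> (\<forall>p\<in>prime_factors r. reduce_vec n (p ^ multiplicity p r) x \<in> A (p ^ multiplicity p r)) \<and>
        (\<forall>p\<in>prime_factors s. reduce_vec n (p ^ multiplicity p s) x \<in> A (p ^ multiplicity p s))"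
    by (simp add: pf ball_Un 1 2 cong: ball_cong)
  thus ?thesis unfolding crt_set_def using assms
    by (simp add: reduce_vec_reduce_vec[OF multiplicity_dvd] reduce_vec_residue_vecs)
qed

lemma crt_set_bij:
  assumes cop: "coprime r s" and rs: "r \<ge> 1" "s \<ge> 1"
  shows "bij_betw (\<lambda>x. (reduce_vec n r x, reduce_vec n s x)) (crt_set n A (r * s)) (crt_set n A r \<times> crt_set n A s)"
  unfolding bij_betw_def
proof (intro conjI)
  show "inj_on (\<lambda>x. (reduce_vec n r x, reduce_vec n s x)) (crt_set n A (r * s))"
  proof (rule inj_onI)
    fix x y assume xy: "x \<in> crt_set n A (r * s)" "y \<in> crt_set n A (r * s)"
      and eq: "(reduce_vec n r x, reduce_vec n s x) = (reduce_vec n r y, reduce_vec n s y)"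
    have x: "x \<in> residue_vecs n (r * s)" "y \<in> residue_vecs n (r * s)" using xy by (auto simp: crt_set_def)
    have "x i = y i" if i: "i < n" for i
    proof -
      have "x i mod r = y i mod r" "x i mod s = y i mod s"
        using eq i by (auto simp: reduce_vec_def fun_eq_iff dest!: spec[of _ i])
      hence "[x i = y i] (mod r * s)" using cop by (auto simp: cong_def intro: coprime_cong_mult_nat[unfolded cong_def])
      moreover have "x i < r * s" "y i < r * s" using x i by (auto simp: residue_vecs_def PiE_def Pi_def)
      ultimately show ?thesis by (simp add: cong_def)
    qed
    thus "x = y" using x by (intro PiE_ext[of x "{..<n}" _ y]) (auto simp: residue_vecs_def)
  qed
  show "(\<lambda>x. (reduce_vec n r x, reduce_vec n s x)) ` crt_set n A (r * s) = crt_set n A r \<times> crt_set n A s"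
  proof (intro equalityI subsetI)
    fix t assume "t \<in> (\<lambda>x. (reduce_vec n r x, reduce_vec n s x)) ` crt_set n A (r * s)"
    then obtain x where x: "x \<in> crt_set n A (r * s)" "t = (reduce_vec n r x, reduce_vec n s x)" by auto
    moreover have "x \<in> residue_vecs n (r * s)" using x by (auto simp: crt_set_def)
    ultimately show "t \<in> crt_set n A r \<times> crt_set n A s"
      using crt_set_mult_iff[OF cop rs] by auto
  next
    fix t assume "t \<in> crt_set n A r \<times> crt_set n A s"
    then obtain y z where yz: "t = (y, z)" "y \<in> crt_set n A r" "z \<in> crt_set n A s" by auto
    have "\<exists>w. [w = y i] (mod r) \<and> [w = z i] (mod s)" for i
      using binary_chinese_remainder_nat[OF cop] by blast
    then obtain w where w: "\<And>i. [w i = y i] (mod r)" "\<And>i. [w i = z i] (mod s)" by metis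
    define x where "x = reduce_vec n (r * s) w"
    have xr: "x \<in> residue_vecs n (r * s)" unfolding x_def using rs by (intro reduce_vec_residue_vecs) auto
    have red: "reduce_vec n m w = v" if "\<And>i. [w i = v i] (mod m)" "v \<in> residue_vecs n m" for v m
      using that by (auto simp: reduce_vec_def residue_vecs_def cong_def PiE_def extensional_def fun_eq_iff Pi_def)
    have "reduce_vec n r x = y" "reduce_vec n s x = z"
      unfolding x_def using yz w by (auto simp: reduce_vec_reduce_vec crt_set_def intro!: red)
    thus "t \<in> (\<lambda>x. (reduce_vec n r x, reduce_vec n s x)) ` crt_set n A (r * s)"
      using crt_set_mult_iff[OF cop rs xr, of A] yz by force
  qed
qed

lemma rho_mult: "coprime r s \<Longrightarrow> r \<ge> 1 \<Longrightarrow> s \<ge> 1 \<Longrightarrow> rho n A (r * s) = rho n A r * rho n A s"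
  using bij_betw_same_card[OF crt_set_bij] by (simp add: rho_def card_cartesian_product)

lemma dot_reduce_vec_cong:
  "[(\<Sum>i<n. h i * int (reduce_vec n m x i)) = (\<Sum>i<n. h i * int (x i))] (mod int m)"
  by (intro cong_sum cong_mult cong_refl) (auto simp: reduce_vec_def cong_def zmod_int)

lemma norm_weyl_le_1: "norm (weyl n A q h u) \<le> 1"
proof -
  have "norm (\<Sum>a\<in>crt_set n A q. cis (2 * pi * (real_of_int (int u * (\<Sum>i<n. h i * int (a i))) / real q)))
     \<le> (\<Sum>a\<in>crt_set n A q. 1)" by (rule sum_norm_le) auto
  thus ?thesis by (cases "rho n A q = 0") (auto simp: weyl_def rho_def norm_divide divide_simps)
qed

text \<open>The Weyl sum modulo \<open>r * s\<close> factors exactly into twisted sums modulo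
  \<open>r\<close> and \<open>s\<close>; the factor modulo \<open>s\<close> is bounded by 1 and
  discarded.\<close>

lemma norm_weyl_mult_le:
  assumes cop: "coprime r s" and rs: "r \<ge> 1" "s \<ge> 1" and u: "[s * u = 1] (mod r)"
  shows "norm (weyl n A (r * s) h 1) \<le> norm (weyl n A r h u)"
proof -
  obtain v where v: "[r * v = 1] (mod s)" using cong_solve_coprime_nat[of r s] cop by (auto simp: coprime_commute)
  \<comment> \<open>Hence \<open>s * u + r * v\<close> is 1 modulo \<open>r * s\<close>, that is,
    1/(rs) and u/r + v/s agree modulo 1/1 after multiplication by any integer; this splits the
    phase.\<close>
  have "[s * u + r * v = 1 + 0] (mod r)" by (intro cong_add u) (auto simp: cong_def)
  moreover have "[s * u + r * v = 0 + 1] (mod s)" by (intro cong_add v) (auto simp: cong_def)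
  ultimately have "[s * u + r * v = 1] (mod r * s)" using cop by (auto intro: coprime_cong_mult_nat)
  hence uv: "[int s * int u + int r * int v = 1] (mod int (r * s))"
    by (metis cong_int_iff of_nat_1 of_nat_add of_nat_mult)
  define E where "E m w k = cis (2 * pi * (real_of_int (int w * k) / real m))" for m w k
  define dot where "dot x = (\<Sum>i<n. h i * int (x i))" for x
  have split: "E (r * s) 1 (dot x) = E r u (dot (reduce_vec n r x)) * E s v (dot (reduce_vec n s x))" for x
  proof -
    have "[dot x * 1 = dot x * (int s * int u + int r * int v)] (mod int (r * s))"
      by (intro cong_mult cong_refl cong_sym[OF uv])
    hence "E (r * s) 1 (dot x) = cis (2 * pi * (real_of_int (dot x * (int s * int u + int r * int v)) / real (r * s)))"
      unfolding E_def using rs by (intro cis_cong_mod) (auto simp: mult_ac)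
    also have "2 * pi * (real_of_int (dot x * (int s * int u + int r * int v)) / real (r * s))
       = 2 * pi * (real_of_int (int u * dot x) / real r) + 2 * pi * (real_of_int (int v * dot x) / real s)"
      using rs by (simp add: field_simps)
    also have "cis \<dots> = E r u (dot x) * E s v (dot x)" by (simp add: E_def cis_mult)
    also have "E r u (dot x) = E r u (dot (reduce_vec n r x))" unfolding E_def dot_def
      by (intro cis_cong_mod cong_mult cong_refl rs cong_sym[OF dot_reduce_vec_cong])
    also have "E s v (dot x) = E s v (dot (reduce_vec n s x))" unfolding E_def dot_def
      by (intro cis_cong_mod cong_mult cong_refl rs cong_sym[OF dot_reduce_vec_cong])
    finally show ?thesis .
  qed
  have "(\<Sum>x\<in>crt_set n A (r * s). E (r * s) 1 (dot x))
      = (\<Sum>(y,z)\<in>crt_set n A r \<times> crt_set n A s. E r u (dot y) * E s v (dot z))"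
    by (subst sum.reindex_bij_betw[OF crt_set_bij[OF cop rs], symmetric]) (simp only: prod.case split)
  also have "\<dots> = (\<Sum>y\<in>crt_set n A r. E r u (dot y)) * (\<Sum>z\<in>crt_set n A s. E s v (dot z))"
    by (simp add: sum_product sum.cartesian_product)
  finally have "weyl n A (r * s) h 1 = weyl n A r h u * weyl n A s h v"
    using rho_mult[OF cop rs, of n A] by (simp add: weyl_def E_def dot_def)
  thus ?thesis using norm_weyl_le_1[of n A s h v] by (simp add: norm_mult mult_left_le)
qed

section \<open>Orthogonality and collision probabilities\<close>

lemma sum_cis_residues:
  assumes "q \<ge> 1"
  shows "(\<Sum>b<q. cis (2 * pi * (real_of_int (int b * k) / real q))) = (if int q dvd k then of_nat q else 0)"
proof (cases "int q dvd k")
  case True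
  have "cis (2 * pi * (real_of_int (int b * k) / real q)) = 1" for b
  proof -
    have "[int b * k = 0] (mod int q)" using True by (simp add: cong_0_iff)
    thus ?thesis using cis_cong_mod[of "int b * k" 0 q] assms by simp
  qed
  thus ?thesis using True by simp
next
  case False
  define z where "z = cis (2 * pi * (real_of_int k / real q))"
  have pow: "cis (2 * pi * (real_of_int (int b * k) / real q)) = z ^ b" for b
  proof -
    have "2 * pi * (real_of_int (int b * k) / real q) = real b * (2 * pi * (real_of_int k / real q))" by simp
    hence "cis (2 * pi * (real_of_int (int b * k) / real q)) = cis (real b * (2 * pi * (real_of_int k / real q)))"
      by (rule arg_cong)
    also have "\<dots> = z ^ b" unfolding z_def by (rule Complex.DeMoivre[symmetric])
    finally show ?thesis .
  qed
  have zq: "z ^ q = 1"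
  proof -
    have "z ^ q = cis (2 * pi * real_of_int k)" unfolding z_def Complex.DeMoivre using assms by (simp add: field_simps)
    thus ?thesis by (simp add: cis_multiple_2pi)
  qed
  have "z \<noteq> 1"
  proof
    assume "z = 1"
    hence "cos (2 * pi * (real_of_int k / real q)) = 1" unfolding z_def by (metis cis.sel(1) one_complex.sel(1))
    then obtain j where "2 * pi * (real_of_int k / real q) = real_of_int j * 2 * pi"
      unfolding cos_one_2pi_int by blast
    hence "real_of_int k = real_of_int (int q * j)" using assms by (simp add: field_simps)
    hence "k = int q * j" by (simp only: of_int_eq_iff)
    thus False using False by simp
  qed
  hence "(\<Sum>b<q. z ^ b) = 0" using zq by (simp add: geometric_sum)
  hence "(\<Sum>b<q. cis (2 * pi * (real_of_int (int b * k) / real q))) = 0" by (simp only: pow)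
  thus ?thesis using False by simp
qed

lemma sum_norm_weyl_sq:
  assumes "q \<ge> 1"
  shows "(\<Sum>b<q. (norm (weyl n A q h b))\<^sup>2) = real q * collision_ratio n A h q"
proof -
  define dot where "dot x = (\<Sum>i<n. h i * int (x i))" for x
  define E where "E b k = cis (2 * pi * (real_of_int (int b * k) / real q))" for b k
  let ?C = "crt_set n A q"
  have "(\<Sum>b<q. of_real ((norm (\<Sum>a\<in>?C. E b (dot a)))\<^sup>2)) = (\<Sum>b<q. \<Sum>x\<in>?C. \<Sum>y\<in>?C. E b (dot x - dot y))"
  proof (rule sum.cong[OF refl])
    fix b
    have "of_real ((norm (\<Sum>a\<in>?C. E b (dot a)))\<^sup>2) = (\<Sum>a\<in>?C. E b (dot a)) * cnj (\<Sum>a\<in>?C. E b (dot a))"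
      by (rule complex_norm_square)
    also have "\<dots> = (\<Sum>x\<in>?C. \<Sum>y\<in>?C. E b (dot x) * cnj (E b (dot y)))"
      by (simp add: sum_product)
    also have "\<dots> = (\<Sum>x\<in>?C. \<Sum>y\<in>?C. E b (dot x - dot y))"
      by (intro sum.cong refl) (simp add: E_def cis_cnj cis_mult right_diff_distrib diff_divide_distrib)
    finally show "of_real ((norm (\<Sum>a\<in>?C. E b (dot a)))\<^sup>2) = (\<Sum>x\<in>?C. \<Sum>y\<in>?C. E b (dot x - dot y))" .
  qed
  also have "\<dots> = (\<Sum>x\<in>?C. \<Sum>y\<in>?C. \<Sum>b<q. E b (dot x - dot y))"
    by (subst sum.swap, rule sum.cong[OF refl], rule sum.swap)
  also have "\<dots> = (\<Sum>x\<in>?C. \<Sum>y\<in>?C. if int q dvd (dot x - dot y) then of_nat q else 0)"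
    unfolding E_def using sum_cis_residues[OF assms] by (simp only:)
  also have "\<dots> = (\<Sum>(x,y)\<in>?C \<times> ?C. if [dot x = dot y] (mod int q) then of_nat q else 0)"
    by (simp add: sum.cartesian_product cong_iff_dvd_diff)
  also have "\<dots> = (\<Sum>p\<in>{p\<in>?C \<times> ?C. [dot (fst p) = dot (snd p)] (mod int q)}. of_nat q)"
    by (subst sum.inter_filter) (auto simp: finite_crt_set case_prod_unfold)
  also have "{p\<in>?C \<times> ?C. [dot (fst p) = dot (snd p)] (mod int q)} = {(x,y)\<in>?C \<times> ?C. [dot x = dot y] (mod int q)}"
    by auto
  also have "(\<Sum>p\<in>\<dots>. of_nat q) = complex_of_real (real q * real (card {(x,y)\<in>?C \<times> ?C. [dot x = dot y] (mod int q)}))"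
    by simp
  finally have "(\<Sum>b<q. (norm (\<Sum>a\<in>?C. E b (dot a)))\<^sup>2) = real q * real (card {(x,y)\<in>?C \<times> ?C. [dot x = dot y] (mod int q)})"
    by (simp only: of_real_sum[symmetric] of_real_eq_iff)
  moreover have "(\<Sum>b<q. (norm (weyl n A q h b))\<^sup>2) = (\<Sum>b<q. (norm (\<Sum>a\<in>?C. E b (dot a)))\<^sup>2) / (real (rho n A q))\<^sup>2"
  proof -
    have "weyl n A q h b = (\<Sum>a\<in>?C. E b (dot a)) / of_nat (rho n A q)" for b
      by (simp only: weyl_def E_def dot_def)
    hence "(norm (weyl n A q h b))\<^sup>2 = (norm (\<Sum>a\<in>?C. E b (dot a)))\<^sup>2 / (real (rho n A q))\<^sup>2" for b
      by (simp only: norm_divide power_divide norm_of_nat)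
    thus ?thesis by (simp only: sum_divide_distrib)
  qed
  ultimately show ?thesis by (simp add: collision_ratio_def dot_def)
qed

lemma collision_ratio_nonneg: "collision_ratio n A h q \<ge> 0"
  by (simp add: collision_ratio_def)

lemma sum_norm_weyl_le:
  assumes "q \<ge> 1"
  shows "(\<Sum>b<q. norm (weyl n A q h b)) \<le> real q * sqrt (collision_ratio n A h q)"
proof -
  have "(\<Sum>b<q. norm (weyl n A q h b))\<^sup>2 \<le> real q * (\<Sum>b<q. (norm (weyl n A q h b))\<^sup>2)"
    using sum_squared_le_sum_of_squares[of "\<lambda>b. norm (weyl n A q h b)" "{..<q}"] by (simp add: mult.commute)
  also have "\<dots> = (real q * sqrt (collision_ratio n A h q))\<^sup>2"
    using sum_norm_weyl_sq[OF assms] collision_ratio_nonneg[of n A h q] by (simp add: power_mult_distrib power2_eq_square)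
  finally show ?thesis using collision_ratio_nonneg[of n A h q] by (auto intro: power2_le_imp_le)
qed

lemma collision_ratio_le_1: "collision_ratio n A h q \<le> 1"
proof -
  have "card {(x, y) \<in> crt_set n A q \<times> crt_set n A q. [(\<Sum>i<n. h i * int (x i)) = (\<Sum>i<n. h i * int (y i))] (mod int q)}
    \<le> card (crt_set n A q \<times> crt_set n A q)" by (intro card_mono) (auto simp: finite_crt_set)
  hence "real (card {(x, y) \<in> crt_set n A q \<times> crt_set n A q. [(\<Sum>i<n. h i * int (x i)) = (\<Sum>i<n. h i * int (y i))] (mod int q)})
    \<le> (real (rho n A q))\<^sup>2" by (simp add: rho_def card_cartesian_product power2_eq_square flip: of_nat_mult)
  thus ?thesis unfolding collision_ratio_def by (intro divide_le_eq_1[THEN iffD2]) (auto simp: zero_less_power2)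
qed

text \<open>The Chinese remainder bijection, applied to both members of a pair, matches collisions
  modulo \<open>r * s\<close> with pairs of collisions modulo \<open>r\<close> and modulo
  \<open>s\<close>.\<close>

lemma collision_ratio_mult:
  assumes cop: "coprime r s" and rs: "r \<ge> 1" "s \<ge> 1"
  shows "collision_ratio n A h (r * s) = collision_ratio n A h r * collision_ratio n A h s"
proof -
  define dot where "dot x = (\<Sum>i<n. h i * int (x i))" for x
  define S where "S q = {(x, y) \<in> crt_set n A q \<times> crt_set n A q. [dot x = dot y] (mod int q)}" for q
  define f where "f = (\<lambda>x. (reduce_vec n r x, reduce_vec n s x))"
  have bij: "bij_betw f (crt_set n A (r * s)) (crt_set n A r \<times> crt_set n A s)"
    unfolding f_def by (rule crt_set_bij[OF cop rs])
  have cong: "[dot x = dot y] (mod int (r * s)) \<longleftrightarrow>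
     [dot (reduce_vec n r x) = dot (reduce_vec n r y)] (mod int r) \<and> [dot (reduce_vec n s x) = dot (reduce_vec n s y)] (mod int s)" for x y
  proof -
    have "[dot x = dot y] (mod int (r * s)) \<longleftrightarrow> [dot x = dot y] (mod int r) \<and> [dot x = dot y] (mod int s)"
      using coprime_cong_mult[of "dot x" "dot y" "int r" "int s"] cop
      by (auto simp: cong_iff_dvd_diff elim: dvd_mult_left dvd_mult_right)
    also have "\<dots> \<longleftrightarrow> [dot (reduce_vec n r x) = dot (reduce_vec n r y)] (mod int r) \<and> [dot (reduce_vec n s x) = dot (reduce_vec n s y)] (mod int s)"
      using dot_reduce_vec_cong[of h n] unfolding cong_def dot_def by simp
    finally show ?thesis .
  qed
  have "bij_betw (\<lambda>(x,y). ((reduce_vec n r x, reduce_vec n r y), (reduce_vec n s x, reduce_vec n s y))) (S (r * s)) (S r \<times> S s)"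
  proof (rule bij_betw_imageI)
    show "inj_on (\<lambda>(x,y). ((reduce_vec n r x, reduce_vec n r y), (reduce_vec n s x, reduce_vec n s y))) (S (r * s))"
      using bij by (auto simp: inj_on_def bij_betw_def S_def f_def)
    show "(\<lambda>(x,y). ((reduce_vec n r x, reduce_vec n r y), (reduce_vec n s x, reduce_vec n s y))) ` S (r * s) = S r \<times> S s"
    proof (intro equalityI subsetI)
      fix t assume "t \<in> (\<lambda>(x,y). ((reduce_vec n r x, reduce_vec n r y), (reduce_vec n s x, reduce_vec n s y))) ` S (r * s)"
      then obtain x y where xy: "(x,y) \<in> S (r * s)" "t = ((reduce_vec n r x, reduce_vec n r y), (reduce_vec n s x, reduce_vec n s y))" by auto
      have "f x \<in> crt_set n A r \<times> crt_set n A s" "f y \<in> crt_set n A r \<times> crt_set n A s"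
        using xy bij_betwE[OF bij] by (auto simp: S_def)
      thus "t \<in> S r \<times> S s" using xy cong[of x y] by (auto simp: S_def f_def)
    next
      fix t assume t: "t \<in> S r \<times> S s"
      then obtain a b c d where abcd: "t = ((a,b),(c,d))" "(a,b) \<in> S r" "(c,d) \<in> S s" by force
      have "(a,c) \<in> f ` crt_set n A (r * s)" "(b,d) \<in> f ` crt_set n A (r * s)"
        using bij abcd by (auto simp: bij_betw_def S_def)
      then obtain x y where xy: "x \<in> crt_set n A (r * s)" "f x = (a,c)" "y \<in> crt_set n A (r * s)" "f y = (b,d)" by (metis imageE)
      hence "(x,y) \<in> S (r * s)" using cong[of x y] abcd by (auto simp: S_def f_def)
      thus "t \<in> (\<lambda>(x,y). ((reduce_vec n r x, reduce_vec n r y), (reduce_vec n s x, reduce_vec n s y))) ` S (r * s)"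
        using xy abcd by (auto simp: f_def intro!: rev_image_eqI[of "(x,y)"])
    qed
  qed
  hence "card (S (r * s)) = card (S r) * card (S s)" by (simp add: bij_betw_same_card card_cartesian_product)
  thus ?thesis using rho_mult[OF cop rs, of n A]
    by (simp add: collision_ratio_def S_def dot_def power_mult_distrib)
qed

text \<open>For fixed \<open>x\<close>, the points \<open>y\<close> colliding with \<open>x\<close>
  lie on one affine hyperplane, non-degenerate since some coordinate of \<open>h\<close> is non-zero
  modulo \<open>p\<close>. So each of the \<open>rho\<close> choices of \<open>x\<close> admits at
  most \<open>lam\<close> choices of \<open>y\<close>.\<close>

lemma collision_ratio_prime_le:
  assumes p: "prime p" and i: "i < n" "\<not> int p dvd h i"
  shows "collision_ratio n A h p \<le> real (lam n A p) / real (rho n A p)"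
proof -
  let ?C = "crt_set n A p"
  define dot where "dot x = (\<Sum>i<n. h i * int (x i))" for x
  \<comment> \<open>Hyperplanes are parametrised by vectors of least residues, so the integer
    frequency is reduced modulo \<open>p\<close> first.\<close>
  define h' where "h' = (\<lambda>i\<in>{..<n}. nat (h i mod int p))"
  have p1: "p \<ge> 1" using p prime_ge_1_nat by auto
  have fin: "finite (affine_hyperplanes n p)"
  proof -
    have "affine_hyperplanes n p \<subseteq> Pow (residue_vecs n p)" by (auto simp: affine_hyperplanes_def)
    moreover have "finite (residue_vecs n p)" unfolding residue_vecs_def by (intro finite_PiE) auto
    ultimately show ?thesis using finite_subset by blast
  qed
  have h'r: "h' \<in> residue_vecs n p" using p1 by (auto simp: h'_def residue_vecs_def nat_less_iff)
  have h'nz: "h' i \<noteq> 0"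
  proof -
    have "h i mod int p \<noteq> 0" "h i mod int p \<ge> 0" using i p1 by (auto simp: dvd_eq_mod_eq_0)
    thus ?thesis using i by (simp add: h'_def)
  qed
  have dot: "[dot x = int (\<Sum>i<n. h' i * x i)] (mod int p)" for x
    unfolding dot_def of_nat_sum of_nat_mult
    by (intro cong_sum cong_mult cong_refl) (use p1 in \<open>auto simp: h'_def cong_def\<close>)
  have fib: "card {y \<in> ?C. [dot x = dot y] (mod int p)} \<le> lam n A p" for x
  proof -
    define a where "a = (\<Sum>i<n. h' i * x i) mod p"
    define H where "H = {y \<in> residue_vecs n p. [(\<Sum>i<n. h' i * y i) = a] (mod p)}"
    have H: "H \<in> affine_hyperplanes n p"
      unfolding H_def affine_hyperplanes_def mem_Collect_eq
      by (rule exI[of _ h'], rule exI[of _ a]) (use h'r h'nz i p1 in \<open>auto simp: a_def\<close>)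
    have "{y \<in> ?C. [dot x = dot y] (mod int p)} \<subseteq> H \<inter> ?C"
    proof
      fix y assume y: "y \<in> {y \<in> ?C. [dot x = dot y] (mod int p)}"
      hence "[int (\<Sum>i<n. h' i * y i) = int (\<Sum>i<n. h' i * x i)] (mod int p)"
        using dot by (metis (mono_tags, lifting) cong_sym cong_trans mem_Collect_eq)
      hence "[(\<Sum>i<n. h' i * y i) = (\<Sum>i<n. h' i * x i)] (mod p)" by (simp only: cong_int_iff)
      thus "y \<in> H \<inter> ?C" using y by (auto simp: H_def a_def crt_set_def cong_def)
    qed
    hence "card {y \<in> ?C. [dot x = dot y] (mod int p)} \<le> card (H \<inter> ?C)"
      by (intro card_mono) (auto simp: finite_crt_set)
    also have "\<dots> \<le> lam n A p" unfolding lam_def using fin H by (intro Max_ge) auto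
    finally show ?thesis .
  qed
  have "{(x, y) \<in> ?C \<times> ?C. [dot x = dot y] (mod int p)} = (SIGMA x:?C. {y \<in> ?C. [dot x = dot y] (mod int p)})" by auto
  hence "card {(x, y) \<in> ?C \<times> ?C. [dot x = dot y] (mod int p)} = (\<Sum>x\<in>?C. card {y \<in> ?C. [dot x = dot y] (mod int p)})"
    by (simp add: card_SigmaI finite_crt_set)
  also have "\<dots> \<le> (\<Sum>x\<in>?C. lam n A p)" by (intro sum_mono fib)
  finally have "card {(x, y) \<in> ?C \<times> ?C. [dot x = dot y] (mod int p)} \<le> rho n A p * lam n A p" by (simp add: rho_def)
  hence "real (card {(x, y) \<in> ?C \<times> ?C. [dot x = dot y] (mod int p)}) \<le> real (rho n A p) * real (lam n A p)"
    by (simp flip: of_nat_mult)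
  then have "collision_ratio n A h p \<le> (real (rho n A p) * real (lam n A p)) / (real (rho n A p))\<^sup>2"
    unfolding collision_ratio_def dot_def by (intro divide_right_mono) auto
  also have "\<dots> = real (lam n A p) / real (rho n A p)"
    by (cases "rho n A p = 0") (simp_all add: power2_eq_square)
  finally show ?thesis .
qed

section \<open>A discrete Erdos-Turan-Koksma inequality\<close>

definition add_char :: "nat \<Rightarrow> int \<Rightarrow> complex" where
  "add_char q k = cis (2 * pi * (real_of_int k / real q))"

text \<open>Representatives in (-q/2, q/2]: the distance from \<open>add_char q h\<close> to 1 is
  then at least 2|h|/q, which governs the decay of Fourier coefficients.\<close>

definition sym_residues :: "nat \<Rightarrow> int set" where
  "sym_residues q = (\<lambda>b. if 2 * b \<le> q then int b else int b - int q) ` {..<q}"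

text \<open>The convolution on Z/q of the indicator of \<open>N\<close> consecutive residues from
  \<open>L\<close> with the uniform average over \<open>J\<close> shifts. Smoothing at scale
  \<open>J\<close> makes the coefficients decay like 1/h^2, so that frequencies can later be
  truncated at a level independent of \<open>q\<close>.\<close>

definition trapezoid :: "nat \<Rightarrow> nat \<Rightarrow> int \<Rightarrow> nat \<Rightarrow> int \<Rightarrow> real" where
  "trapezoid q J L N m = (\<Sum>i<N. \<Sum>j<J. if int q dvd (m - (L + int i + int j)) then 1 else 0) / real J"

definition trapezoid_coeff :: "nat \<Rightarrow> nat \<Rightarrow> int \<Rightarrow> nat \<Rightarrow> int \<Rightarrow> complex" where
  "trapezoid_coeff q J L N h = (\<Sum>i<N. \<Sum>j<J. add_char q (- (h * (L + int i + int j)))) / (of_nat J * of_nat q)"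

lemma add_char_add: "add_char q (a + b) = add_char q a * add_char q b"
  by (simp add: add_char_def cis_mult add_divide_distrib distrib_left)

lemma add_char_cong: "[a = b] (mod int q) \<Longrightarrow> q \<ge> 1 \<Longrightarrow> add_char q a = add_char q b"
  unfolding add_char_def by (rule cis_cong_mod)

lemma norm_add_char [simp]: "norm (add_char q k) = 1"
  by (simp add: add_char_def)

lemma add_char_0 [simp]: "add_char q 0 = 1"
  by (simp add: add_char_def)

lemma add_char_power: "add_char q k ^ i = add_char q (k * int i)"
proof (induction i)
  case (Suc i)
  have "add_char q (k * int (Suc i)) = add_char q (k + k * int i)" by (simp add: algebra_simps)
  thus ?case using Suc by (simp add: add_char_add)
qed simp

lemma finite_sym_residues [simp]: "finite (sym_residues q)"
  by (simp add: sym_residues_def)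

lemma sym_residues_inj: "inj_on (\<lambda>b. if 2 * b \<le> q then int b else int b - int q) {..<q}"
  by (auto intro!: inj_onI split: if_splits)

lemma sym_residues_abs: "h \<in> sym_residues q \<Longrightarrow> 2 * \<bar>h\<bar> \<le> int q"
  by (auto simp: sym_residues_def split: if_splits)

lemma zero_in_sym_residues: "q \<ge> 1 \<Longrightarrow> 0 \<in> sym_residues q"
  unfolding sym_residues_def by (rule image_eqI[of _ _ 0]) auto

lemma sum_add_char_sym_residues:
  assumes "q \<ge> 1"
  shows "(\<Sum>h\<in>sym_residues q. add_char q (h * k)) = (if int q dvd k then of_nat q else 0)"
proof -
  have "(\<Sum>h\<in>sym_residues q. add_char q (h * k)) = (\<Sum>b<q. add_char q ((if 2 * b \<le> q then int b else int b - int q) * k))"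
    unfolding sym_residues_def by (subst sum.reindex[OF sym_residues_inj]) simp
  also have "\<dots> = (\<Sum>b<q. add_char q (int b * k))"
  proof (intro sum.cong refl add_char_cong assms)
    fix b
    show "[(if 2 * b \<le> q then int b else int b - int q) * k = int b * k] (mod int q)"
      by (auto simp: cong_iff_dvd_diff algebra_simps)
  qed
  also have "\<dots> = (if int q dvd k then of_nat q else 0)"
    using sum_cis_residues[OF assms] unfolding add_char_def .
  finally show ?thesis .
qed

text \<open>A weak Jordan inequality: s \<le> tan s at the half angle s = t/2, combined with cos^2 s
  \<ge> 1/2.\<close>

lemma half_le_sin:
  assumes "0 \<le> t" "t \<le> pi / 2"
  shows "t / 2 \<le> sin t"
proof -
  define s where "s = t / 2"
  have s: "0 \<le> s" "s \<le> pi / 4" using assms by (auto simp: s_def)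
  have c: "cos s > 0" using s pi_gt_zero by (intro cos_gt_zero_pi) linarith+
  have tn: "0 \<le> tan s" using s c by (auto simp: tan_def intro!: divide_nonneg_nonneg sin_ge_zero)
  have "s = arctan (tan s)" using s pi_gt_zero by (intro arctan_tan[symmetric]) linarith+
  also have "\<dots> \<le> tan s" using arctan_le_self[OF tn] .
  finally have "s * cos s \<le> sin s" using c by (simp add: tan_def field_simps)
  hence "s * (cos s)\<^sup>2 \<le> sin s * cos s" using c by (simp add: power2_eq_square flip: mult.assoc)
  moreover have "sin t = 2 * sin s * cos s" using sin_double[of s] by (simp add: s_def)
  moreover have "(cos s)\<^sup>2 \<ge> 1 / 2"
  proof -
    have "cos t = 2 * (cos s)\<^sup>2 - 1" using cos_double_cos[of s] by (simp add: s_def)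
    moreover have "cos t \<ge> 0" using assms by (intro cos_ge_zero) linarith+
    ultimately show ?thesis by linarith
  qed
  hence "s * (1 / 2) \<le> s * (cos s)\<^sup>2" using s by (intro mult_left_mono)
  ultimately show ?thesis by (simp add: s_def)
qed

lemma norm_add_char_minus_1_ge:
  assumes "q \<ge> 1" "2 * \<bar>h\<bar> \<le> int q"
  shows "2 * real_of_int \<bar>h\<bar> / real q \<le> norm (add_char q h - 1)"
proof -
  define t where "t = pi * real_of_int \<bar>h\<bar> / real q"
  have "2 * real_of_int \<bar>h\<bar> \<le> real q" using assms(2) by linarith
  hence t: "0 \<le> t" "t \<le> pi / 2" using assms(1) by (auto simp: t_def field_simps)
  have pi2: "pi * 2 \<ge> 2 * 2" using pi_gt3 by simp
  have "norm (add_char q h - 1) ^ 2 = (cos (2 * t) - 1)\<^sup>2 + (sin (2 * t))\<^sup>2"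
  proof -
    have "2 * pi * (real_of_int h / real q) = (if h \<ge> 0 then 2 * t else - (2 * t))"
      by (simp add: t_def)
    hence "cos (2 * pi * (real_of_int h / real q)) = cos (2 * t)"
      "(sin (2 * pi * (real_of_int h / real q)))\<^sup>2 = (sin (2 * t))\<^sup>2" by auto
    thus ?thesis by (simp add: add_char_def cmod_power2)
  qed
  also have "\<dots> = ((cos (2 * t))\<^sup>2 + (sin (2 * t))\<^sup>2) + 1 - 2 * cos (2 * t)" by (simp add: power2_diff)
  also have "\<dots> = 2 - 2 * cos (2 * t)" by (simp only: sin_cos_squared_add2)
  also have "\<dots> = (2 * sin t)\<^sup>2" by (simp add: cos_double_sin power_mult_distrib)
  finally have sq: "norm (add_char q h - 1) ^ 2 = (2 * sin t)\<^sup>2" .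
  have "sin t \<ge> 0" using t pi_gt_zero by (intro sin_ge_zero) linarith+
  hence "norm (add_char q h - 1) = 2 * sin t" by (intro power2_eq_imp_eq[OF sq]) simp_all
  moreover have "2 * real_of_int \<bar>h\<bar> / real q \<le> t"
    using mult_right_mono[of 2 pi "real_of_int \<bar>h\<bar> / real q"] pi_gt3 by (simp add: t_def)
  ultimately show ?thesis using half_le_sin[OF t] by linarith
qed

lemma norm_geometric_add_char_le:
  assumes "q \<ge> 1" "2 * \<bar>h\<bar> \<le> int q" "h \<noteq> 0"
  shows "norm (\<Sum>i<N. add_char q (- (h * int i))) \<le> real q / real_of_int \<bar>h\<bar>"
proof -
  have lb: "2 * real_of_int \<bar>h\<bar> / real q \<le> norm (add_char q (- h) - 1)"
    using norm_add_char_minus_1_ge[of q "- h"] assms by simp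
  have pos: "0 < 2 * real_of_int \<bar>h\<bar> / real q" using assms by simp
  have "add_char q (-h) \<noteq> 1" using lb pos by auto
  hence "(\<Sum>i<N. add_char q (-h) ^ i) = (add_char q (-h) ^ N - 1) / (add_char q (-h) - 1)" by (rule geometric_sum)
  hence "norm (\<Sum>i<N. add_char q (- (h * int i))) = norm (add_char q (-h) ^ N - 1) / norm (add_char q (-h) - 1)"
    by (simp add: add_char_power norm_divide)
  also have "\<dots> \<le> 2 / (2 * real_of_int \<bar>h\<bar> / real q)"
  proof (rule frac_le)
    show "norm (add_char q (-h) ^ N - 1) \<le> 2" using norm_triangle_ineq4[of "add_char q (-h) ^ N" 1] by (simp add: norm_power)
  qed (use lb pos in auto)
  finally show ?thesis by simp
qed

lemma trapezoid_coeff_factor: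
  "trapezoid_coeff q J L N h = add_char q (- (h * L)) * (\<Sum>i<N. add_char q (- (h * int i))) * (\<Sum>j<J. add_char q (- (h * int j))) / (of_nat J * of_nat q)"
proof -
  have "add_char q (- (h * (L + int i + int j))) = add_char q (- (h * L)) * (add_char q (- (h * int i)) * add_char q (- (h * int j)))" for i j
    by (simp add: add_char_add[symmetric] algebra_simps)
  hence "(\<Sum>i<N. \<Sum>j<J. add_char q (- (h * (L + int i + int j))))
      = add_char q (- (h * L)) * ((\<Sum>i<N. add_char q (- (h * int i))) * (\<Sum>j<J. add_char q (- (h * int j))))"
    unfolding sum_product by (simp only: sum_distrib_left[symmetric])
  thus ?thesis by (simp add: trapezoid_coeff_def mult.assoc)
qed

lemma trapezoid_coeff_0: "J \<ge> 1 \<Longrightarrow> trapezoid_coeff q J L N 0 = of_nat N / of_nat q"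
  by (simp add: trapezoid_coeff_def)

text \<open>The two terms of the minimum bound the averaging factor trivially by \<open>J\<close> or
  by its geometric sum. The value 2 at zero accommodates lengths \<open>N\<close> up to
  \<open>2 * q\<close>, since a widened full interval can exceed one period.\<close>

definition trap_bound :: "nat \<Rightarrow> nat \<Rightarrow> int \<Rightarrow> real" where
  "trap_bound q J h = (if h = 0 then 2 else min (1 / real_of_int \<bar>h\<bar>) (real q / (real J * (real_of_int h)\<^sup>2)))"

lemma trap_bound_nonneg: "trap_bound q J h \<ge> 0"
  by (simp add: trap_bound_def)

lemma norm_trapezoid_coeff_le:
  assumes "q \<ge> 1" "J \<ge> 1" "N \<le> 2 * q" "h \<in> sym_residues q"
  shows "norm (trapezoid_coeff q J L N h) \<le> trap_bound q J h"
proof (cases "h = 0")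
  case True
  have "real N \<le> 2 * real q" using assms by linarith
  thus ?thesis using True assms by (simp add: trapezoid_coeff_0 trap_bound_def norm_divide divide_simps)
next
  case False
  define a where "a = norm (\<Sum>i<N. add_char q (- (h * int i)))"
  define b where "b = norm (\<Sum>j<J. add_char q (- (h * int j)))"
  define x where "x = real_of_int \<bar>h\<bar>"
  have x: "x > 0" using False by (simp add: x_def)
  have a: "0 \<le> a" "a \<le> real q / x" unfolding a_def x_def using norm_geometric_add_char_le[OF assms(1) sym_residues_abs[OF assms(4)] False] by auto
  have b: "0 \<le> b" "b \<le> real q / x" unfolding b_def x_def using norm_geometric_add_char_le[OF assms(1) sym_residues_abs[OF assms(4)] False] by auto
  have "b \<le> (\<Sum>j<J. 1)" unfolding b_def by (rule sum_norm_le) auto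
  hence bJ: "b \<le> real J" by simp
  have eq: "norm (trapezoid_coeff q J L N h) = a * b / (real J * real q)"
    by (simp add: trapezoid_coeff_factor a_def b_def norm_mult norm_divide)
  have "a * b / (real J * real q) \<le> (real q / x) * real J / (real J * real q)"
    using a b bJ x by (intro divide_right_mono mult_mono) auto
  also have "\<dots> = 1 / x" using assms by simp
  finally have 1: "a * b / (real J * real q) \<le> 1 / x" .
  have "a * b / (real J * real q) \<le> (real q / x) * (real q / x) / (real J * real q)"
    using a b x by (intro divide_right_mono mult_mono) auto
  also have "\<dots> = real q / (real J * x\<^sup>2)" using assms by (simp add: power2_eq_square)
  finally have 2: "a * b / (real J * real q) \<le> real q / (real J * x\<^sup>2)" .
  show ?thesis using 1 2 False unfolding eq by (simp add: trap_bound_def x_def)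
qed

lemma trapezoid_fourier:
  assumes "q \<ge> 1" "J \<ge> 1"
  shows "of_real (trapezoid q J L N m) = (\<Sum>h\<in>sym_residues q. trapezoid_coeff q J L N h * add_char q (h * m))"
proof -
  have "(\<Sum>h\<in>sym_residues q. trapezoid_coeff q J L N h * add_char q (h * m))
      = (\<Sum>h\<in>sym_residues q. \<Sum>i<N. \<Sum>j<J. add_char q (h * (m - (L + int i + int j)))) / (of_nat J * of_nat q)"
    unfolding trapezoid_coeff_def sum_divide_distrib sum_distrib_right
    by (intro sum.cong refl) (simp add: add_char_add[symmetric] algebra_simps)
  also have "(\<Sum>h\<in>sym_residues q. \<Sum>i<N. \<Sum>j<J. add_char q (h * (m - (L + int i + int j))))
     = (\<Sum>i<N. \<Sum>j<J. \<Sum>h\<in>sym_residues q. add_char q (h * (m - (L + int i + int j))))"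
    by (subst sum.swap, rule sum.cong[OF refl], rule sum.swap)
  also have "\<dots> = (\<Sum>i<N. \<Sum>j<J. of_nat q * (if int q dvd (m - (L + int i + int j)) then 1 else 0))"
    unfolding sum_add_char_sym_residues[OF assms(1)] by (intro sum.cong) auto
  also have "\<dots> = of_nat q * (\<Sum>i<N. \<Sum>j<J. (if int q dvd (m - (L + int i + int j)) then 1 else 0))"
    by (simp only: sum_distrib_left)
  also have "\<dots> / (of_nat J * of_nat q) = (\<Sum>i<N. \<Sum>j<J. (if int q dvd (m - (L + int i + int j)) then 1 else 0)) / of_nat J"
    using assms by simp
  also have "\<dots> = of_real (trapezoid q J L N m)"
    unfolding trapezoid_def by (simp add: if_distrib[of complex_of_real] cong: if_cong)
  finally show ?thesis by simp
qed

lemma trapezoid_nonneg: "trapezoid q J L N m \<ge> 0"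
  unfolding trapezoid_def by (intro divide_nonneg_nonneg sum_nonneg) auto

section \<open>Majorants and minorants for intervals modulo q\<close>

text \<open>Widening the interval by \<open>J - 1\<close> points to the left leaves, for every shift
  \<open>j\<close>, an \<open>i\<close> with \<open>L - J + 1 + i + j\<close> equal to
  \<open>k\<close>; so each of the \<open>J\<close> averaged terms is at least 1.\<close>

lemma trapezoid_ge_1:
  assumes "J \<ge> 1" "k \<in> {L..<L + int N}" "[k = m] (mod int q)"
  shows "trapezoid q J (L - int J + 1) (N + J - 1) m \<ge> 1"
proof -
  have "(\<Sum>j<J. 1) \<le> (\<Sum>j<J. \<Sum>i<N+J-1. if int q dvd (m - (L - int J + 1 + int i + int j)) then 1 else (0::real))"
  proof (rule sum_mono)
    fix j assume j: "j \<in> {..<J}"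
    define i where "i = nat (k - L + int J - 1 - int j)"
    have i: "int i = k - L + int J - 1 - int j" using j assms by (auto simp: i_def)
    have "i \<in> {..<N+J-1}" using i assms j by auto
    moreover have "int q dvd (m - (L - int J + 1 + int i + int j))"
      unfolding i using assms(3) by (simp add: cong_iff_dvd_diff dvd_diff_commute)
    ultimately show "1 \<le> (\<Sum>i<N+J-1. if int q dvd (m - (L - int J + 1 + int i + int j)) then 1 else (0::real))"
      using member_le_sum[of i "{..<N+J-1}" "\<lambda>i. if int q dvd (m - (L - int J + 1 + int i + int j)) then 1 else (0::real)"] by auto
  qed
  also have "\<dots> = (\<Sum>i<N+J-1. \<Sum>j<J. if int q dvd (m - (L - int J + 1 + int i + int j)) then 1 else (0::real))"
    by (rule sum.swap)
  finally show ?thesis using assms(1) by (simp add: trapezoid_def)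
qed

text \<open>Shortening to \<open>N + 1 - J\<close> keeps every shifted point inside the original
  interval. The truncated subtraction gives the zero minorant when \<open>N < J\<close>. The bound
  on \<open>N\<close> keeps the shortened length at most one period, so each shift hits a residue at
  most once.\<close>

lemma trapezoid_le_indicator:
  assumes "J \<ge> 1" "N \<le> q + J - 1"
  shows "trapezoid q J L (N + 1 - J) m \<le> (if \<exists>k\<in>{L..<L + int N}. [k = m] (mod int q) then 1 else 0)"
proof (cases "\<exists>k\<in>{L..<L + int N}. [k = m] (mod int q)")
  case False
  have "\<not> int q dvd (m - (L + int i + int j))" if "i < N + 1 - J" "j < J" for i j
  proof
    assume "int q dvd (m - (L + int i + int j))"
    hence "[L + int i + int j = m] (mod int q)" by (simp add: cong_iff_dvd_diff dvd_diff_commute)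
    moreover have "L + int i + int j \<in> {L..<L + int N}" using that by auto
    ultimately show False using False by blast
  qed
  hence "trapezoid q J L (N + 1 - J) m = 0" by (simp add: trapezoid_def)
  thus ?thesis using False by simp
next
  case True
  have "(\<Sum>j<J. \<Sum>i<N+1-J. if int q dvd (m - (L + int i + int j)) then 1 else (0::real)) \<le> (\<Sum>j<J. 1)"
  proof (rule sum_mono)
    fix j
    let ?A = "{i. i < N + 1 - J \<and> int q dvd (m - (L + int i + int j))}"
    have "a = b" if "a \<in> ?A" "b \<in> ?A" for a b
    proof -
      have "int q dvd ((m - (L + int a + int j)) - (m - (L + int b + int j)))" using that by (metis (no_types, lifting) dvd_diff mem_Collect_eq)
      hence "int q dvd (int b - int a)" by (simp add: algebra_simps)
      hence "[int b = int a] (mod int q)" by (simp add: cong_iff_dvd_diff)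
      hence "[b = a] (mod q)" by (simp only: cong_int_iff)
      moreover have "a < q" "b < q" using that assms by auto
      ultimately show ?thesis by (simp add: cong_def)
    qed
    hence "card ?A \<le> 1" by (auto simp: card_le_Suc0_iff_eq)
    moreover have "(\<Sum>i<N+1-J. if int q dvd (m - (L + int i + int j)) then 1 else (0::real)) = real (card ?A)"
      by (simp add: sum.If_cases Int_def lessThan_def)
    ultimately show "(\<Sum>i<N+1-J. if int q dvd (m - (L + int i + int j)) then 1 else (0::real)) \<le> 1" by linarith
  qed
  also have "(\<Sum>j<J. \<Sum>i<N+1-J. if int q dvd (m - (L + int i + int j)) then 1 else (0::real))
    = (\<Sum>i<N+1-J. \<Sum>j<J. if int q dvd (m - (L + int i + int j)) then 1 else (0::real))"
    by (rule sum.swap)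
  finally show ?thesis using assms(1) True by (simp add: trapezoid_def)
qed

text \<open>Expanding each factor in its Fourier series turns the average into a sum of Weyl sums;
  the zero frequency contributes exactly the product of the densities
  \<open>N i / q\<close>.\<close>

lemma average_trapezoid_product:
  assumes q: "q \<ge> 1" and J: "J \<ge> 1" and N: "\<And>i. i < n \<Longrightarrow> N i \<le> 2 * q" and rho: "rho n A q \<ge> 1"
  shows "\<bar>(\<Sum>a\<in>crt_set n A q. \<Prod>i<n. trapezoid q J (L i) (N i) (int (a i))) / real (rho n A q)
            - (\<Prod>i<n. real (N i) / real q)\<bar>
     \<le> (\<Sum>h\<in>{h \<in> {..<n} \<rightarrow>\<^sub>E sym_residues q. \<exists>i<n. h i \<noteq> 0}. (\<Prod>i<n. trap_bound q J (h i)) * norm (weyl n A q h 1))"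
proof -
  let ?H = "{..<n} \<rightarrow>\<^sub>E sym_residues q"
  let ?C = "crt_set n A q"
  define c where "c i h = trapezoid_coeff q J (L i) (N i) h" for i h
  \<comment> \<open>The zero frequency, as an extensional function on the coordinates.\<close>
  define z :: "nat \<Rightarrow> int" where "z = (\<lambda>i\<in>{..<n}. 0)"
  have finH: "finite ?H" by (intro finite_PiE) auto
  have zH: "z \<in> ?H" using zero_in_sym_residues[OF q] by (auto simp: z_def)
  have zD: "?H - {z} = {h \<in> ?H. \<exists>i<n. h i \<noteq> 0}"
  proof (intro equalityI subsetI)
    fix h assume h: "h \<in> ?H - {z}"
    have "\<exists>i<n. h i \<noteq> 0"
    proof (rule ccontr)
      assume "\<not> (\<exists>i<n. h i \<noteq> 0)"
      hence "h = z" using h by (auto simp: z_def PiE_def extensional_def fun_eq_iff)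
      thus False using h by simp
    qed
    thus "h \<in> {h \<in> ?H. \<exists>i<n. h i \<noteq> 0}" using h by auto
  next
    fix h assume h: "h \<in> {h \<in> ?H. \<exists>i<n. h i \<noteq> 0}"
    then obtain i where "i < n" "h i \<noteq> 0" by blast
    moreover have "z i = 0" if "i < n" for i using that by (simp add: z_def)
    ultimately have "h \<noteq> z" by metis
    thus "h \<in> ?H - {z}" using h by blast
  qed
  have "complex_of_real (\<Sum>a\<in>?C. \<Prod>i<n. trapezoid q J (L i) (N i) (int (a i)))
      = (\<Sum>a\<in>?C. \<Prod>i<n. \<Sum>h\<in>sym_residues q. c i h * add_char q (h * int (a i)))"
    by (simp add: trapezoid_fourier[OF q J] c_def)
  also have "\<dots> = (\<Sum>a\<in>?C. \<Sum>h\<in>?H. \<Prod>i<n. c i (h i) * add_char q (h i * int (a i)))"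
    by (intro sum.cong refl prod_sum_PiE) auto
  also have "\<dots> = (\<Sum>h\<in>?H. \<Sum>a\<in>?C. \<Prod>i<n. c i (h i) * add_char q (h i * int (a i)))"
    by (rule sum.swap)
  also have "\<dots> = (\<Sum>h\<in>?H. (\<Prod>i<n. c i (h i)) * (\<Sum>a\<in>?C. add_char q (\<Sum>i<n. h i * int (a i))))"
  proof (intro sum.cong refl)
    fix h
    have "(\<Prod>i<n. add_char q (h i * int (a i))) = add_char q (\<Sum>i<n. h i * int (a i))" for a
      by (induction n) (simp_all add: add_char_add mult.commute)
    thus "(\<Sum>a\<in>?C. \<Prod>i<n. c i (h i) * add_char q (h i * int (a i))) = (\<Prod>i<n. c i (h i)) * (\<Sum>a\<in>?C. add_char q (\<Sum>i<n. h i * int (a i)))"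
      by (simp only: prod.distrib sum_distrib_left)
  qed
  also have "\<dots> = (\<Sum>h\<in>?H. (\<Prod>i<n. c i (h i)) * (of_nat (rho n A q) * weyl n A q h 1))"
    using rho by (intro sum.cong refl) (simp add: weyl_def add_char_def)
  also have "\<dots> = of_nat (rho n A q) * (\<Sum>h\<in>?H. (\<Prod>i<n. c i (h i)) * weyl n A q h 1)"
    by (simp add: sum_distrib_left mult_ac)
  finally have "complex_of_real ((\<Sum>a\<in>?C. \<Prod>i<n. trapezoid q J (L i) (N i) (int (a i))) / real (rho n A q))
     = (\<Sum>h\<in>?H. (\<Prod>i<n. c i (h i)) * weyl n A q h 1)" using rho by simp
  also have "\<dots> = (\<Prod>i<n. c i (z i)) * weyl n A q z 1 + (\<Sum>h\<in>?H - {z}. (\<Prod>i<n. c i (h i)) * weyl n A q h 1)"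
    using finH zH by (rule sum.remove)
  also have "weyl n A q z 1 = 1" using rho by (simp add: weyl_def z_def rho_def)
  also have "(\<Prod>i<n. c i (z i)) = of_real (\<Prod>i<n. real (N i) / real q)"
    by (simp add: z_def c_def trapezoid_coeff_0[OF J])
  finally have eq: "complex_of_real ((\<Sum>a\<in>?C. \<Prod>i<n. trapezoid q J (L i) (N i) (int (a i))) / real (rho n A q)
       - (\<Prod>i<n. real (N i) / real q)) = (\<Sum>h\<in>?H - {z}. (\<Prod>i<n. c i (h i)) * weyl n A q h 1)" by simp
  have "\<bar>(\<Sum>a\<in>?C. \<Prod>i<n. trapezoid q J (L i) (N i) (int (a i))) / real (rho n A q) - (\<Prod>i<n. real (N i) / real q)\<bar>
     = norm (\<Sum>h\<in>?H - {z}. (\<Prod>i<n. c i (h i)) * weyl n A q h 1)"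
    unfolding eq[symmetric] by (simp only: norm_of_real)
  also have "\<dots> \<le> (\<Sum>h\<in>?H - {z}. (\<Prod>i<n. trap_bound q J (h i)) * norm (weyl n A q h 1))"
  proof (rule sum_norm_le)
    fix h assume h: "h \<in> ?H - {z}"
    have "(\<Prod>i<n. norm (c i (h i))) \<le> (\<Prod>i<n. trap_bound q J (h i))"
      using h N q J by (intro prod_mono) (auto simp: c_def intro!: norm_trapezoid_coeff_le)
    thus "norm ((\<Prod>i<n. c i (h i)) * weyl n A q h 1) \<le> (\<Prod>i<n. trap_bound q J (h i)) * norm (weyl n A q h 1)"
      by (simp add: norm_mult prod_norm mult_right_mono)
  qed
  finally show ?thesis unfolding zD .
qed

section \<open>Boxes on the torus and their lattice points\<close>

lemma frac_image_interval_measure: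
  assumes "a \<le> b" "b - a \<le> (1::real)"
  shows "frac ` {a..b} \<in> sets lborel" "emeasure lborel (frac ` {a..b}) = ennreal (b - a)"
proof -
  define m where "m = real_of_int \<lfloor>a\<rfloor>"
  have m: "m \<le> a" "a < m + 1" by (auto simp: m_def)
  have fr: "frac y = y - m" if "m \<le> y" "y < m + 1" for y
  proof -
    have "\<lfloor>y\<rfloor> = \<lfloor>a\<rfloor>" by (rule floor_unique) (use that in \<open>auto simp: m_def\<close>)
    thus ?thesis by (simp add: frac_def m_def)
  qed
  have fr2: "frac y = y - m - 1" if "m + 1 \<le> y" "y < m + 2" for y
  proof -
    have "\<lfloor>y\<rfloor> = \<lfloor>a\<rfloor> + 1" by (rule floor_unique) (use that in \<open>auto simp: m_def\<close>)
    thus ?thesis by (simp add: frac_def m_def)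
  qed
  have "frac ` {a..b} \<in> sets lborel \<and> emeasure lborel (frac ` {a..b}) = ennreal (b - a)"
  proof (cases "b < m + 1")
    case True
    have "frac ` {a..b} = (\<lambda>y. y - m) ` {a..b}" by (intro image_cong) (use True m fr in auto)
    also have "\<dots> = {a - m..b - m}" by (auto simp: image_iff intro!: bexI[of _ "_ + m"])
    finally have eq: "frac ` {a..b} = {a - m..b - m}" .
    show ?thesis unfolding eq using assms by simp
  next
    case False
    have b: "b < m + 2" "m + 1 \<le> b" using False m assms by auto
    have "{a..b} = {a..<m+1} \<union> {m+1..b}" using False m by auto
    hence "frac ` {a..b} = frac ` {a..<m+1} \<union> frac ` {m+1..b}" by (simp only: image_Un)
    also have "frac ` {a..<m+1} = (\<lambda>y. y - m) ` {a..<m+1}" by (intro image_cong) (use m fr in auto)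
    also have "\<dots> = {a - m..<1}" by (auto simp: image_iff intro!: bexI[of _ "_ + m"])
    also have "frac ` {m+1..b} = (\<lambda>y. y - m - 1) ` {m+1..b}" by (intro image_cong) (use b fr2 in auto)
    also have "\<dots> = {0..b - m - 1}" by (auto simp: image_iff intro!: bexI[of _ "_ + m + 1"])
    finally have eq: "frac ` {a..b} = {a - m..<1} \<union> {0..b - m - 1}" .
    show ?thesis
    \<comment> \<open>After wrapping past an integer the two pieces are disjoint, except at full
      length, where they share the endpoint \<open>a - m\<close> and together fill [0, 1).\<close>
    proof (cases "b - a = 1")
      case True
      have "{a - m..<1} \<union> {0..b - m - 1} = {0..<1}" using m b True by auto
      thus ?thesis unfolding eq using True by simp
    next
      case False
      have "{a - m..<1} \<inter> {0..b - m - 1} = {}" using False assms by auto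
      hence "emeasure lborel ({a - m..<1} \<union> {0..b - m - 1}) = emeasure lborel {a - m..<1} + emeasure lborel {0..b - m - 1}"
        by (intro plus_emeasure[symmetric]) auto
      also have "\<dots> = ennreal (1 - (a - m)) + ennreal (b - m - 1)" using m b by simp
      also have "\<dots> = ennreal (b - a)" using m b by (simp flip: ennreal_plus)
      finally show ?thesis unfolding eq by simp
    qed
  qed
  thus "frac ` {a..b} \<in> sets lborel" "emeasure lborel (frac ` {a..b}) = ennreal (b - a)" by auto
qed

lemma torus_proj_box:
  "torus_proj n ` (\<Pi>\<^sub>E i\<in>{..<n}. {a i..b i}) = (\<Pi>\<^sub>E i\<in>{..<n}. frac ` {a i..b i})"
proof (intro equalityI subsetI)
  fix y assume "y \<in> (\<Pi>\<^sub>E i\<in>{..<n}. frac ` {a i..b i})"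
  hence y: "y \<in> extensional {..<n}" "\<And>i. i < n \<Longrightarrow> \<exists>t\<in>{a i..b i}. y i = frac t" by (auto simp: PiE_def)
  then obtain t where t: "\<And>i. i < n \<Longrightarrow> t i \<in> {a i..b i} \<and> y i = frac (t i)" by metis
  define u where "u = (\<lambda>i\<in>{..<n}. t i)"
  have "u \<in> (\<Pi>\<^sub>E i\<in>{..<n}. {a i..b i})" using t by (auto simp: u_def)
  moreover have "y = torus_proj n u" using y t by (auto simp: u_def torus_proj_def extensional_def fun_eq_iff)
  ultimately show "y \<in> torus_proj n ` (\<Pi>\<^sub>E i\<in>{..<n}. {a i..b i})" by blast
next
  fix y assume "y \<in> torus_proj n ` (\<Pi>\<^sub>E i\<in>{..<n}. {a i..b i})"
  then obtain u where u: "u \<in> (\<Pi>\<^sub>E i\<in>{..<n}. {a i..b i})" "y = torus_proj n u" by blast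
  show "y \<in> (\<Pi>\<^sub>E i\<in>{..<n}. frac ` {a i..b i})" unfolding u(2) torus_proj_def
    using u(1) by (intro restrict_PiE_iff[THEN iffD2]) blast
qed

lemma torus_vol_box:
  assumes "\<And>i. i < n \<Longrightarrow> a i \<le> b i \<and> b i - a i \<le> 1"
  shows "torus_vol n (torus_proj n ` (\<Pi>\<^sub>E i\<in>{..<n}. {a i..b i})) = (\<Prod>i<n. b i - a i)"
proof -
  interpret product_sigma_finite "\<lambda>_::nat. lborel :: real measure" by standard
  have "emeasure (Pi\<^sub>M {..<n} (\<lambda>_. lborel)) (\<Pi>\<^sub>E i\<in>{..<n}. frac ` {a i..b i}) = (\<Prod>i<n. emeasure lborel (frac ` {a i..b i}))"
    using assms by (intro emeasure_PiM) (auto intro!: frac_image_interval_measure(1)[simplified])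
  also have "\<dots> = (\<Prod>i<n. ennreal (b i - a i))"
    using assms by (intro prod.cong refl frac_image_interval_measure(2)) auto
  also have "\<dots> = ennreal (\<Prod>i<n. b i - a i)" using assms by (intro prod_ennreal) auto
  finally show ?thesis unfolding torus_vol_def torus_proj_box measure_def
    using assms by (simp only:) (intro enn2real_ennreal prod_nonneg, auto)
qed

text \<open>On points with denominator \<open>q\<close>, a box is a product of intervals of integers
  read modulo \<open>q\<close>; this reduces the continuous discrepancy to a problem on
  residues.\<close>

lemma rational_point_in_box:
  assumes q: "q \<ge> 1"
  shows "torus_proj n (\<lambda>i. real (x i) / real q) \<in> torus_proj n ` (\<Pi>\<^sub>E i\<in>{..<n}. {a i..b i})
     \<longleftrightarrow> (\<forall>i<n. \<exists>k\<in>{\<lceil>real q * a i\<rceil>..\<lfloor>real q * b i\<rfloor>}. [k = int (x i)] (mod int q))"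
proof -
  have one: "frac (real (x i) / real q) \<in> frac ` {a i..b i} \<longleftrightarrow>
     (\<exists>k\<in>{\<lceil>real q * a i\<rceil>..\<lfloor>real q * b i\<rfloor>}. [k = int (x i)] (mod int q))" for i
  proof
    assume "frac (real (x i) / real q) \<in> frac ` {a i..b i}"
    then obtain t where t: "t \<in> {a i..b i}" "frac t = frac (real (x i) / real q)" by auto
    define j where "j = \<lfloor>t\<rfloor> - \<lfloor>real (x i) / real q\<rfloor>"
    have tj: "t = real (x i) / real q + real_of_int j" using t(2) by (simp add: frac_def j_def)
    define k where "k = int (x i) + int q * j"
    have "real_of_int k = real q * t" using q by (simp add: tj k_def field_simps)
    moreover have "real q * a i \<le> real q * t" "real q * t \<le> real q * b i" using t by (auto intro!: mult_left_mono)
    ultimately have "k \<in> {\<lceil>real q * a i\<rceil>..\<lfloor>real q * b i\<rfloor>}" by (auto simp: ceiling_le_iff le_floor_iff)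
    moreover have "[k = int (x i)] (mod int q)" by (simp add: k_def cong_iff_dvd_diff)
    ultimately show "\<exists>k\<in>{\<lceil>real q * a i\<rceil>..\<lfloor>real q * b i\<rfloor>}. [k = int (x i)] (mod int q)" by blast
  next
    assume "\<exists>k\<in>{\<lceil>real q * a i\<rceil>..\<lfloor>real q * b i\<rfloor>}. [k = int (x i)] (mod int q)"
    then obtain k where k: "\<lceil>real q * a i\<rceil> \<le> k" "k \<le> \<lfloor>real q * b i\<rfloor>" "[k = int (x i)] (mod int q)" by auto
    then obtain j where j: "k = int (x i) + int q * j" by (metis cong_iff_lin cong_sym)
    have "real_of_int k / real q = real (x i) / real q + real_of_int j" using q j by (simp add: field_simps)
    hence "frac (real (x i) / real q) = frac (real_of_int k / real q)" by simp
    moreover have "real q * a i \<le> real_of_int k" "real_of_int k \<le> real q * b i" using k by (auto simp: ceiling_le_iff le_floor_iff)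
    hence "real_of_int k / real q \<in> {a i..b i}" using q by (auto simp: field_simps)
    ultimately show "frac (real (x i) / real q) \<in> frac ` {a i..b i}" by auto
  qed
  have "torus_proj n (\<lambda>i. real (x i) / real q) \<in> (\<Pi>\<^sub>E i\<in>{..<n}. frac ` {a i..b i})
     \<longleftrightarrow> (\<forall>i<n. frac (real (x i) / real q) \<in> frac ` {a i..b i})"
    unfolding torus_proj_def by (subst restrict_PiE_iff) auto
  thus ?thesis unfolding torus_proj_box by (simp only: one)
qed

lemma abs_prod_diff_le:
  fixes x y :: "nat \<Rightarrow> real"
  assumes "\<And>i. i < n \<Longrightarrow> 0 \<le> x i \<and> x i \<le> 2 \<and> 0 \<le> y i \<and> y i \<le> 2 \<and> \<bar>x i - y i\<bar> \<le> e"
  shows "\<bar>(\<Prod>i<n. x i) - (\<Prod>i<n. y i)\<bar> \<le> real n * 2 ^ n * e"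
proof -
  \<comment> \<open>The telescoping bound for differences of products needs factors of norm at most
    1, hence the rescaling by 2, which costs the factor \<open>2 ^ n\<close>.\<close>
  have "norm ((\<Prod>i<n. x i / 2) - (\<Prod>i<n. y i / 2)) \<le> (\<Sum>i<n. norm (x i / 2 - y i / 2))"
    using assms by (intro norm_prod_diff) auto
  also have "\<dots> \<le> (\<Sum>i<n. e)"
  proof (rule sum_mono)
    fix i assume "i \<in> {..<n}"
    hence "\<bar>x i - y i\<bar> \<le> e" using assms by auto
    thus "norm (x i / 2 - y i / 2) \<le> e" by (auto simp: abs_if split: if_splits)
  qed
  finally have "\<bar>((\<Prod>i<n. x i) - (\<Prod>i<n. y i)) / 2 ^ n\<bar> \<le> real n * e"
    by (simp add: prod_dividef diff_divide_distrib)
  thus ?thesis by (simp add: field_simps)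
qed

text \<open>Products of trapezoids sandwich the indicator of the box. Their densities differ from
  the side lengths by at most \<open>J / q\<close> in each coordinate, which gives the first error
  term; the non-zero frequencies give the second.\<close>

lemma box_discrepancy_le:
  assumes q: "q \<ge> 1" and J: "2 \<le> J" "J \<le> q" and rho: "rho n A q \<ge> 1"
    and ab: "\<And>i. i < n \<Longrightarrow> a i \<le> b i \<and> b i - a i \<le> 1"
  defines "B \<equiv> torus_proj n ` (\<Pi>\<^sub>E i\<in>{..<n}. {a i..b i})"
  shows "\<bar>Delta n A q B - torus_vol n B\<bar> \<le> real n * 2 ^ n * (real J / real q) +
     (\<Sum>h\<in>{h \<in> {..<n} \<rightarrow>\<^sub>E sym_residues q. \<exists>i<n. h i \<noteq> 0}. (\<Prod>i<n. trap_bound q J (h i)) * norm (weyl n A q h 1))"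
    (is "_ \<le> ?e + ?R")
proof -
  define L where "L i = \<lceil>real q * a i\<rceil>" for i
  define N where "N i = nat (\<lfloor>real q * b i\<rfloor> - L i + 1)" for i
  have qab: "real q * a i \<le> real q * b i" "real q * b i \<le> real q * a i + real q" if "i < n" for i
    using ab[OF that] mult_left_mono[of "b i - a i" 1 "real q"] by (auto intro!: mult_left_mono simp: right_diff_distrib)
  have N: "int (N i) = \<lfloor>real q * b i\<rfloor> - L i + 1" if "i < n" for i
    using qab[OF that] unfolding N_def L_def by linarith
  have NR: "real (N i) \<ge> real q * (b i - a i) - 1" "real (N i) \<le> real q * (b i - a i) + 1" if "i < n" for i
  proof -
    have "real (N i) = real_of_int \<lfloor>real q * b i\<rfloor> - real_of_int (L i) + 1" using N[OF that] by (metis of_int_1 of_int_add of_int_diff of_int_of_nat_eq)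
    moreover have "real_of_int (L i) \<le> real q * a i + 1" "real_of_int (L i) \<ge> real q * a i" unfolding L_def by linarith+
    moreover have "real_of_int \<lfloor>real q * b i\<rfloor> \<le> real q * b i" "real_of_int \<lfloor>real q * b i\<rfloor> \<ge> real q * b i - 1" by linarith+
    ultimately show "real (N i) \<ge> real q * (b i - a i) - 1" "real (N i) \<le> real q * (b i - a i) + 1"
      unfolding right_diff_distrib by linarith+
  qed
  \<comment> \<open>A closed interval of length \<open>q\<close> may contain \<open>q + 1\<close>
    integers. This is why \<open>2 \<le> J\<close> is imposed: it yields
    \<open>N i \<le> q + J - 1\<close> for the minorant, while \<open>J \<le> q\<close> gives
    \<open>N i + J - 1 \<le> 2 * q\<close> for the majorant.\<close>
  have Nq: "N i \<le> q + 1" if "i < n" for i using NR(2)[OF that] qab[OF that] by (simp add: right_diff_distrib)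
  have I: "{\<lceil>real q * a i\<rceil>..\<lfloor>real q * b i\<rfloor>} = {L i..<L i + int (N i)}" if "i < n" for i
    using N[OF that] by (auto simp: L_def)
  let ?C = "crt_set n A q"
  define P where "P x i \<longleftrightarrow> (\<exists>k\<in>{L i..<L i + int (N i)}. [k = int (x i)] (mod int q))" for x :: "nat \<Rightarrow> nat" and i
  have ind: "indicator B (torus_proj n (\<lambda>i. real (x i) / real q)) = (\<Prod>i<n. if P x i then 1 else (0::real))" for x
    using rational_point_in_box[OF q, of n x a b] unfolding B_def P_def
    by (auto simp: indicator_def I prod_zero_iff)
  define up where "up x i = trapezoid q J (L i - int J + 1) (N i + J - 1) (int (x i))" for x :: "nat \<Rightarrow> nat" and i
  define lo where "lo x i = trapezoid q J (L i) (N i + 1 - J) (int (x i))" for x :: "nat \<Rightarrow> nat" and i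
  have 1: "(if P x i then 1 else 0) \<le> up x i" for x i
    using trapezoid_ge_1[of J _ "L i" "N i" "int (x i)" q] trapezoid_nonneg J by (auto simp: P_def up_def)
  have 2: "lo x i \<le> (if P x i then 1 else 0)" if "i < n" for x i
    using trapezoid_le_indicator[of J "N i" q "L i" "int (x i)"] Nq[OF that] J unfolding lo_def P_def by linarith
  have D: "Delta n A q B = (\<Sum>x\<in>?C. \<Prod>i<n. if P x i then 1 else (0::real)) / real (rho n A q)"
    by (simp add: Delta_def ind)
  have vol: "torus_vol n B = (\<Prod>i<n. b i - a i)" unfolding B_def by (rule torus_vol_box[OF ab])
  have Jq: "real J / real q > 0" using J q by simp
  have "Delta n A q B \<le> (\<Sum>x\<in>?C. \<Prod>i<n. up x i) / real (rho n A q)" unfolding D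
    using 1 by (intro divide_right_mono sum_mono prod_mono) auto
  also have "\<dots> \<le> (\<Prod>i<n. real (N i + J - 1) / real q) + ?R"
    using average_trapezoid_product[of q J n "\<lambda>i. N i + J - 1" A "\<lambda>i. L i - int J + 1"] q J Nq rho
    unfolding up_def by fastforce
  also have "(\<Prod>i<n. real (N i + J - 1) / real q) \<le> (\<Prod>i<n. b i - a i) + ?e"
  proof -
    have "\<bar>(\<Prod>i<n. real (N i + J - 1) / real q) - (\<Prod>i<n. b i - a i)\<bar> \<le> ?e"
    proof (intro abs_prod_diff_le conjI)
      fix i assume i: "i < n"
      have e: "real (N i + J - 1) / real q - (b i - a i) = (real (N i) + real J - 1 - real q * (b i - a i)) / real q"
        using q J by (simp add: field_simps of_nat_diff)
      have "0 \<le> real (N i + J - 1) / real q - (b i - a i)" "real (N i + J - 1) / real q - (b i - a i) \<le> real J / real q"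
        unfolding e using NR[OF i] J by (auto intro!: divide_right_mono divide_nonneg_nonneg)
      thus "\<bar>real (N i + J - 1) / real q - (b i - a i)\<bar> \<le> real J / real q" by linarith
      have "real (N i + J - 1) \<le> 2 * real q" using Nq[OF i] J by linarith
      thus "real (N i + J - 1) / real q \<le> 2" using q by (simp add: divide_simps)
    qed (use ab in fastforce)+
    thus ?thesis by linarith
  qed
  finally have U: "Delta n A q B \<le> torus_vol n B + ?e + ?R" unfolding vol by simp
  have "(\<Prod>i<n. b i - a i) - ?e \<le> (\<Prod>i<n. real (N i + 1 - J) / real q)"
  proof -
    have "\<bar>(\<Prod>i<n. real (N i + 1 - J) / real q) - (\<Prod>i<n. b i - a i)\<bar> \<le> ?e"
    proof (intro abs_prod_diff_le conjI)
      fix i assume i: "i < n"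
      have "real (N i + 1 - J) \<le> real q * (b i - a i)" "real (N i + 1 - J) \<ge> real q * (b i - a i) - real J"
        using NR[OF i] J ab[OF i] by (cases "N i + 1 \<le> J"; auto simp: of_nat_diff)+
      hence "real (N i + 1 - J) / real q \<le> (real q * (b i - a i)) / real q"
        "(real q * (b i - a i) - real J) / real q \<le> real (N i + 1 - J) / real q" by (intro divide_right_mono; simp)+
      thus "\<bar>real (N i + 1 - J) / real q - (b i - a i)\<bar> \<le> real J / real q"
        using q by (simp add: diff_divide_distrib abs_le_iff)
      have "real (N i + 1 - J) \<le> 2 * real q" using Nq[OF i] J by linarith
      thus "real (N i + 1 - J) / real q \<le> 2" using q by (simp add: divide_simps)
    qed (use ab in fastforce)+
    thus ?thesis by linarith
  qed
  also have "\<dots> \<le> (\<Sum>x\<in>?C. \<Prod>i<n. lo x i) / real (rho n A q) + ?R"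
    using average_trapezoid_product[of q J n "\<lambda>i. N i + 1 - J" A L] q J Nq rho
    unfolding lo_def by fastforce
  also have "(\<Sum>x\<in>?C. \<Prod>i<n. lo x i) / real (rho n A q) \<le> Delta n A q B" unfolding D
    using 2 trapezoid_nonneg unfolding lo_def by (intro divide_right_mono sum_mono prod_mono) auto
  finally show ?thesis using U unfolding vol by linarith
qed

section \<open>Truncation to boundedly many frequencies\<close>

definition freq_weight :: "int \<Rightarrow> real" where
  "freq_weight h = (if h = 0 then 2 else 1 / real_of_int \<bar>h\<bar>)"

definition freqs :: "nat \<Rightarrow> nat \<Rightarrow> (nat \<Rightarrow> int) set" where
  "freqs n M = {h \<in> {..<n} \<rightarrow>\<^sub>E {- int M..int M}. \<exists>i<n. h i \<noteq> 0}"

lemma freq_weight_nonneg: "freq_weight h \<ge> 0"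
  by (simp add: freq_weight_def)

lemma sum_abs_int_le:
  fixes f :: "nat \<Rightarrow> real"
  assumes "\<And>h. h \<in> S \<Longrightarrow> nat \<bar>h\<bar> \<in> {a..b}" "\<And>m. f m \<ge> 0"
  shows "(\<Sum>h\<in>S. f (nat \<bar>h\<bar>)) \<le> 2 * (\<Sum>m=a..b. f m)"
proof -
  have sub: "S \<subseteq> int ` {a..b} \<union> (\<lambda>m. - int m) ` {a..b}"
  proof
    fix h assume h: "h \<in> S"
    have "h = int (nat \<bar>h\<bar>) \<or> h = - int (nat \<bar>h\<bar>)" by linarith
    thus "h \<in> int ` {a..b} \<union> (\<lambda>m. - int m) ` {a..b}" using assms(1)[OF h] by blast
  qed
  have "(\<Sum>h\<in>S. f (nat \<bar>h\<bar>)) \<le> (\<Sum>h\<in>int ` {a..b} \<union> (\<lambda>m. - int m) ` {a..b}. f (nat \<bar>h\<bar>))"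
    using assms(2) by (intro sum_mono2 sub) auto
  also have "\<dots> \<le> (\<Sum>h\<in>int ` {a..b}. f (nat \<bar>h\<bar>)) + (\<Sum>h\<in>(\<lambda>m. - int m) ` {a..b}. f (nat \<bar>h\<bar>))"
    using assms(2) by (subst sum.union_inter[symmetric]) (auto intro: sum_nonneg)
  also have "(\<Sum>h\<in>int ` {a..b}. f (nat \<bar>h\<bar>)) = (\<Sum>m=a..b. f m)"
    by (subst sum.reindex) auto
  also have "(\<Sum>h\<in>(\<lambda>m. - int m) ` {a..b}. f (nat \<bar>h\<bar>)) = (\<Sum>m=a..b. f m)"
    by (subst sum.reindex) (auto intro!: inj_onI)
  finally show ?thesis by simp
qed

lemma sum_inverse_squares_tail:
  assumes "M \<ge> 1"
  shows "(\<Sum>m=M+1..K. 1 / (real m)\<^sup>2) \<le> 1 / real M"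
proof (cases "K \<ge> M")
  case True
  have "(\<Sum>m=M+1..K. 1 / (real m)\<^sup>2) \<le> 1 / real M - 1 / real K" using True
  proof (induction K rule: dec_induct)
    case (step K)
    have K: "real K > 0" "real (Suc K) > 0" using step assms by auto
    have "(\<Sum>m=M+1..Suc K. 1 / (real m)\<^sup>2) = (\<Sum>m=M+1..K. 1 / (real m)\<^sup>2) + 1 / (real (Suc K))\<^sup>2"
      using step by simp
    also have "\<dots> \<le> (1 / real M - 1 / real K) + 1 / (real K * real (Suc K))"
      using step K by (intro add_mono divide_left_mono) (auto simp: power2_eq_square)
    also have "1 / (real K * real (Suc K)) = 1 / real K - 1 / real (Suc K)"
      using K by (simp add: divide_simps del: of_nat_Suc)
    finally show ?case by simp
  qed auto
  moreover have "0 \<le> 1 / real K" by simp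
  ultimately show ?thesis by linarith
qed auto

lemma harm_le_1_plus_ln:
  assumes "M \<ge> 1"
  shows "(\<Sum>m=1..M. 1 / real m) \<le> 1 + ln (real M)"
  using assms
proof (induction M rule: dec_induct)
  case (step M)
  have M: "real M > 0" "real (Suc M) > 0" using step by auto
  have "ln (real M / real (Suc M)) \<le> real M / real (Suc M) - 1" using M by (intro ln_le_minus_one) auto
  also have "\<dots> = - (1 / real (Suc M))" using M by (simp add: field_simps)
  finally have "1 / real (Suc M) \<le> ln (real (Suc M)) - ln (real M)" using M by (subst (asm) ln_div) auto
  thus ?case using step by simp
qed auto

lemma trap_bound_le_freq_weight: "trap_bound q J h \<le> freq_weight h"
  by (simp add: trap_bound_def freq_weight_def)

lemma sum_trap_bound_tail:
  assumes "J \<ge> 1" "M \<ge> 1"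
  shows "(\<Sum>h\<in>{h\<in>sym_residues q. \<bar>h\<bar> > int M}. trap_bound q J h) \<le> 2 * (real q / real J) / real M"
proof -
  have "(\<Sum>h\<in>{h\<in>sym_residues q. \<bar>h\<bar> > int M}. trap_bound q J h)
     \<le> (\<Sum>h\<in>{h\<in>sym_residues q. \<bar>h\<bar> > int M}. real q / real J * (1 / (real (nat \<bar>h\<bar>))\<^sup>2))"
    by (rule sum_mono) (auto simp: trap_bound_def min_le_iff_disj)
  also have "\<dots> \<le> 2 * (\<Sum>m=M+1..q. real q / real J * (1 / (real m)\<^sup>2))"
    by (rule sum_abs_int_le) (auto dest: sym_residues_abs)
  also have "\<dots> = 2 * (real q / real J) * (\<Sum>m=M+1..q. 1 / (real m)\<^sup>2)"
    by (simp add: sum_distrib_left mult_ac)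
  also have "\<dots> \<le> 2 * (real q / real J) * (1 / real M)"
    using sum_inverse_squares_tail[OF assms(2), of q] by (intro mult_left_mono) auto
  finally show ?thesis by simp
qed

lemma sum_freq_weight_le:
  assumes "M \<ge> 1"
  shows "(\<Sum>h=-int M..int M. freq_weight h) \<le> 4 + 2 * ln (real M)"
proof -
  have "(\<Sum>h=-int M..int M. freq_weight h) = freq_weight 0 + (\<Sum>h\<in>{-int M..int M} - {0}. freq_weight h)"
    by (rule sum.remove) auto
  also have "(\<Sum>h\<in>{-int M..int M} - {0}. freq_weight h) = (\<Sum>h\<in>{-int M..int M} - {0}. 1 / real (nat \<bar>h\<bar>))"
    by (intro sum.cong) (auto simp: freq_weight_def)
  also have "\<dots> \<le> 2 * (\<Sum>m=1..M. 1 / real m)" by (rule sum_abs_int_le) auto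
  also have "\<dots> \<le> 2 * (1 + ln (real M))" using harm_le_1_plus_ln[OF assms] by simp
  finally show ?thesis by (simp add: freq_weight_def)
qed

lemma sum_trap_bound_le:
  assumes "J \<ge> 1" "M \<ge> 1"
  shows "(\<Sum>h\<in>sym_residues q. trap_bound q J h) \<le> 4 + 2 * ln (real M) + 2 * (real q / real J) / real M"
proof -
  have "(\<Sum>h\<in>sym_residues q. trap_bound q J h) \<le>
     (\<Sum>h\<in>{-int M..int M} \<union> {h\<in>sym_residues q. \<bar>h\<bar> > int M}. trap_bound q J h)"
    using trap_bound_nonneg by (intro sum_mono2) auto
  also have "\<dots> = (\<Sum>h=-int M..int M. trap_bound q J h) + (\<Sum>h\<in>{h\<in>sym_residues q. \<bar>h\<bar> > int M}. trap_bound q J h)"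
    by (intro sum.union_disjoint) auto
  also have "\<dots> \<le> (\<Sum>h=-int M..int M. freq_weight h) + 2 * (real q / real J) / real M"
    using sum_trap_bound_tail[OF assms] by (intro add_mono sum_mono trap_bound_le_freq_weight)
  finally show ?thesis using sum_freq_weight_le[OF assms(2)] by linarith
qed

lemma sum_UN_le_sum_sum:
  fixes f :: "'a \<Rightarrow> real"
  assumes "finite I" "\<And>i. i \<in> I \<Longrightarrow> finite (B i)" "\<And>x. f x \<ge> 0"
  shows "sum f (\<Union>i\<in>I. B i) \<le> (\<Sum>i\<in>I. sum f (B i))"
  using assms(1,2)
proof (induction I rule: finite_induct)
  case (insert i I)
  have "sum f (\<Union>i\<in>insert i I. B i) = sum f (B i) + sum f (\<Union>i\<in>I. B i) - sum f (B i \<inter> (\<Union>i\<in>I. B i))"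
    using insert by (simp only: UN_insert) (intro sum_Un, auto)
  moreover have "sum f (B i \<inter> (\<Union>i\<in>I. B i)) \<ge> 0" using assms(3) by (intro sum_nonneg) auto
  moreover have "sum f (\<Union>i\<in>I. B i) \<le> (\<Sum>i\<in>I. sum f (B i))" using insert by auto
  moreover have "(\<Sum>i\<in>insert i I. sum f (B i)) = sum f (B i) + (\<Sum>i\<in>I. sum f (B i))"
    using insert by simp
  ultimately show ?case by linarith
qed simp

text \<open>An Erdos-Turan-Koksma inequality whose cut-off and error depend on \<open>H\<close>
  alone. Smoothing at scale \<open>J\<close> close to \<open>q / H\<close> costs
  \<open>1 / H\<close>, and truncating at \<open>H^2\<close> costs q / (J H^2), again of order
  \<open>1 / H\<close>, times powers of ln H. So one finite set of frequencies serves all moduli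
  \<open>q \<ge> 2 * H\<close>.\<close>

lemma disc_Delta_le:
  assumes n: "n \<ge> 1" and H: "H \<ge> 1" and q: "q \<ge> 2 * H" and rho: "rho n A q \<ge> 1"
  shows "disc n (Delta n A q) \<le> (real n * 2 ^ n + 4 * real n * (8 + 4 * ln (real H)) ^ n) / real H
     + (\<Sum>h\<in>freqs n (H\<^sup>2). (\<Prod>i<n. freq_weight (h i)) * norm (weyl n A q h 1))"
proof -
  \<comment> \<open>\<open>q \<ge> 2 * H\<close> makes this at least 2, and rounding down at most
    halves it, whence \<open>q / J \<le> 2 * H\<close>.\<close>
  define J where "J = q div H"
  define M where "M = H\<^sup>2"
  have q1: "q \<ge> 1" using q H by simp
  have J: "2 \<le> J" "J \<le> q" using q H by (auto simp: J_def less_eq_div_iff_mult_less_eq)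
  have M: "M \<ge> 1" using H by (simp add: M_def)
  have Hpos: "real H > 0" using H by simp
  have JH: "real J / real q \<le> 1 / real H"
  proof -
    have "J * H \<le> q" by (simp add: J_def)
    hence "real J * real H \<le> real q" by (metis of_nat_le_iff of_nat_mult)
    thus ?thesis using Hpos q1 by (simp add: divide_simps mult.commute)
  qed
  have qJ: "real q / real J \<le> 2 * real H"
  proof -
    have "q mod H < H" using H by simp
    hence "q < J * H + H" using div_mult_mod_eq[of q H] unfolding J_def by linarith
    also have "J * H + H \<le> 2 * (J * H)" using J by (cases J) auto
    finally have "real q \<le> 2 * (real J * real H)" by (metis less_imp_le of_nat_le_iff of_nat_mult of_nat_numeral)
    thus ?thesis using J by (simp add: divide_simps mult_ac)
  qed
  define T where "T = (\<Sum>h\<in>{h\<in>sym_residues q. \<bar>h\<bar> > int M}. trap_bound q J h)"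
  define G where "G = (\<Sum>h\<in>sym_residues q. trap_bound q J h)"
  have TM: "2 * (real q / real J) / real M \<le> 4 / real H"
  proof -
    have "2 * (real q / real J) / real M \<le> 2 * (2 * real H) / real M" using qJ by (intro divide_right_mono mult_left_mono) auto
    also have "\<dots> = 4 / real H" using Hpos by (simp add: M_def power2_eq_square)
    finally show ?thesis .
  qed
  have T: "T \<le> 4 / real H" using sum_trap_bound_tail[of J M q] J M TM unfolding T_def by linarith
  have T0: "T \<ge> 0" unfolding T_def by (intro sum_nonneg trap_bound_nonneg)
  have "4 / real H \<le> 4" using H by (simp add: divide_simps)
  moreover have "ln (real M) = 2 * ln (real H)" using Hpos by (simp add: M_def ln_realpow)
  ultimately have G: "G \<le> 8 + 4 * ln (real H)" using sum_trap_bound_le[of J M q] J M TM unfolding G_def by linarith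
  have G0: "G \<ge> 0" unfolding G_def by (intro sum_nonneg trap_bound_nonneg)
  have lnH: "ln (real H) \<ge> 0" using H by simp
  define K where "K = 8 + 4 * ln (real H)"
  have K: "K \<ge> 1" using lnH by (simp add: K_def)
  let ?P = "{..<n} \<rightarrow>\<^sub>E sym_residues q"
  let ?t = "\<lambda>h. \<Prod>i<n. trap_bound q J (h i)"
  let ?w = "\<lambda>h. \<Prod>i<n. freq_weight (h i)"
  have t0: "?t h \<ge> 0" for h by (intro prod_nonneg) (auto simp: trap_bound_nonneg)
  have finP: "finite ?P" by (intro finite_PiE) auto
  \<comment> \<open>Frequencies whose \<open>j\<close>-th coordinate exceeds \<open>M\<close>. The
    sum over them factors by coordinates into one small tail \<open>T\<close> and
    \<open>n - 1\<close> full sums \<open>G\<close>; the Weyl sums are bounded by 1 there.\<close>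
  define Bad where "Bad j = {h \<in> ?P. \<bar>h j\<bar> > int M}" for j
  have bad: "(\<Sum>h\<in>Bad j. ?t h) \<le> 4 / real H * K ^ n" if j: "j < n" for j
  proof -
    define S where "S i = (if i = j then {h\<in>sym_residues q. \<bar>h\<bar> > int M} else sym_residues q)" for i
    have "Bad j = PiE {..<n} S" using j unfolding Bad_def S_def
      by (auto simp: PiE_def Pi_def split: if_splits)
    hence "(\<Sum>h\<in>Bad j. ?t h) = (\<Prod>i<n. \<Sum>h\<in>S i. trap_bound q J h)"
      by (simp only:) (rule prod_sum_PiE[symmetric], auto simp: S_def)
    also have "\<dots> = (\<Sum>h\<in>S j. trap_bound q J h) * (\<Prod>i\<in>{..<n} - {j}. \<Sum>h\<in>S i. trap_bound q J h)"
      using j by (intro prod.remove) auto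
    also have "(\<Prod>i\<in>{..<n} - {j}. \<Sum>h\<in>S i. trap_bound q J h) = (\<Prod>i\<in>{..<n} - {j}. G)"
      by (intro prod.cong) (auto simp: S_def G_def)
    also have "\<dots> = G ^ (n - 1)" using j by simp
    also have "(\<Sum>h\<in>S j. trap_bound q J h) = T" by (simp add: S_def T_def)
    also have "T * G ^ (n - 1) \<le> 4 / real H * K ^ n"
    proof (intro mult_mono T)
      have "G ^ (n - 1) \<le> K ^ (n - 1)" using G G0 by (intro power_mono) (auto simp: K_def)
      also have "\<dots> \<le> K ^ n" using K by (intro power_increasing) auto
      finally show "G ^ (n - 1) \<le> K ^ n" .
    qed (use G0 in auto)
    finally show ?thesis .
  qed
  have "(\<Sum>h\<in>{h\<in>?P. \<exists>i<n. h i \<noteq> 0}. ?t h * norm (weyl n A q h 1))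
     \<le> (\<Sum>h\<in>(\<Union>j<n. Bad j) \<union> {h \<in> ?P. (\<exists>i<n. h i \<noteq> 0) \<and> (\<forall>i<n. \<bar>h i\<bar> \<le> int M)}. ?t h * norm (weyl n A q h 1))"
  proof (intro sum_mono2)
    show "finite ((\<Union>j<n. Bad j) \<union> {h \<in> ?P. (\<exists>i<n. h i \<noteq> 0) \<and> (\<forall>i<n. \<bar>h i\<bar> \<le> int M)})"
      using finP by (auto simp: Bad_def)
    show "{h\<in>?P. \<exists>i<n. h i \<noteq> 0} \<subseteq> (\<Union>j<n. Bad j) \<union> {h \<in> ?P. (\<exists>i<n. h i \<noteq> 0) \<and> (\<forall>i<n. \<bar>h i\<bar> \<le> int M)}"
    proof
      fix h assume h: "h \<in> {h\<in>?P. \<exists>i<n. h i \<noteq> 0}"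
      show "h \<in> (\<Union>j<n. Bad j) \<union> {h \<in> ?P. (\<exists>i<n. h i \<noteq> 0) \<and> (\<forall>i<n. \<bar>h i\<bar> \<le> int M)}"
      proof (cases "\<forall>i<n. \<bar>h i\<bar> \<le> int M")
        case False
        then obtain j where "j < n" "\<bar>h j\<bar> > int M" by (meson not_le)
        hence "h \<in> Bad j" using h unfolding Bad_def by blast
        thus ?thesis using \<open>j < n\<close> by blast
      qed (use h in blast)
    qed
  qed (use t0 in auto)
  also have "\<dots> \<le> (\<Sum>h\<in>(\<Union>j<n. Bad j). ?t h * norm (weyl n A q h 1)) +
      (\<Sum>h\<in>{h \<in> ?P. (\<exists>i<n. h i \<noteq> 0) \<and> (\<forall>i<n. \<bar>h i\<bar> \<le> int M)}. ?t h * norm (weyl n A q h 1))"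
    using finP t0 by (subst sum.union_inter[symmetric]) (auto simp: Bad_def intro!: sum_nonneg)
  also have "(\<Sum>h\<in>(\<Union>j<n. Bad j). ?t h * norm (weyl n A q h 1)) \<le> (\<Sum>h\<in>(\<Union>j<n. Bad j). ?t h)"
    using t0 norm_weyl_le_1 by (intro sum_mono) (auto intro: mult_left_le)
  also have "(\<Sum>h\<in>(\<Union>j<n. Bad j). ?t h) \<le> (\<Sum>j<n. \<Sum>h\<in>Bad j. ?t h)"
    using t0 finP by (intro sum_UN_le_sum_sum) (auto simp: Bad_def)
  also have "\<dots> \<le> (\<Sum>j<n. 4 / real H * K ^ n)" using bad by (intro sum_mono) auto
  also have "\<dots> = 4 * real n * K ^ n / real H" by simp
  also have "(\<Sum>h\<in>{h \<in> ?P. (\<exists>i<n. h i \<noteq> 0) \<and> (\<forall>i<n. \<bar>h i\<bar> \<le> int M)}. ?t h * norm (weyl n A q h 1))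
     \<le> (\<Sum>h\<in>freqs n M. ?w h * norm (weyl n A q h 1))"
  proof -
    have ff: "finite (freqs n M)"
      by (rule finite_subset[of _ "{..<n} \<rightarrow>\<^sub>E {- int M..int M}"]) (auto simp: freqs_def intro!: finite_PiE)
    have "(\<Sum>h\<in>{h \<in> ?P. (\<exists>i<n. h i \<noteq> 0) \<and> (\<forall>i<n. \<bar>h i\<bar> \<le> int M)}. ?t h * norm (weyl n A q h 1))
      \<le> (\<Sum>h\<in>{h \<in> ?P. (\<exists>i<n. h i \<noteq> 0) \<and> (\<forall>i<n. \<bar>h i\<bar> \<le> int M)}. ?w h * norm (weyl n A q h 1))"
      by (intro sum_mono mult_right_mono prod_mono) (auto simp: trap_bound_nonneg trap_bound_le_freq_weight)
    also have "\<dots> \<le> (\<Sum>h\<in>freqs n M. ?w h * norm (weyl n A q h 1))"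
    proof (intro sum_mono2 ff)
      show "{h \<in> ?P. (\<exists>i<n. h i \<noteq> 0) \<and> (\<forall>i<n. \<bar>h i\<bar> \<le> int M)} \<subseteq> freqs n M"
        unfolding freqs_def by (auto simp: PiE_def Pi_def abs_le_iff)
    qed (auto intro!: mult_nonneg_nonneg prod_nonneg freq_weight_nonneg)
    finally show ?thesis .
  qed
  finally have R: "(\<Sum>h\<in>{h\<in>?P. \<exists>i<n. h i \<noteq> 0}. ?t h * norm (weyl n A q h 1))
     \<le> 4 * real n * K ^ n / real H + (\<Sum>h\<in>freqs n M. ?w h * norm (weyl n A q h 1))" by simp
  show ?thesis unfolding disc_def
  proof (rule cSUP_least)
    show "torus_boxes n \<noteq> {}" unfolding torus_boxes_def by (auto intro!: exI[of _ "\<lambda>_. 0"])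
    fix B assume "B \<in> torus_boxes n"
    then obtain a b where ab: "B = torus_proj n ` (\<Pi>\<^sub>E i\<in>{..<n}. {a i..b i})" "\<And>i. i < n \<Longrightarrow> a i \<le> b i \<and> b i - a i \<le> 1"
      unfolding torus_boxes_def by blast
    have "\<bar>Delta n A q B - torus_vol n B\<bar> \<le> real n * 2 ^ n * (real J / real q) +
       (\<Sum>h\<in>{h\<in>?P. \<exists>i<n. h i \<noteq> 0}. ?t h * norm (weyl n A q h 1))"
      unfolding ab(1) by (rule box_discrepancy_le[OF q1 J rho]) (rule ab(2))
    also have "real n * 2 ^ n * (real J / real q) \<le> real n * 2 ^ n * (1 / real H)" using JH by (intro mult_left_mono) auto
    finally show "\<bar>Delta n A q B - torus_vol n B\<bar> \<le> (real n * 2 ^ n + 4 * real n * (8 + 4 * ln (real H)) ^ n) / real H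
     + (\<Sum>h\<in>freqs n (H\<^sup>2). ?w h * norm (weyl n A q h 1))"
      using R unfolding K_def[symmetric] M_def[symmetric] by (simp add: add_divide_distrib)
  qed
qed

text \<open>The trivial bound for the moduli up to \<open>sqrt x\<close>, which are too few to
  matter.\<close>

lemma disc_Delta_le_1: "disc n (Delta n A q) \<le> 1"
  unfolding disc_def
proof (rule cSUP_least)
  show "torus_boxes n \<noteq> {}" unfolding torus_boxes_def by (auto intro!: exI[of _ "\<lambda>_. 0"])
  fix B assume "B \<in> torus_boxes n"
  then obtain a b where ab: "B = torus_proj n ` (\<Pi>\<^sub>E i\<in>{..<n}. {a i..b i})" "\<And>i. i < n \<Longrightarrow> a i \<le> b i \<and> b i - a i \<le> 1"
    unfolding torus_boxes_def by blast
  have "torus_vol n B = (\<Prod>i<n. b i - a i)" unfolding ab(1) by (rule torus_vol_box) (rule ab(2))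
  hence "0 \<le> torus_vol n B" "torus_vol n B \<le> 1"
    using ab(2) by (auto intro!: prod_nonneg prod_le_1)
  moreover have "0 \<le> Delta n A q B" unfolding Delta_def by (intro mult_nonneg_nonneg sum_nonneg) auto
  moreover have "Delta n A q B \<le> 1"
  proof -
    have "(\<Sum>a\<in>crt_set n A q. indicator B (torus_proj n (\<lambda>i. real (a i) / real q))) \<le> (\<Sum>a\<in>crt_set n A q. 1::real)"
      by (intro sum_mono) (auto simp: indicator_def)
    thus ?thesis by (cases "rho n A q = 0") (auto simp: Delta_def rho_def divide_simps)
  qed
  ultimately show "\<bar>Delta n A q B - torus_vol n B\<bar> \<le> 1" by linarith
qed

lemma sum_freqs_weight_le:
  assumes "M \<ge> 1"
  shows "(\<Sum>h\<in>freqs n M. \<Prod>i<n. freq_weight (h i)) \<le> (4 + 2 * ln (real M)) ^ n"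
proof -
  have "(\<Sum>h\<in>freqs n M. \<Prod>i<n. freq_weight (h i)) \<le> (\<Sum>h\<in>{..<n} \<rightarrow>\<^sub>E {- int M..int M}. \<Prod>i<n. freq_weight (h i))"
    by (intro sum_mono2 finite_PiE) (auto simp: freqs_def freq_weight_nonneg intro: prod_nonneg)
  also have "\<dots> = (\<Prod>i<n. \<Sum>h=-int M..int M. freq_weight h)"
    by (rule prod_sum_PiE[symmetric]) auto
  also have "\<dots> = (\<Sum>h=-int M..int M. freq_weight h) ^ n" by simp
  also have "\<dots> \<le> (4 + 2 * ln (real M)) ^ n"
    using sum_freq_weight_le[OF assms] by (intro power_mono sum_nonneg freq_weight_nonneg) auto
  finally show ?thesis .
qed

section \<open>Elementary symmetric sums and sums over primes\<close>

definition elem_sym :: "'a set \<Rightarrow> ('a \<Rightarrow> real) \<Rightarrow> nat \<Rightarrow> real" where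
  "elem_sym T g j = (\<Sum>U\<in>{U. U \<subseteq> T \<and> card U = j}. prod g U)"

lemma elem_sym_0: "finite T \<Longrightarrow> elem_sym T g 0 = 1"
proof -
  assume "finite T"
  hence "{U. U \<subseteq> T \<and> card U = 0} = {{}}" by (auto dest: finite_subset)
  thus ?thesis by (simp only: elem_sym_def) simp
qed

text \<open>Both sides count a set of \<open>Suc j\<close> elements together with a distinguished
  element; removing or inserting that element passes between them.\<close>

lemma elem_sym_Suc:
  assumes "finite T"
  shows "real (Suc j) * elem_sym T g (Suc j) = (\<Sum>U\<in>{U. U \<subseteq> T \<and> card U = j}. prod g U * sum g (T - U))"
proof -
  have fin: "finite {U. U \<subseteq> T \<and> card U = k}" for k using assms by simp
  have "real (Suc j) * elem_sym T g (Suc j) = (\<Sum>V\<in>{V. V \<subseteq> T \<and> card V = Suc j}. \<Sum>t\<in>V. prod g V)"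
    unfolding elem_sym_def sum_distrib_left by (intro sum.cong) auto
  also have "\<dots> = (\<Sum>(V,t)\<in>(SIGMA V:{V. V \<subseteq> T \<and> card V = Suc j}. V). prod g V)"
    using assms by (intro sum.Sigma) (auto dest: finite_subset)
  also have "\<dots> = (\<Sum>(U,t)\<in>(SIGMA U:{U. U \<subseteq> T \<and> card U = j}. T - U). prod g U * g t)"
  proof (rule sum.reindex_bij_witness[of _ "\<lambda>(U,t). (insert t U, t)" "\<lambda>(V,t). (V - {t}, t)"])
    fix a assume a: "a \<in> (SIGMA V:{V. V \<subseteq> T \<and> card V = Suc j}. V)"
    then obtain V t where Vt: "a = (V, t)" "V \<subseteq> T" "card V = Suc j" "t \<in> V" by auto
    have fV: "finite V" using Vt assms finite_subset by auto
    show "(case case a of (V, t) \<Rightarrow> (V - {t}, t) of (U, t) \<Rightarrow> (insert t U, t)) = a" using Vt by auto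
    show "(case a of (V, t) \<Rightarrow> (V - {t}, t)) \<in> (SIGMA U:{U. U \<subseteq> T \<and> card U = j}. T - U)"
      using Vt fV by auto
    show "(case case a of (V, t) \<Rightarrow> (V - {t}, t) of (U, t) \<Rightarrow> prod g U * g t) = (case a of (V, t) \<Rightarrow> prod g V)"
      using Vt fV prod.remove[of V t g] by (simp add: mult.commute)
  next
    fix b assume b: "b \<in> (SIGMA U:{U. U \<subseteq> T \<and> card U = j}. T - U)"
    then obtain U t where Ut: "b = (U, t)" "U \<subseteq> T" "card U = j" "t \<in> T" "t \<notin> U" by auto
    have fU: "finite U" using Ut assms finite_subset by auto
    show "(case case b of (U, t) \<Rightarrow> (insert t U, t) of (V, t) \<Rightarrow> (V - {t}, t)) = b" using Ut by auto
    show "(case b of (U, t) \<Rightarrow> (insert t U, t)) \<in> (SIGMA V:{V. V \<subseteq> T \<and> card V = Suc j}. V)"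
      using Ut fU by auto
  qed
  also have "\<dots> = (\<Sum>U\<in>{U. U \<subseteq> T \<and> card U = j}. \<Sum>t\<in>T - U. prod g U * g t)"
    using assms by (intro sum.Sigma[symmetric]) auto
  finally show ?thesis by (simp add: sum_distrib_left)
qed

lemma elem_sym_le:
  assumes "finite T" "\<And>t. t \<in> T \<Longrightarrow> g t \<ge> 0"
  shows "elem_sym T g j \<le> sum g T ^ j / fact j"
proof (induction j)
  case 0
  show ?case using elem_sym_0[OF assms(1)] by simp
next
  case (Suc j)
  have "real (Suc j) * elem_sym T g (Suc j) \<le> (\<Sum>U\<in>{U. U \<subseteq> T \<and> card U = j}. prod g U * sum g T)"
    unfolding elem_sym_Suc[OF assms(1)]
    using assms by (intro sum_mono mult_left_mono sum_mono2 prod_nonneg) auto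
  also have "\<dots> = elem_sym T g j * sum g T" by (simp add: elem_sym_def sum_distrib_right)
  also have "\<dots> \<le> sum g T ^ j / fact j * sum g T" using Suc assms by (intro mult_right_mono sum_nonneg) auto
  finally have "real (Suc j) * elem_sym T g (Suc j) \<le> sum g T ^ Suc j / fact j" by (simp add: mult.commute)
  hence "elem_sym T g (Suc j) \<le> sum g T ^ Suc j / fact j / real (Suc j)"
    by (subst pos_le_divide_eq) (auto simp: mult.commute)
  thus ?case by (simp only: fact_Suc divide_divide_eq_left of_nat_mult mult.commute)
qed

text \<open>Building a \<open>j\<close>-set one element at a time, the elements already chosen
  remove at most \<open>E\<close> from the total available at each step.\<close>

lemma elem_sym_ge:
  assumes "finite T" "\<And>t. t \<in> T \<Longrightarrow> g t \<ge> 0" "E \<le> sum g T"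
    and "\<And>U. U \<subseteq> T \<Longrightarrow> card U < j \<Longrightarrow> sum g U \<le> E"
  shows "(sum g T - E) ^ j / fact j \<le> elem_sym T g j"
  using assms(4)
proof (induction j)
  case 0
  show ?case using elem_sym_0[OF assms(1)] by simp
next
  case (Suc j)
  have "(sum g T - E) ^ j / fact j * (sum g T - E) \<le> elem_sym T g j * (sum g T - E)"
    using Suc.IH Suc.prems assms(3) by (intro mult_right_mono) auto
  also have "\<dots> = (\<Sum>U\<in>{U. U \<subseteq> T \<and> card U = j}. prod g U * (sum g T - E))"
    by (simp add: elem_sym_def sum_distrib_right)
  also have "\<dots> \<le> (\<Sum>U\<in>{U. U \<subseteq> T \<and> card U = j}. prod g U * sum g (T - U))"
  proof (intro sum_mono mult_left_mono)
    fix U assume U: "U \<in> {U. U \<subseteq> T \<and> card U = j}"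
    have "sum g (T - U) = sum g T - sum g U" using U assms(1) by (intro sum_diff) auto
    moreover have "sum g U \<le> E" using U by (intro Suc.prems) auto
    ultimately show "sum g T - E \<le> sum g (T - U)" by linarith
    show "0 \<le> prod g U" using U assms(2) by (intro prod_nonneg) auto
  qed
  also have "\<dots> = real (Suc j) * elem_sym T g (Suc j)" by (rule elem_sym_Suc[OF assms(1), symmetric])
  finally have "(sum g T - E) ^ Suc j / fact j \<le> real (Suc j) * elem_sym T g (Suc j)" by (simp add: mult.commute)
  hence "(sum g T - E) ^ Suc j / fact j / real (Suc j) \<le> elem_sym T g (Suc j)"
    by (subst pos_divide_le_eq) (auto simp: mult.commute)
  thus ?case by (simp only: fact_Suc divide_divide_eq_left of_nat_mult mult.commute)
qed

section \<open>Sums of reciprocals of primes\<close>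

text \<open>The extremal set is an initial segment {2, ..., m + 1}; the induction removes the
  maximum, which exceeds the cardinality. It bounds both the primes dividing a frequency and the
  primes already used in a product.\<close>

lemma sum_reciprocals_le_ln:
  assumes "finite U" "\<And>u. u \<in> U \<Longrightarrow> u \<ge> (2::nat)"
  shows "(\<Sum>u\<in>U. 1 / real u) \<le> ln (real (card U) + 1)"
  using assms
proof (induction "card U" arbitrary: U)
  case (Suc m)
  define M where "M = Max U"
  have ne: "U \<noteq> {}" using Suc by auto
  have MU: "M \<in> U" unfolding M_def using Suc ne by (intro Max_in) auto
  have "U \<subseteq> {2..M}" using Suc by (auto simp: M_def)
  hence "card U \<le> card {2..M}" by (intro card_mono) auto
  hence M: "M \<ge> m + 2" using Suc(2) by simp
  have "(\<Sum>u\<in>U. 1 / real u) = 1 / real M + (\<Sum>u\<in>U - {M}. 1 / real u)"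
    using Suc MU by (intro sum.remove) auto
  also have "(\<Sum>u\<in>U - {M}. 1 / real u) \<le> ln (real (card (U - {M})) + 1)"
    using Suc MU by (intro Suc(1)) auto
  also have "real (card (U - {M})) = real m" using Suc MU by simp
  also have "1 / real M \<le> 1 / (real m + 2)" using M by (intro divide_left_mono) auto
  also have "1 / (real m + 2) + ln (real m + 1) \<le> ln (real m + 2)"
  proof -
    have "ln ((real m + 1) / (real m + 2)) \<le> (real m + 1) / (real m + 2) - 1" by (intro ln_le_minus_one) auto
    also have "\<dots> = - (1 / (real m + 2))" by (simp add: field_simps)
    finally show ?thesis by (subst (asm) ln_div) auto
  qed
  also have "real m + 2 = real (card U) + 1" using Suc(2) by simp
  finally show ?case by simp
qed auto

text \<open>Chebyshev's upper bound, as the case of modulus 1 of the progression bound.\<close>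

lemma prime_count_le:
  "\<exists>Y0\<ge>2. \<forall>Y\<ge>Y0. real (card {p. prime p \<and> real p \<le> Y}) \<le> 33 * (Y / ln Y)"
proof -
  obtain Y0 where pb: "progression_bound Y0" using card_primepows_in_progression_le by blast
  note Y0 = progression_boundD[OF pb]
  have "real (card {p. prime p \<and> real p \<le> Y}) \<le> 33 * (Y / ln Y)" if Y: "Y \<ge> Y0" for Y
  proof -
    have "finite {t::nat. real t \<le> Y}"
      by (rule finite_subset[of _ "{..nat \<lfloor>Y\<rfloor>}"]) (auto intro: le_nat_floor)
    hence fin: "finite {t::nat. primepow t \<and> real t \<le> Y \<and> [t = 1] (mod 1)}" by (rule rev_finite_subset) auto
    have "real (card {p. prime p \<and> real p \<le> Y}) \<le> real (card {t::nat. primepow t \<and> real t \<le> Y \<and> [t = 1] (mod 1)})"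
      by (intro of_nat_mono card_mono fin) auto
    also have "\<dots> \<le> 33 * (Y / (real 1 * ln Y)) * (\<Prod>p\<in>prime_factors (1::nat). 1 + 1 / real p)"
      using Y Y0(1) by (intro Y0(2)) (auto intro: ge_one_powr_ge_zero)
    finally show ?thesis by simp
  qed
  thus ?thesis using Y0(1) by blast
qed

lemma finite_nat_le_real: "finite {t::nat. P t \<and> real t \<le> Y}"
  by (rule finite_subset[of _ "{..nat \<lfloor>Y\<rfloor>}"]) (auto intro: le_nat_floor)

text \<open>An upper bound of Mertens type by dyadic blocks: the block from \<open>y\<close> to
  \<open>2 * y\<close> contributes at most 66 / ln(2y), and along the blocks ln y increases in steps
  of ln 2, so the total is at most 66 / ln 2 times a difference of iterated logarithms. As ln 2
  \<ge> 2/3, the constant is at most 99.\<close>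

lemma sum_prime_reciprocals_le:
  "\<exists>Y0\<ge>2. \<forall>z\<ge>Y0. \<forall>x\<ge>z. (\<Sum>p | prime p \<and> z < real p \<and> real p \<le> x. 1 / real p)
     \<le> 100 * (1 + ln (ln x) - ln (ln z))"
proof -
  obtain Y0 where Y0: "Y0 \<ge> 2" "\<And>Y. Y \<ge> Y0 \<Longrightarrow> real (card {p. prime p \<and> real p \<le> Y}) \<le> 33 * (Y / ln Y)"
    using prime_count_le by blast
  define S where "S z x = (\<Sum>p | prime p \<and> z < real p \<and> real p \<le> x. 1 / real p)" for z x
  have fin: "finite {p::nat. prime p \<and> z < real p \<and> real p \<le> x}" for z x
    using finite_nat_le_real[of "\<lambda>p. prime p \<and> z < real p" x] by simp
  have dy: "S y (2 * y) \<le> 66 / ln (2 * y)" if y: "y \<ge> Y0" for y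
  proof -
    have y2: "y \<ge> 2" using y Y0 by simp
    have "S y (2 * y) \<le> (\<Sum>p | prime p \<and> y < real p \<and> real p \<le> 2 * y. 1 / y)"
      unfolding S_def using y2 by (intro sum_mono divide_left_mono) auto
    also have "\<dots> = real (card {p. prime p \<and> y < real p \<and> real p \<le> 2 * y}) / y" by simp
    also have "\<dots> \<le> real (card {p. prime p \<and> real p \<le> 2 * y}) / y"
      using y2 by (intro divide_right_mono of_nat_mono card_mono finite_nat_le_real) auto
    also have "\<dots> \<le> 33 * (2 * y / ln (2 * y)) / y" using y y2 by (intro divide_right_mono Y0(2)) auto
    also have "\<dots> = 66 / ln (2 * y)" using y2 by simp
    finally show ?thesis .
  qed
  have ind: "S z (2 ^ I * z) \<le> 66 / ln 2 * (ln (ln z + real I * ln 2) - ln (ln z))" if z: "z \<ge> Y0" for z I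
  proof (induction I)
    case 0
    have "{p. prime p \<and> z < real p \<and> real p \<le> 2 ^ 0 * z} = {}" by auto
    thus ?case unfolding S_def by (simp only:) simp
  next
    case (Suc I)
    have z2: "z \<ge> 2" using z Y0 by simp
    have zI: "2 ^ I * z \<ge> z" using z2 mult_right_mono[of 1 "2 ^ I" z] by simp
    define u where "u = ln z + real I * ln 2"
    have u: "u > 0" using z2 by (auto simp: u_def intro: add_pos_nonneg)
    have lnz: "ln (2 * (2 ^ I * z)) = u + ln 2" using z2 by (simp add: u_def ln_mult ln_realpow)
    have "{p. prime p \<and> z < real p \<and> real p \<le> 2 ^ Suc I * z} =
       {p. prime p \<and> z < real p \<and> real p \<le> 2 ^ I * z} \<union> {p. prime p \<and> 2 ^ I * z < real p \<and> real p \<le> 2 * (2 ^ I * z)}"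
      using z2 by (auto dest: le_less_trans[OF zI])
    hence "S z (2 ^ Suc I * z) = S z (2 ^ I * z) + S (2 ^ I * z) (2 * (2 ^ I * z))"
      unfolding S_def using fin by (subst sum.union_disjoint[symmetric]) (auto simp: mult_ac)
    also have "\<dots> \<le> 66 / ln 2 * (ln u - ln (ln z)) + 66 / (u + ln 2)"
      using Suc dy[of "2 ^ I * z"] z zI unfolding lnz u_def by (intro add_mono) auto
    also have "66 / (u + ln 2) \<le> 66 / ln 2 * (ln (u + ln 2) - ln u)"
    proof -
      have p: "u + ln 2 > 0" using u by (simp add: add_pos_pos)
      have "ln (u / (u + ln 2)) \<le> u / (u + ln 2) - 1" using u p by (intro ln_le_minus_one) auto
      hence "ln u - ln (u + ln 2) \<le> - (ln 2 / (u + ln 2))" using u p by (simp add: ln_div field_simps)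
      hence "66 / ln 2 * (ln 2 / (u + ln 2)) \<le> 66 / ln 2 * (ln (u + ln 2) - ln u)" by (intro mult_left_mono) auto
      thus ?thesis by simp
    qed
    finally have "S z (2 ^ Suc I * z) \<le> 66 / ln 2 * (ln (u + ln 2) - ln (ln z))" by (simp add: right_diff_distrib)
    thus ?case by (simp add: u_def algebra_simps)
  qed
  have "S z x \<le> 100 * (1 + ln (ln x) - ln (ln z))" if z: "z \<ge> Y0" and x: "x \<ge> z" for z x
  proof -
    have z2: "z \<ge> 2" using z Y0 by simp
    have lz: "ln z > 0" "ln x \<ge> ln z" using z2 x by auto
    define I where "I = nat \<lceil>log 2 (x / z)\<rceil>"
    have xz: "x / z \<ge> 1" using z2 x by simp
    have l0: "log 2 (x / z) \<ge> 0" using xz by simp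
    have I: "log 2 (x / z) \<le> real I" "real I \<le> log 2 (x / z) + 1" using l0 unfolding I_def by linarith+
    have l2: "ln 2 > (0::real)" "ln 2 \<le> (1::real)" "ln 2 \<ge> (2/3::real)" using ln_2_less_1 ln2_ge_two_thirds by auto
    have "x / z \<le> 2 ^ I"
      using I(1) xz by (simp add: log_le_iff powr_realpow)
    hence xI: "x \<le> 2 ^ I * z" using z2 by (simp add: field_simps)
    have "real I * ln 2 \<le> (log 2 (x / z) + 1) * ln 2" using I l2 by (intro mult_right_mono) auto
    also have "\<dots> = ln x - ln z + ln 2" using z2 x l2 by (simp add: log_def ln_div field_simps)
    finally have "ln z + real I * ln 2 \<le> ln x + ln 2" by linarith
    also have "\<dots> \<le> 2 * ln x" using z2 x ln_le_cancel_iff[of 2 x] by simp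
    finally have b: "ln z + real I * ln 2 \<le> 2 * ln x" .
    have "S z x \<le> S z (2 ^ I * z)" unfolding S_def using fin xI by (intro sum_mono2) auto
    also have "\<dots> \<le> 66 / ln 2 * (ln (ln z + real I * ln 2) - ln (ln z))" by (rule ind[OF z])
    also have "\<dots> \<le> 66 / ln 2 * (ln (2 * ln x) - ln (ln z))"
      using b lz l2 by (intro mult_left_mono diff_right_mono ln_mono) (auto intro: add_pos_nonneg)
    also have "ln (2 * ln x) = ln 2 + ln (ln x)" using lz by (subst ln_mult) auto
    also have "66 / ln 2 * (ln 2 + ln (ln x) - ln (ln z)) \<le> 100 * (1 + ln (ln x) - ln (ln z))"
    proof (intro mult_mono)
      show "66 / ln 2 \<le> (100::real)" using l2 by (simp add: divide_simps)
      have "ln (ln z) \<le> ln (ln x)" using lz z2 x by (intro ln_mono) auto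
      thus "0 \<le> ln 2 + ln (ln x) - ln (ln z)" using l2 by linarith
    qed (use l2 in auto)
    finally show ?thesis .
  qed
  thus ?thesis using Y0(1) unfolding S_def by blast
qed

lemma ln_ln_increment_le:
  assumes "m \<ge> (2::nat)"
  shows "ln (ln (real m + 1)) - ln (ln (real m)) \<le> 1 / (real m * ln (real m))"
proof -
  have m: "real m > 0" "ln (real m) > 0" "ln (real m + 1) > 0" using assms by auto
  have "ln (ln (real m + 1)) - ln (ln (real m)) = ln (ln (real m + 1) / ln (real m))" using m by (simp add: ln_div)
  also have "\<dots> \<le> ln (real m + 1) / ln (real m) - 1" using m by (intro ln_le_minus_one) auto
  also have "\<dots> = (ln (real m + 1) - ln (real m)) / ln (real m)" using m by (simp add: diff_divide_distrib)
  also have "\<dots> \<le> (1 / real m) / ln (real m)"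
  proof (intro divide_right_mono)
    have "ln (real m + 1) - ln (real m) = ln ((real m + 1) / real m)" using m by (simp add: ln_div)
    also have "(real m + 1) / real m = 1 + 1 / real m" using m by (simp add: add_divide_distrib)
    also have "ln (1 + 1 / real m) \<le> 1 / real m" using m by (intro ln_add_one_self_le_self) auto
    finally show "ln (real m + 1) - ln (real m) \<le> 1 / real m" .
  qed (use m in auto)
  finally show ?thesis by simp
qed

text \<open>Partial summation: 1/p is \<open>ln p\<close> times the decreasing weight 1 / (p ln p),
  and the partial sums of \<open>ln p\<close> are at least \<alpha> times their length.\<close>

lemma sum_reciprocals_ge:
  fixes S :: "nat set" and \<alpha> x0 x :: real
  assumes S: "\<And>p. p \<in> S \<Longrightarrow> p \<ge> 2" and \<alpha>: "\<alpha> > 0" and x0: "x0 \<ge> 2"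
    and hyp: "\<And>y. y \<ge> x0 \<Longrightarrow> (\<Sum>p | p \<in> S \<and> real p \<le> y. ln (real p)) \<ge> \<alpha> * y"
    and x: "x \<ge> x0 + 1"
  shows "(\<Sum>p | p \<in> S \<and> real p \<le> x. 1 / real p) \<ge> \<alpha> * (ln (ln x) - ln (ln (x0 + 2)))"
proof -
  define c where "c m = (if m \<in> S then ln (real m) else 0)" for m
  define g where "g m = 1 / (real m * ln (real m))" for m :: nat
  define C where "C N = (\<Sum>m\<le>N. c m)" for N
  define n0 where "n0 = nat \<lceil>x0\<rceil>"
  have n0: "n0 \<ge> 2" "x0 \<le> real n0" "real n0 \<le> x0 + 1" unfolding n0_def using x0 by linarith+
  have c0: "c m \<ge> 0" for m using S[of m] by (auto simp: c_def)
  have gmono: "g b \<le> g a" if "2 \<le> a" "a \<le> b" for a b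
    unfolding g_def using that by (intro divide_left_mono mult_mono) auto
  have CN: "C N \<ge> \<alpha> * real N" if "N \<ge> n0" for N
  proof -
    have "C N = (\<Sum>p | p \<in> S \<and> real p \<le> real N. ln (real p))"
      unfolding C_def c_def by (simp add: sum.If_cases Int_def conj_commute)
    thus ?thesis using hyp[of "real N"] n0 that by simp
  qed
  have step: "real m * (g m - g (Suc m)) \<ge> ln (ln (real m + 2)) - ln (ln (real m + 1))" if "m \<ge> 2" for m
  proof -
    have l: "ln (real m) > 0" "ln (real m + 1) \<ge> ln (real m)" using that by auto
    have "real m * g m = 1 / ln (real m)" using that by (simp add: g_def)
    moreover have "real m * g (Suc m) = 1 / ln (real m + 1) - g (Suc m)"
    proof -
      have "real m * g (Suc m) = (real m + 1) * g (Suc m) - g (Suc m)" by (simp add: algebra_simps)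
      also have "(real m + 1) * g (Suc m) = 1 / ln (real m + 1)" by (simp add: g_def add.commute)
      finally show ?thesis .
    qed
    moreover have "1 / ln (real m + 1) \<le> 1 / ln (real m)" using l by (intro divide_left_mono mult_pos_pos) linarith+
    moreover have "ln (ln (real m + 2)) - ln (ln (real m + 1)) \<le> g (Suc m)"
      using ln_ln_increment_le[of "Suc m"] that by (simp add: g_def add_ac)
    ultimately show ?thesis by (simp add: right_diff_distrib)
  qed
  \<comment> \<open>The boundary term \<open>C N * g N\<close> is carried through the induction, so
    that each step is an exact Abel summation; afterwards it is dropped as non-negative.\<close>
  have main: "(\<Sum>m\<le>N. c m * g m) \<ge> C N * g N + \<alpha> * (ln (ln (real N + 1)) - ln (ln (real n0 + 1)))" if "N \<ge> n0" for N
    using that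
  proof (induction N rule: dec_induct)
    case base
    have "C n0 * g n0 = (\<Sum>m\<le>n0. c m * g n0)" by (simp add: C_def sum_distrib_right)
    also have "\<dots> \<le> (\<Sum>m\<le>n0. c m * g m)"
    proof (rule sum_mono)
      fix m assume m: "m \<in> {..n0}"
      show "c m * g n0 \<le> c m * g m"
      proof (cases "m \<in> S")
        case True
        hence "g n0 \<le> g m" using S m by (intro gmono) auto
        thus ?thesis using c0 by (intro mult_left_mono) auto
      qed (auto simp: c_def)
    qed
    finally show ?case by simp
  next
    case (step N)
    have N2: "N \<ge> 2" using step n0 by simp
    have "\<alpha> * (real N * (g N - g (Suc N))) \<le> C N * (g N - g (Suc N))"
      using CN[of N] step gmono[of N "Suc N"] N2 unfolding mult.assoc[symmetric] by (intro mult_right_mono) auto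
    moreover have "\<alpha> * (ln (ln (real N + 2)) - ln (ln (real N + 1))) \<le> \<alpha> * (real N * (g N - g (Suc N)))"
      using \<alpha> \<open>\<And>m. m \<ge> 2 \<Longrightarrow> real m * (g m - g (Suc m)) \<ge> ln (ln (real m + 2)) - ln (ln (real m + 1))\<close>[OF N2]
      by (intro mult_left_mono) auto
    moreover have "(\<Sum>m\<le>Suc N. c m * g m) = (\<Sum>m\<le>N. c m * g m) + c (Suc N) * g (Suc N)" by simp
    moreover have "C (Suc N) * g (Suc N) = C N * g (Suc N) + c (Suc N) * g (Suc N)"
      by (simp add: C_def algebra_simps)
    ultimately show ?case using step.IH by (simp add: algebra_simps)
  qed
  define N where "N = nat \<lfloor>x\<rfloor>"
  have N: "n0 \<le> N" "x \<le> real N + 1" "real N \<le> x" unfolding N_def using x n0 by linarith+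
  have "C N * g N \<ge> 0" unfolding C_def g_def using c0 n0 N by (intro mult_nonneg_nonneg sum_nonneg) auto
  hence "\<alpha> * (ln (ln (real N + 1)) - ln (ln (real n0 + 1))) \<le> (\<Sum>m\<le>N. c m * g m)"
    using main[OF N(1)] by linarith
  moreover have "(\<Sum>m\<le>N. c m * g m) = (\<Sum>p | p \<in> S \<and> real p \<le> x. 1 / real p)"
  proof -
    have "c m * g m = (if m \<in> S then 1 / real m else 0)" for m
      using S[of m] by (auto simp: c_def g_def)
    moreover have "m \<le> N \<longleftrightarrow> real m \<le> x" for m unfolding N_def using x x0 by (simp add: le_nat_iff le_floor_iff)
    ultimately show ?thesis by (simp add: sum.If_cases Int_def conj_commute)
  qed
  moreover have "ln (ln x) \<le> ln (ln (real N + 1))" using N x x0 by (intro ln_mono) auto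
  moreover have "ln (ln (real n0 + 1)) \<le> ln (ln (x0 + 2))" using n0 x0 by (intro ln_mono) auto
  ultimately show ?thesis using \<alpha> mult_left_mono[of "ln (ln x) - ln (ln (x0 + 2))" "ln (ln (real N + 1)) - ln (ln (real n0 + 1))" \<alpha>]
    by linarith
qed

lemma sum_non_prime_primepows_le:
  "(\<Sum>t | primepow t \<and> \<not> prime t \<and> real t \<le> x. 1 / real t) \<le> 4"
proof -
  let ?A = "{t::nat. primepow t \<and> \<not> prime t \<and> real t \<le> x}"
  define K where "K = nat \<lfloor>x\<rfloor>"
  let ?B = "{2..K} \<times> {2..K}"
  have sub: "?A \<subseteq> (\<lambda>(p,v). p ^ v) ` ?B"
  proof
    fix t assume t: "t \<in> ?A"
    then obtain p v where pv: "prime p" "v > 0" "t = p ^ v" by (auto simp: primepow_def)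
    have v: "v \<ge> 2" using pv t by (metis (mono_tags, lifting) One_nat_def Suc_leI le_neq_implies_less mem_Collect_eq numeral_2_eq_2 power_one_right)
    have p: "p \<ge> 2" using pv prime_ge_2_nat by auto
    have tK: "t \<le> K" using t by (auto simp: K_def intro: le_nat_floor)
    have "p ^ 1 \<le> p ^ v" using v p by (intro power_increasing) auto
    moreover have "v \<le> p ^ v"
    proof -
      have "v < 2 ^ v" by (rule less_exp)
      also have "2 ^ v \<le> p ^ v" using p by (intro power_mono) auto
      finally show ?thesis by simp
    qed
    ultimately have "p \<le> K \<and> v \<le> K" using tK pv(3) by auto
    hence "(p, v) \<in> ?B" using p v by auto
    thus "t \<in> (\<lambda>(p,v). p ^ v) ` ?B" by (rule image_eqI[rotated]) (simp add: pv(3))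
  qed
  have "(\<Sum>t\<in>?A. 1 / real t) \<le> (\<Sum>t\<in>(\<lambda>(p,v). p ^ v) ` ?B. 1 / real t)"
    by (intro sum_mono2 sub) auto
  also have "\<dots> \<le> (\<Sum>(p,v)\<in>?B. 1 / real (p ^ v))"
    using sum_image_le[of ?B "\<lambda>t. 1 / real t" "\<lambda>(p,v). p ^ v"] by (simp add: case_prod_unfold comp_def)
  also have "\<dots> = (\<Sum>p\<in>{2..K}. \<Sum>v\<in>{2..K}. 1 / real p ^ v)" by (simp add: sum.cartesian_product)
  also have "\<dots> \<le> (\<Sum>p\<in>{2..K}. 2 * (1 / (real p)\<^sup>2))"
  proof (rule sum_mono)
    fix p assume p: "p \<in> {2..K}"
    \<comment> \<open>The subtracted last term closes the induction: since p \<ge> 2, twice the next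
      term is at most the current one.\<close>
    have "(\<Sum>v\<in>{2..M}. 1 / real p ^ v) \<le> 2 * (1 / (real p)\<^sup>2) - 1 / real p ^ M" if "M \<ge> 2" for M
      using that
    proof (induction M rule: dec_induct)
      case (step M)
      have "1 / real p ^ Suc M + 1 / real p ^ Suc M \<le> 1 / real p ^ M"
        using p by (simp add: divide_simps)
      thus ?case using step by simp
    qed auto
    from this[of K] show "(\<Sum>v\<in>{2..K}. 1 / real p ^ v) \<le> 2 * (1 / (real p)\<^sup>2)"
      using p by (auto intro: order.trans)
  qed
  also have "\<dots> = 2 * (\<Sum>p\<in>{2..K}. 1 / (real p)\<^sup>2)" by (simp add: sum_distrib_left)
  also have "\<dots> \<le> 2 * (\<Sum>p\<in>{1..K}. 1 / (real p)\<^sup>2)" by (intro mult_left_mono sum_mono2) auto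
  also have "\<dots> \<le> 4" using sum_inverse_squares_le[of K] by simp
  finally show ?thesis .
qed

section \<open>Averaging Weyl sums over moduli\<close>

definition prime_power_parts :: "nat \<Rightarrow> nat set" where
  "prime_power_parts q = (\<lambda>p. p ^ multiplicity p q) ` prime_factors q"

lemma finite_prime_power_parts [simp]: "finite (prime_power_parts q)"
  by (simp add: prime_power_parts_def)

lemma prime_power_parts_inj: "inj_on (\<lambda>p. p ^ multiplicity p q) (prime_factors q)"
proof (rule inj_onI)
  fix p p' assume p: "p \<in> prime_factors q" "p' \<in> prime_factors q" "p ^ multiplicity p q = p' ^ multiplicity p' q"
  have "aprimedivisor (p ^ multiplicity p q) = p" "aprimedivisor (p' ^ multiplicity p' q) = p'"
    using p(1,2) by (auto simp: prime_factors_multiplicity aprimedivisor_prime_power)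
  thus "p = p'" using p(3) by metis
qed

lemma card_prime_power_parts: "card (prime_power_parts q) = card (prime_factors q)"
  unfolding prime_power_parts_def by (rule card_image[OF prime_power_parts_inj])

lemma prod_prime_power_parts:
  assumes "q \<ge> 1"
  shows "\<Prod>(prime_power_parts q) = q"
proof -
  have "\<Prod>(prime_power_parts q) = (\<Prod>p\<in>prime_factors q. p ^ multiplicity p q)"
    unfolding prime_power_parts_def by (subst prod.reindex[OF prime_power_parts_inj]) simp
  also have "\<dots> = q" using assms by (simp add: prod_prime_factors)
  finally show ?thesis .
qed

lemma primepow_prime_power_parts: "t \<in> prime_power_parts q \<Longrightarrow> primepow t"
  by (auto simp: prime_power_parts_def prime_factors_multiplicity intro!: primepow_prime_power)

lemma prime_power_parts_coprime:
  assumes "t \<in> prime_power_parts q" "t' \<in> prime_power_parts q" "t \<noteq> t'"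
  shows "coprime t t'"
  using assms by (auto simp: prime_power_parts_def in_prime_factors_iff intro!: coprime_power_left_iff[THEN iffD2] coprime_power_right_iff[THEN iffD2] primes_coprime)

lemma pairwise_coprime_prod:
  assumes "finite U" "finite V" "\<And>u v. u \<in> U \<Longrightarrow> v \<in> V \<Longrightarrow> coprime u (v::nat)"
  shows "coprime (\<Prod>U) (\<Prod>V)"
  using assms by (intro prod_coprime_left prod_coprime_right) auto

lemma collision_ratio_prod_le:
  assumes "finite V" "\<And>t. t \<in> V \<Longrightarrow> t \<ge> 1" "\<And>t t'. t \<in> V \<Longrightarrow> t' \<in> V \<Longrightarrow> t \<noteq> t' \<Longrightarrow> coprime t t'"
  shows "collision_ratio n A h (\<Prod>V) \<le> (\<Prod>t\<in>V. collision_ratio n A h t)"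
  using assms
proof (induction V rule: finite_induct)
  case empty
  show ?case using collision_ratio_le_1[of n A h 1] by simp
next
  case (insert t V)
  have c: "coprime t (\<Prod>V)" using insert by (intro prod_coprime_right) auto
  have "\<Prod>V \<noteq> 0" using insert.prems(1) insert.hyps(1) by fastforce
  hence "\<Prod>V \<ge> 1" by linarith
  moreover have "t \<ge> 1" using insert by auto
  ultimately have "collision_ratio n A h (t * \<Prod>V) = collision_ratio n A h t * collision_ratio n A h (\<Prod>V)"
    using c by (intro collision_ratio_mult)
  also have "\<dots> \<le> collision_ratio n A h t * (\<Prod>t\<in>V. collision_ratio n A h t)"
    using insert by (intro mult_left_mono insert.IH collision_ratio_nonneg) auto
  finally show ?case using insert by simp
qed

lemma prod_prime_factors_prod:
  fixes f :: "nat \<Rightarrow> real"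
  assumes "finite V" "\<And>t. t \<in> V \<Longrightarrow> primepow t" "\<And>t t'. t \<in> V \<Longrightarrow> t' \<in> V \<Longrightarrow> t \<noteq> t' \<Longrightarrow> coprime t t'"
  shows "(\<Prod>p\<in>prime_factors (\<Prod>V). f p) = (\<Prod>t\<in>V. f (aprimedivisor t))"
proof -
  have pp: "prime_factors t = {aprimedivisor t}" if tV: "t \<in> V" for t
  proof -
    obtain p v where pv: "prime p" "v > 0" "t = p ^ v" using assms(2)[OF tV] by (auto simp: primepow_def)
    thus ?thesis by (simp add: prime_factors_power prime_prime_factors aprimedivisor_prime_power)
  qed
  have nz: "0 \<notin> V" using assms(2) by fastforce
  have "prime_factors (\<Prod>V) = (\<Union>t\<in>V. prime_factors t)"
    using assms(1) nz by (subst prime_factors_prod) auto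
  also have "\<dots> = aprimedivisor ` V" using pp by auto
  finally have eq: "prime_factors (\<Prod>V) = aprimedivisor ` V" .
  have inj: "inj_on aprimedivisor V"
  proof (rule inj_onI)
    fix t t' assume t: "t \<in> V" "t' \<in> V" "aprimedivisor t = aprimedivisor t'"
    define p where "p = aprimedivisor t"
    have "p \<in> prime_factors t" "p \<in> prime_factors t'" using pp t by (auto simp: p_def)
    hence "prime p" "p dvd t" "p dvd t'" by auto
    hence "\<not> coprime t t'" by (metis coprime_common_divisor not_prime_unit)
    thus "t = t'" using assms(3) t by blast
  qed
  show ?thesis unfolding eq by (simp add: prod.reindex[OF inj])
qed

text \<open>The twist attached to \<open>t\<close> is the inverse of \<open>c * t\<close> modulo
  \<open>r\<close>, so it determines the class of \<open>t\<close> modulo \<open>r\<close>. Each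
  twist is therefore taken at most \<open>K\<close> times, and by positivity the sum may be extended
  to all twists modulo \<open>r\<close>.\<close>

lemma sum_norm_weyl_progressions_le:
  assumes r: "r \<ge> 1" and c: "c \<ge> 1" and cop: "coprime c r" and S: "finite S"
    and St: "\<And>t. t \<in> S \<Longrightarrow> t \<ge> 1 \<and> coprime t r"
    and K: "\<And>b. coprime b r \<Longrightarrow> real (card {t\<in>S. [t = b] (mod r)}) \<le> K"
  shows "(\<Sum>t\<in>S. norm (weyl n A (r * (c * t)) h 1)) \<le> K * (real r * sqrt (collision_ratio n A h r))"
proof -
  have ex: "\<exists>u<r. [c * t * u = 1] (mod r)" if "t \<in> S" for t
  proof -
    have "coprime (c * t) r" using St[OF that] cop by simp
    then obtain u where u: "[c * t * u = 1] (mod r)" using cong_solve_coprime_nat[of "c * t" r] by auto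
    have "[c * t * (u mod r) = c * t * u] (mod r)" by (intro cong_mult cong_refl) (auto simp: cong_def)
    hence "[c * t * (u mod r) = 1] (mod r)" using u cong_trans by blast
    thus ?thesis using r by (intro exI[of _ "u mod r"]) auto
  qed
  then obtain u where u: "\<And>t. t \<in> S \<Longrightarrow> u t < r \<and> [c * t * u t = 1] (mod r)" by metis
  \<comment> \<open>The class of 1 is coprime to \<open>r\<close>, and its cardinality is
    non-negative.\<close>
  have K0: "K \<ge> 0" using K[of 1] by (auto intro: order.trans[rotated])
  have fib: "real (card {t\<in>S. u t = w}) \<le> K" for w
  proof (cases "{t\<in>S. u t = w} = {}")
    case True
    hence "card {t\<in>S. u t = w} = 0" by (simp only: card.empty)
    thus ?thesis using K0 by simp
  next
    case False
    then obtain t0 where t0: "t0 \<in> S" "u t0 = w" by auto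
    have "{t\<in>S. u t = w} \<subseteq> {t\<in>S. [t = t0] (mod r)}"
    proof
      fix t assume t: "t \<in> {t\<in>S. u t = w}"
      have "[c * t * w = 1] (mod r)" "[c * t0 * w = 1] (mod r)" using u[of t] u[of t0] t t0 by auto
      hence eq: "[t * (c * w) = t0 * (c * w)] (mod r)" by (metis (no_types, lifting) cong_sym cong_trans mult.assoc mult.commute)
      have "coprime (c * t0 * w) r"
        by (rule cong_imp_coprime[OF cong_sym[OF \<open>[c * t0 * w = 1] (mod r)\<close>]]) simp
      hence "coprime (c * w) r" by simp
      thus "t \<in> {t\<in>S. [t = t0] (mod r)}" using eq t by (simp add: cong_mult_rcancel_nat)
    qed
    hence "card {t\<in>S. u t = w} \<le> card {t\<in>S. [t = t0] (mod r)}" using S by (intro card_mono) auto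
    also have "real (card {t\<in>S. [t = t0] (mod r)}) \<le> K" using St[OF t0(1)] by (intro K) auto
    finally show ?thesis by simp
  qed
  have "(\<Sum>t\<in>S. norm (weyl n A (r * (c * t)) h 1)) \<le> (\<Sum>t\<in>S. norm (weyl n A r h (u t)))"
  proof (rule sum_mono)
    fix t assume t: "t \<in> S"
    have "1 \<le> c * t" using c St[OF t] by simp
    thus "norm (weyl n A (r * (c * t)) h 1) \<le> norm (weyl n A r h (u t))"
      using u[OF t] St[OF t] cop r by (intro norm_weyl_mult_le) (auto simp: coprime_commute)
  qed
  also have "\<dots> = (\<Sum>w<r. \<Sum>t\<in>{t\<in>S. u t = w}. norm (weyl n A r h (u t)))"
    using u S by (intro sum.group[symmetric]) auto
  also have "\<dots> = (\<Sum>w<r. real (card {t\<in>S. u t = w}) * norm (weyl n A r h w))"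
    by (intro sum.cong refl) simp
  also have "\<dots> \<le> (\<Sum>w<r. K * norm (weyl n A r h w))" using fib by (intro sum_mono mult_right_mono) auto
  also have "\<dots> = K * (\<Sum>w<r. norm (weyl n A r h w))" by (simp add: sum_distrib_left)
  also have "\<dots> \<le> K * (real r * sqrt (collision_ratio n A h r))"
    using sum_norm_weyl_le[OF r] K0 by (intro mult_left_mono)
  finally show ?thesis .
qed

section \<open>Summing Weyl sums over the moduli with k components\<close>

text \<open>The contribution of one prime power component to the final product. At most
  \<open>z\<close>, it belongs to \<open>r\<close>: the factor 1 + 1/p is its share of the
  Brun-Titchmarsh constant and the root its share of the collision bound. Above \<open>z\<close>, it
  belongs to \<open>c\<close> and nothing is saved.\<close>

definition comp_weight :: "nat \<Rightarrow> (nat \<Rightarrow> (nat \<Rightarrow> nat) set) \<Rightarrow> (nat \<Rightarrow> int) \<Rightarrow> real \<Rightarrow> nat \<Rightarrow> real" where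
  "comp_weight n A h z t = 1 / real t *
     (if real t \<le> z then (1 + 1 / real (aprimedivisor t)) * sqrt (collision_ratio n A h t) else 1)"

lemma comp_weight_nonneg: "comp_weight n A h z t \<ge> 0"
  using collision_ratio_nonneg[of n A h t] by (simp add: comp_weight_def)

definition QQ_primepows :: "nat \<Rightarrow> (nat \<Rightarrow> (nat \<Rightarrow> nat) set) \<Rightarrow> real \<Rightarrow> nat set" where
  "QQ_primepows n A x = {t. primepow t \<and> rho n A t \<ge> 1 \<and> real t \<le> x}"

text \<open>\<open>V\<close> and \<open>W\<close> yield the factors \<open>r\<close> and
  \<open>c\<close>. The density 1/r of a residue class cancels the factor \<open>r\<close> from the
  sum over all twists, leaving the range \<open>Y / ln Y\<close> times the root of the collision
  ratio, which is then distributed over the components.\<close>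

lemma sum_weyl_fixed_cofactor:
  assumes pb: "progression_bound Y0"
    and U: "finite U" "\<And>t. t \<in> U \<Longrightarrow> primepow t" "\<And>t t'. t \<in> U \<Longrightarrow> t' \<in> U \<Longrightarrow> t \<noteq> t' \<Longrightarrow> coprime t t'"
    and z: "z \<ge> 1" "z ^ card U \<le> y powr (1/4)" and y: "y \<ge> Y0" and x: "x / real (\<Prod>U) \<ge> y"
  shows "(\<Sum>t | primepow t \<and> real t \<le> x / real (\<Prod>U) \<and> coprime t (\<Prod>U). norm (weyl n A (\<Prod>U * t) h 1))
     \<le> 33 * (x / ln y) * (\<Prod>t\<in>U. comp_weight n A h z t)"
proof -
  note Y0 = progression_boundD[OF pb]
  define Y where "Y = x / real (\<Prod>U)"
  define V where "V = {t\<in>U. real t \<le> z}"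
  define W where "W = {t\<in>U. \<not> real t \<le> z}"
  have UV: "U = V \<union> W" "V \<inter> W = {}" "finite V" "finite W" using U by (auto simp: V_def W_def)
  have pos: "t > 0" if "t \<in> U" for t using U(2)[OF that] by (rule primepow_gt_0_nat)
  define r where "r = \<Prod>V"
  define c where "c = \<Prod>W"
  have rc: "\<Prod>U = r * c" unfolding r_def c_def using UV by (simp add: prod.union_disjoint)
  have "r \<noteq> 0" "c \<noteq> 0" unfolding r_def c_def using UV pos by (auto simp: prod_zero_iff)
  hence r1: "r \<ge> 1" and c1: "c \<ge> 1" by auto
  have cop: "coprime c r" unfolding r_def c_def
    using U(3) by (intro pairwise_coprime_prod UV) (auto simp: V_def W_def)
  have Yy: "Y \<ge> y" "Y \<ge> Y0" "Y \<ge> 2" using x y Y0(1) by (auto simp: Y_def)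
  have "real r = (\<Prod>t\<in>V. real t)" by (simp add: r_def)
  also have "\<dots> \<le> (\<Prod>t\<in>V. z)" by (intro prod_mono) (auto simp: V_def)
  also have "\<dots> \<le> z ^ card U"
  proof -
    have "card V \<le> card U" by (intro card_mono U(1)) (auto simp: V_def)
    thus ?thesis using z(1) by (simp add: power_increasing)
  qed
  also have "\<dots> \<le> y powr (1/4)" by (rule z(2))
  also have "\<dots> \<le> Y powr (1/4)" using Yy(1) y Y0(1) by (intro powr_mono2) auto
  finally have rY: "real r \<le> Y powr (1/4)" .
  define PP where "PP = (\<Prod>p\<in>prime_factors r. 1 + 1 / real p)"
  have PP0: "PP \<ge> 0" unfolding PP_def by (intro prod_nonneg) auto
  define S where "S = {t. primepow t \<and> real t \<le> Y \<and> coprime t (\<Prod>U)}"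
  have finS: "finite S" unfolding S_def
    by (rule finite_subset[OF _ finite_nat_le_real[of "\<lambda>_. True" Y]]) auto
  have "(\<Sum>t\<in>S. norm (weyl n A (r * (c * t)) h 1)) \<le> (33 * (Y / (real r * ln Y)) * PP) * (real r * sqrt (collision_ratio n A h r))"
  proof (rule sum_norm_weyl_progressions_le[OF r1 c1 cop finS])
    fix t assume "t \<in> S"
    thus "1 \<le> t \<and> coprime t r" using primepow_gt_0_nat[of t] by (auto simp: S_def rc)
  next
    fix b assume b: "coprime b r"
    have "real (card {t\<in>S. [t = b] (mod r)}) \<le> real (card {t. primepow t \<and> real t \<le> Y \<and> [t = b] (mod r)})"
      by (intro of_nat_mono card_mono finite_subset[OF _ finite_nat_le_real[of "\<lambda>_. True" Y]]) (auto simp: S_def)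
    also have "\<dots> \<le> 33 * (Y / (real r * ln Y)) * PP" unfolding PP_def using Yy r1 rY b by (intro Y0(2))
    finally show "real (card {t\<in>S. [t = b] (mod r)}) \<le> 33 * (Y / (real r * ln Y)) * PP" .
  qed
  also have "\<dots> = 33 * (Y / ln Y) * (PP * sqrt (collision_ratio n A h r))" using r1 by simp
  also have "\<dots> \<le> 33 * (Y / ln y) * ((\<Prod>t\<in>V. 1 + 1 / real (aprimedivisor t)) * (\<Prod>t\<in>V. sqrt (collision_ratio n A h t)))"
  proof (intro mult_mono)
    show "Y / ln Y \<le> Y / ln y" using Yy y Y0(1) by (intro divide_left_mono) auto
    show "PP \<le> (\<Prod>t\<in>V. 1 + 1 / real (aprimedivisor t))"
      unfolding PP_def r_def
      by (rule eq_refl, rule prod_prime_factors_prod[OF UV(3)]) (use U(2,3) in \<open>simp_all add: V_def\<close>)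
    have "sqrt (collision_ratio n A h r) \<le> sqrt (\<Prod>t\<in>V. collision_ratio n A h t)"
      unfolding r_def
      by (intro real_sqrt_le_mono collision_ratio_prod_le UV(3)) (use U(3) pos in \<open>simp_all add: V_def Suc_le_eq\<close>)
    also have "\<dots> = (\<Prod>t\<in>V. sqrt (collision_ratio n A h t))"
      using UV(3) by (induction V rule: finite_induct) (simp_all add: real_sqrt_mult)
    finally show "sqrt (collision_ratio n A h r) \<le> (\<Prod>t\<in>V. sqrt (collision_ratio n A h t))" .
  qed (use Yy y Y0(1) in \<open>auto intro!: prod_nonneg mult_nonneg_nonneg PP0 simp: collision_ratio_nonneg\<close>)
  also have "\<dots> = 33 * (x / ln y) * (\<Prod>t\<in>U. comp_weight n A h z t)"
  proof -
    have "(\<Prod>t\<in>U. comp_weight n A h z t) = (\<Prod>t\<in>U. 1 / real t) * ((\<Prod>t\<in>V. (1 + 1 / real (aprimedivisor t)) * sqrt (collision_ratio n A h t)) * (\<Prod>t\<in>W. 1))"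
      unfolding comp_weight_def prod.distrib
      by (subst (2) UV(1), subst prod.union_disjoint) (use UV in \<open>auto simp: V_def W_def prod.distrib\<close>)
    moreover have "(\<Prod>t\<in>U. 1 / real t) = 1 / real (\<Prod>U)" by (simp add: prod_dividef)
    ultimately show ?thesis by (simp add: Y_def prod.distrib)
  qed
  finally show ?thesis unfolding S_def Y_def rc by (simp add: mult.assoc)
qed

lemma prime_power_parts_split:
  assumes "q \<ge> 1" "t \<in> prime_power_parts q"
  shows "q = \<Prod>(prime_power_parts q - {t}) * t" "coprime t (\<Prod>(prime_power_parts q - {t}))" "\<Prod>(prime_power_parts q - {t}) \<ge> 1"
proof -
  have "\<Prod>(prime_power_parts q) = t * \<Prod>(prime_power_parts q - {t})" using assms by (intro prod.remove) auto
  thus eq: "q = \<Prod>(prime_power_parts q - {t}) * t" using prod_prime_power_parts[OF assms(1)] by (simp add: mult.commute)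
  show "coprime t (\<Prod>(prime_power_parts q - {t}))" using prime_power_parts_coprime[OF assms(2)] by (intro prod_coprime_right) auto
  have "\<Prod>(prime_power_parts q - {t}) \<noteq> 0" using eq assms(1) by (metis mult_0 not_one_le_zero)
  thus "\<Prod>(prime_power_parts q - {t}) \<ge> 1" by linarith
qed

lemma rho_prime_power_parts:
  assumes "q \<ge> 1" "t \<in> prime_power_parts q" "rho n A q \<ge> 1"
  shows "rho n A t \<ge> 1"
proof -
  have t1: "t \<ge> 1" using primepow_prime_power_parts[OF assms(2)] primepow_gt_0_nat by (simp add: Suc_le_eq)
  have "rho n A q = rho n A (t * \<Prod>(prime_power_parts q - {t}))" using prime_power_parts_split(1)[OF assms(1,2)] by (metis mult.commute)
  also have "\<dots> = rho n A t * rho n A (\<Prod>(prime_power_parts q - {t}))"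
    by (intro rho_mult prime_power_parts_split assms t1)
  finally show ?thesis using assms(3) by (metis Suc_le_eq One_nat_def gr0I mult_0 not_one_le_zero)
qed

text \<open>Separating the largest component \<open>m q\<close> is injective, since the product
  recovers \<open>q\<close>. It remains to bound a sum over cofactors \<open>U\<close>, each treated
  with \<open>t\<close> free.\<close>

lemma sum_weyl_QQ_k_le:
  assumes pb: "progression_bound Y0"
    and k: "k \<ge> 1" and z: "z \<ge> 1" "z ^ (k - 1) \<le> y powr (1/4)" and y: "y \<ge> Y0" "y ^ k \<le> sqrt x" and x: "x \<ge> 1"
  shows "(\<Sum>q | q \<in> QQ_k_upto n A k x \<and> sqrt x < real q. norm (weyl n A q h 1))
     \<le> 33 * (x / ln y) * elem_sym (QQ_primepows n A x) (comp_weight n A h z) (k - 1)"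
proof -
  note Y0 = progression_boundD[OF pb]
  define X where "X = {q. q \<in> QQ_k_upto n A k x \<and> sqrt x < real q}"
  define T where "T = QQ_primepows n A x"
  have finT: "finite T" unfolding T_def QQ_primepows_def
    by (rule finite_subset[OF _ finite_nat_le_real[of "\<lambda>_. True" x]]) auto
  define m where "m q = Max (prime_power_parts q)" for q
  define \<phi> where "\<phi> q = (prime_power_parts q - {m q}, m q)" for q
  define f where "f = (\<lambda>(U,t). norm (weyl n A (\<Prod>U * t) h 1))"
  define G where "G = {U. U \<subseteq> T \<and> card U = k - 1 \<and> (\<forall>t\<in>U. \<forall>t'\<in>U. t \<noteq> t' \<longrightarrow> coprime t t') \<and> y \<le> x / real (\<Prod>U)}"
  define P where "P U = {t. primepow t \<and> real t \<le> x / real (\<Prod>U) \<and> coprime t (\<Prod>U)}" for U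
  have y1: "y \<ge> 2" using y Y0 by simp
  have q: "q \<ge> 1" "rho n A q \<ge> 1" "real q \<le> x" "card (prime_power_parts q) = k" "sqrt x < real q" if "q \<in> X" for q
    using that by (auto simp: X_def QQ_k_upto_def QQ_upto_def QQ_def card_prime_power_parts)
  have m: "m q \<in> prime_power_parts q" if "q \<in> X" for q
  proof -
    have "prime_power_parts q \<noteq> {}" using q(4)[OF that] k by auto
    thus ?thesis unfolding m_def by (intro Max_in) auto
  qed
  \<comment> \<open>If all \<open>k\<close> components were below \<open>y\<close>, then
    \<open>q\<close> would be at most \<open>y ^ k \<le> sqrt x\<close>.\<close>
  have my: "y \<le> real (m q)" if "q \<in> X" for q
  proof (rule ccontr)
    assume "\<not> y \<le> real (m q)"
    hence lt: "real t \<le> y" if "t \<in> prime_power_parts q" for t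
      using Max_ge[OF finite_prime_power_parts that] unfolding m_def by (meson le_trans linear of_nat_le_iff order.trans)
    have "real (\<Prod>(prime_power_parts q)) = (\<Prod>t\<in>prime_power_parts q. real t)" by (rule of_nat_prod)
    hence "real q = (\<Prod>t\<in>prime_power_parts q. real t)" by (simp only: prod_prime_power_parts[OF q(1)[OF that]])
    also have "\<dots> \<le> (\<Prod>t\<in>prime_power_parts q. y)" using lt by (intro prod_mono) auto
    also have "\<dots> = y ^ k" using q(4)[OF that] by simp
    also have "\<dots> \<le> sqrt x" by (rule y(2))
    finally show False using q(5)[OF that] by simp
  qed
  have split: "q = \<Prod>(prime_power_parts q - {m q}) * m q" "coprime (m q) (\<Prod>(prime_power_parts q - {m q}))" "\<Prod>(prime_power_parts q - {m q}) \<ge> 1" if "q \<in> X" for q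
    using prime_power_parts_split[OF q(1)[OF that] m[OF that]] by auto
  have inj: "inj_on \<phi> X"
  proof (rule inj_onI)
    fix q q' assume "q \<in> X" "q' \<in> X" "\<phi> q = \<phi> q'"
    thus "q = q'" using split(1)[of q] split(1)[of q'] unfolding \<phi>_def by (metis prod.inject)
  qed
  have range: "\<phi> ` X \<subseteq> (SIGMA U:G. P U)"
  proof
    fix a assume "a \<in> \<phi> ` X"
    then obtain q where qX: "q \<in> X" and a: "a = \<phi> q" by auto
    define U where "U = prime_power_parts q - {m q}"
    have fac: "real q = real (\<Prod>U) * real (m q)" unfolding U_def using split(1)[OF qX] by (metis of_nat_mult)
    have U1: "real (\<Prod>U) > 0" using split(3)[OF qX] unfolding U_def by linarith
    have mx: "real (m q) \<le> x / real (\<Prod>U)" using fac U1 q(3)[OF qX] by (simp add: field_simps)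
    have "prime_power_parts q \<subseteq> T"
    proof
      fix t assume t: "t \<in> prime_power_parts q"
      have "t dvd q" using prime_power_parts_split(1)[OF q(1)[OF qX] t] by (metis dvd_triv_right)
      hence "t \<le> q" using q(1)[OF qX] by (intro dvd_imp_le) auto
      hence "real t \<le> x" using q(3)[OF qX] by linarith
      thus "t \<in> T" unfolding T_def QQ_primepows_def
        using primepow_prime_power_parts[OF t] rho_prime_power_parts[OF q(1)[OF qX] t q(2)[OF qX]] by simp
    qed
    moreover have "card U = k - 1" unfolding U_def using m[OF qX] q(4)[OF qX] by simp
    moreover have "\<forall>t\<in>U. \<forall>t'\<in>U. t \<noteq> t' \<longrightarrow> coprime t t'" unfolding U_def using prime_power_parts_coprime by blast
    moreover have "y \<le> x / real (\<Prod>U)" using mx my[OF qX] by linarith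
    ultimately have "U \<in> G" unfolding G_def U_def by blast
    moreover have "m q \<in> P U" unfolding P_def using mx split(2)[OF qX] primepow_prime_power_parts[OF m[OF qX]] by (simp add: U_def)
    ultimately show "a \<in> (SIGMA U:G. P U)" unfolding a \<phi>_def U_def by blast
  qed
  have finG: "finite G" unfolding G_def using finT by simp
  have finP: "finite (P U)" for U unfolding P_def
    by (rule finite_subset[OF _ finite_nat_le_real[of "\<lambda>_. True" "x / real (\<Prod>U)"]]) auto
  have "(\<Sum>q\<in>X. norm (weyl n A q h 1)) = (\<Sum>q\<in>X. f (\<phi> q))"
    using split(1) unfolding f_def \<phi>_def by (intro sum.cong) (auto simp: mult.commute)
  also have "\<dots> = sum f (\<phi> ` X)" by (simp add: sum.reindex[OF inj])
  \<comment> \<open>By positivity, \<open>t\<close> is released: it need no longer be the largest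
    component nor come from a modulus in Q, only be a prime power in range coprime to the cofactor.
    This is what makes the sieve applicable.\<close>
  also have "\<dots> \<le> sum f (SIGMA U:G. P U)"
    using finG finP by (intro sum_mono2 range) (auto simp: f_def)
  also have "\<dots> = (\<Sum>U\<in>G. \<Sum>t\<in>P U. norm (weyl n A (\<Prod>U * t) h 1))"
    unfolding f_def using finG finP by (intro sum.Sigma[symmetric]) auto
  also have "\<dots> \<le> (\<Sum>U\<in>G. 33 * (x / ln y) * (\<Prod>t\<in>U. comp_weight n A h z t))"
  proof (rule sum_mono)
    fix U assume U: "U \<in> G"
    have Uf: "finite U" "\<And>t. t \<in> U \<Longrightarrow> primepow t" "\<And>t t'. t \<in> U \<Longrightarrow> t' \<in> U \<Longrightarrow> t \<noteq> t' \<Longrightarrow> coprime t t'"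
      "card U = k - 1" "y \<le> x / real (\<Prod>U)"
      using U finT finite_subset unfolding G_def T_def QQ_primepows_def by blast+
    have zc: "z ^ card U \<le> y powr (1/4)" using z(2) by (simp only: Uf(4))
    show "(\<Sum>t\<in>P U. norm (weyl n A (\<Prod>U * t) h 1)) \<le> 33 * (x / ln y) * (\<Prod>t\<in>U. comp_weight n A h z t)"
      unfolding P_def
      by (rule sum_weyl_fixed_cofactor[where ?Y0.0 = Y0]) (assumption | rule pb Uf(1,2,3,5) z(1) zc y(1))+
  qed
  also have "\<dots> = 33 * (x / ln y) * (\<Sum>U\<in>G. \<Prod>t\<in>U. comp_weight n A h z t)" by (simp add: sum_distrib_left)
  \<comment> \<open>Dropping the coprimality and size conditions on \<open>U\<close> completes the
    sum to an elementary symmetric one.\<close>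
  also have "\<dots> \<le> 33 * (x / ln y) * elem_sym T (comp_weight n A h z) (k - 1)"
    unfolding elem_sym_def using finT x y1
    by (intro mult_left_mono sum_mono2) (auto simp: G_def intro!: prod_nonneg comp_weight_nonneg)
  finally show ?thesis unfolding X_def T_def .
qed

text \<open>The distinct prime divisors are each at least 2 and their product divides
  \<open>m\<close>.\<close>

lemma card_prime_divisors_le_log:
  assumes "m \<noteq> (0::int)" "\<bar>m\<bar> \<le> int M"
  shows "finite {p::nat. prime p \<and> int p dvd m}" "real (card {p::nat. prime p \<and> int p dvd m}) \<le> log 2 (real M)"
proof -
  let ?D = "{p::nat. prime p \<and> int p dvd m}"
  define N where "N = nat \<bar>m\<bar>"
  have N: "N \<ge> 1" "N \<le> M" using assms by (auto simp: N_def)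
  have dN: "p dvd N" if "p \<in> ?D" for p using that by (simp add: N_def nat_abs_dvd_iff dvd_nat_abs_iff)
  show fin: "finite ?D"
  proof (rule finite_subset)
    show "?D \<subseteq> {..N}"
    proof
      fix p assume "p \<in> ?D"
      thus "p \<in> {..N}" using dvd_imp_le[OF dN[of p]] N(1) by simp
    qed
  qed simp
  have "\<Prod>?D dvd N" using fin dN by (intro prod_primes_dvd) auto
  hence "\<Prod>?D \<le> N" using N by (intro dvd_imp_le) auto
  moreover have "(\<Prod>p\<in>?D. 2) \<le> \<Prod>?D" by (intro prod_mono) (auto intro: prime_ge_2_nat)
  ultimately have "2 ^ card ?D \<le> M" using N by simp
  hence "2 ^ card ?D \<le> real M" by (metis of_nat_le_iff of_nat_numeral of_nat_power)
  thus "real (card ?D) \<le> log 2 (real M)" using N by (subst le_log_iff) (auto simp: powr_realpow)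
qed

text \<open>Only primes up to \<open>z\<close> not dividing \<open>h i\<close> carry a saving. The
  other terms are errors: primes dividing \<open>h i\<close>, primes above \<open>z\<close>, the
  factors 1 + 1/p (at most 2 in total), and proper prime powers (at most 2 * 4 = 8 in total), the
  last two forming the constant 10.\<close>

lemma sum_comp_weight_le:
  fixes n A and x \<delta> z :: real and h :: "nat \<Rightarrow> int"
  defines "Q \<equiv> {p. prime p \<and> p \<in> QQ_upto n A x}"
  assumes Y1: "\<And>z x. Y1 \<le> z \<Longrightarrow> z \<le> x \<Longrightarrow> (\<Sum>p | prime p \<and> z < real p \<and> real p \<le> x. 1 / real p)
     \<le> 100 * (1 + ln (ln x) - ln (ln z))"
    and z: "Y1 \<le> z" "z \<le> x" and i: "i < n" "h i \<noteq> 0" "\<bar>h i\<bar> \<le> int M" and \<delta>: "\<delta> \<ge> 0"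
    and hyp: "(\<Sum>p\<in>Q. 1 / real p * (real (lam n A p) / real (rho n A p))) \<le> \<delta> * (\<Sum>p\<in>Q. 1 / real p)"
  shows "sum (comp_weight n A h z) (QQ_primepows n A x) \<le> sqrt \<delta> * (\<Sum>p\<in>Q. 1 / real p)
     + ln (log 2 (real M) + 1) + 100 * (1 + ln (ln x) - ln (ln z)) + 10"
proof -
  define T where "T = QQ_primepows n A x"
  have finle: "finite {t::nat. P t \<and> real t \<le> x}" for P by (rule finite_nat_le_real)
  have finQ: "finite Q" unfolding Q_def QQ_upto_def by (rule finite_subset[OF _ finle[of "\<lambda>_. True"]]) auto
  have finT: "finite T" unfolding T_def QQ_primepows_def by (rule finite_subset[OF _ finle[of "\<lambda>_. True"]]) auto
  define N where "N = {t. primepow t \<and> \<not> prime t \<and> real t \<le> x}"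
  have finN: "finite N" unfolding N_def by (rule finite_subset[OF _ finle[of "\<lambda>_. True"]]) auto
  have TQ: "T \<subseteq> Q \<union> N" unfolding T_def Q_def N_def QQ_primepows_def QQ_upto_def QQ_def
    by (auto simp: prime_ge_1_nat Suc_le_eq prime_gt_0_nat)
  let ?w = "comp_weight n A h z"
  define L where "L = (\<Sum>p\<in>Q. 1 / real p)"
  define s where "s p = 1 / real p * sqrt (real (lam n A p) / real (rho n A p))" for p
  define D where "D = {p::nat. prime p \<and> int p dvd h i}"
  define R where "R = {p. prime p \<and> z < real p \<and> real p \<le> x}"
  have finR: "finite R" unfolding R_def by (rule finite_subset[OF _ finle[of "\<lambda>_. True"]]) auto
  have wQ: "?w p \<le> s p + 1 / (real p)\<^sup>2 + (if p \<in> D then 1 / real p else 0) + (if p \<in> R then 1 / real p else 0)"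
    if p: "p \<in> Q" for p
  proof -
    have pr: "prime p" "real p \<le> x" using p by (auto simp: Q_def QQ_upto_def)
    have p0: "real p > 0" using prime_gt_0_nat[OF pr(1)] by simp
    have s0: "s p \<ge> 0" by (simp add: s_def)
    define \<kappa> where "\<kappa> = sqrt (collision_ratio n A h p)"
    have \<kappa>: "0 \<le> \<kappa>" "\<kappa> \<le> 1" unfolding \<kappa>_def using collision_ratio_nonneg[of n A h p] collision_ratio_le_1[of n A h p] by auto
    show ?thesis
    proof (cases "real p \<le> z")
      case True
      have w: "?w p = 1 / real p * \<kappa> + 1 / (real p)\<^sup>2 * \<kappa>"
        using True p0 pr(1) by (simp add: comp_weight_def \<kappa>_def power2_eq_square field_simps)
      have b: "1 / (real p)\<^sup>2 * \<kappa> \<le> 1 / (real p)\<^sup>2" using \<kappa> by (intro mult_left_le) auto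
      have a: "1 / real p * \<kappa> \<le> s p + (if p \<in> D then 1 / real p else 0)"
      proof (cases "p \<in> D")
        case True
        have "1 / real p * \<kappa> \<le> 1 / real p" using \<kappa> by (intro mult_left_le) auto
        thus ?thesis using True s0 by simp
      next
        case False
        hence "\<not> int p dvd h i" using pr by (simp add: D_def)
        hence "\<kappa> \<le> sqrt (real (lam n A p) / real (rho n A p))"
          unfolding \<kappa>_def using collision_ratio_prime_le[OF pr(1) i(1), of h A] by (intro real_sqrt_le_mono) auto
        thus ?thesis using False p0 by (simp add: s_def divide_right_mono)
      qed
      have r: "(if p \<in> R then 1 / real p else 0) \<ge> 0" by simp
      show ?thesis unfolding w using a b r by linarith
    next
      case False
      hence "p \<in> R" using pr by (simp add: R_def)
      thus ?thesis using False s0 by (auto simp: comp_weight_def)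
    qed
  qed
  have wN: "?w t \<le> 2 * (1 / real t)" if t: "t \<in> N" for t
  proof -
    have pp: "primepow t" using t by (simp add: N_def)
    define \<kappa> where "\<kappa> = sqrt (collision_ratio n A h t)"
    have \<kappa>: "0 \<le> \<kappa>" "\<kappa> \<le> 1" unfolding \<kappa>_def using collision_ratio_nonneg[of n A h t] collision_ratio_le_1[of n A h t] by auto
    have "aprimedivisor t \<ge> 1" using primepow_gt_Suc_0[OF pp] aprimedivisor_pos_nat[of t] by (simp add: Suc_le_eq)
    hence "1 + 1 / real (aprimedivisor t) \<le> 2" by simp
    hence "(1 + 1 / real (aprimedivisor t)) * \<kappa> \<le> 2 * 1" using \<kappa> by (intro mult_mono) auto
    hence "(if real t \<le> z then (1 + 1 / real (aprimedivisor t)) * \<kappa> else 1) \<le> 2" by simp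
    hence "1 / real t * (if real t \<le> z then (1 + 1 / real (aprimedivisor t)) * \<kappa> else 1) \<le> 1 / real t * 2" by (intro mult_left_mono) auto
    thus ?thesis unfolding comp_weight_def \<kappa>_def by (simp only: mult.commute)
  qed
  have "sum ?w T \<le> sum ?w (Q \<union> N)" using finQ finN TQ by (intro sum_mono2) (auto simp: comp_weight_nonneg)
  also have "\<dots> = sum ?w Q + sum ?w N"
    using finQ finN by (intro sum.union_disjoint) (auto simp: Q_def N_def)
  also have "sum ?w Q \<le> (\<Sum>p\<in>Q. s p + 1 / (real p)\<^sup>2 + (if p \<in> D then 1 / real p else 0) + (if p \<in> R then 1 / real p else 0))"
    by (intro sum_mono wQ)
  also have "\<dots> = (\<Sum>p\<in>Q. s p) + (\<Sum>p\<in>Q. 1 / (real p)\<^sup>2) + (\<Sum>p\<in>Q \<inter> D. 1 / real p) + (\<Sum>p\<in>Q \<inter> R. 1 / real p)"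
    using finQ by (simp add: sum.distrib sum.inter_restrict)
  \<comment> \<open>Cauchy-Schwarz with weights 1/p: the root in the collision bound is why the
    hypothesis with \<delta> yields only its square root.\<close>
  also have "(\<Sum>p\<in>Q. s p) \<le> sqrt \<delta> * L"
  proof -
    have "(\<Sum>p\<in>Q. s p) = (\<Sum>p\<in>Q. sqrt (1 / real p) * sqrt (1 / real p * (real (lam n A p) / real (rho n A p))))"
    proof (intro sum.cong refl)
      fix p
      have "sqrt (1 / real p) * sqrt (1 / real p * (real (lam n A p) / real (rho n A p)))
        = (sqrt (1 / real p) * sqrt (1 / real p)) * sqrt (real (lam n A p) / real (rho n A p))"
        by (simp only: real_sqrt_mult mult.assoc)
      thus "s p = sqrt (1 / real p) * sqrt (1 / real p * (real (lam n A p) / real (rho n A p)))" by (simp add: s_def)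
    qed
    hence "(\<Sum>p\<in>Q. s p)\<^sup>2 \<le> (\<Sum>p\<in>Q. (sqrt (1 / real p))\<^sup>2) * (\<Sum>p\<in>Q. (sqrt (1 / real p * (real (lam n A p) / real (rho n A p))))\<^sup>2)"
      using Cauchy_Schwarz_ineq_sum[of "\<lambda>p. sqrt (1 / real p)" "\<lambda>p. sqrt (1 / real p * (real (lam n A p) / real (rho n A p)))" Q] by simp
    also have "\<dots> = L * (\<Sum>p\<in>Q. 1 / real p * (real (lam n A p) / real (rho n A p)))"
      by (simp add: L_def)
    also have "\<dots> \<le> L * (\<delta> * L)" using hyp by (intro mult_left_mono) (auto simp: L_def intro: sum_nonneg)
    also have "\<dots> = (sqrt \<delta> * L)\<^sup>2" using \<delta> by (simp add: power_mult_distrib power2_eq_square)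
    finally show ?thesis
      by (rule power2_le_imp_le) (use \<delta> in \<open>auto simp: L_def intro!: mult_nonneg_nonneg sum_nonneg\<close>)
  qed
  also have "(\<Sum>p\<in>Q. 1 / (real p)\<^sup>2) \<le> 2"
  proof -
    have "(\<Sum>p\<in>Q. 1 / (real p)\<^sup>2) \<le> (\<Sum>p\<in>{1..nat \<lfloor>x\<rfloor>}. 1 / (real p)\<^sup>2)"
      by (intro sum_mono2) (auto simp: Q_def QQ_upto_def Suc_le_eq prime_gt_0_nat intro: le_nat_floor)
    thus ?thesis using sum_inverse_squares_le[of "nat \<lfloor>x\<rfloor>"] by linarith
  qed
  also have "(\<Sum>p\<in>Q \<inter> D. 1 / real p) \<le> ln (log 2 (real M) + 1)"
  proof -
    have fD: "finite D" unfolding D_def by (rule card_prime_divisors_le_log(1)[OF i(2,3)])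
    have "(\<Sum>p\<in>Q \<inter> D. 1 / real p) \<le> (\<Sum>p\<in>D. 1 / real p)" by (intro sum_mono2 fD) auto
    also have "\<dots> \<le> ln (real (card D) + 1)" by (rule sum_reciprocals_le_ln[OF fD]) (auto simp: D_def prime_ge_2_nat)
    also have "\<dots> \<le> ln (log 2 (real M) + 1)"
      using card_prime_divisors_le_log(2)[OF i(2,3)] unfolding D_def[symmetric] by (intro ln_mono) auto
    finally show ?thesis .
  qed
  also have "(\<Sum>p\<in>Q \<inter> R. 1 / real p) \<le> 100 * (1 + ln (ln x) - ln (ln z))"
  proof -
    have "(\<Sum>p\<in>Q \<inter> R. 1 / real p) \<le> (\<Sum>p\<in>R. 1 / real p)" by (intro sum_mono2 finR) auto
    thus ?thesis using Y1[OF z] unfolding R_def by linarith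
  qed
  also have "sum ?w N \<le> 8"
  proof -
    have "sum ?w N \<le> (\<Sum>t\<in>N. 2 * (1 / real t))" by (intro sum_mono wN)
    also have "\<dots> = 2 * (\<Sum>t\<in>N. 1 / real t)" by (simp only: sum_distrib_left)
    finally show ?thesis using sum_non_prime_primepows_le[of x] by (simp add: N_def)
  qed
  finally show ?thesis by (simp add: T_def L_def)
qed

section \<open>Lower bound for the number of moduli\<close>

lemma rho_1: "rho n A 1 \<ge> 1"
proof -
  have "(\<lambda>i\<in>{..<n}. 0) \<in> crt_set n A 1" by (auto simp: crt_set_def residue_vecs_def)
  hence "card (crt_set n A 1) > 0" using finite_crt_set card_gt_0_iff by blast
  thus ?thesis by (simp add: rho_def)
qed

lemma rho_prod_primes:
  assumes "finite V" "\<And>p. p \<in> V \<Longrightarrow> prime p \<and> rho n A p \<ge> 1"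
  shows "rho n A (\<Prod>V) \<ge> 1"
  using assms
proof (induction V rule: finite_induct)
  case empty
  show ?case using rho_1[of n A] by simp
next
  case (insert p V)
  have c: "coprime p (\<Prod>V)" using insert by (intro prod_coprime_right primes_coprime) auto
  have "\<Prod>V > 0" using insert by (intro prod_pos) (auto simp: prime_gt_0_nat)
  hence "\<Prod>V \<ge> 1" by linarith
  moreover have "p \<ge> 1" using insert prime_ge_1_nat by auto
  ultimately have eq: "rho n A (p * \<Prod>V) = rho n A p * rho n A (\<Prod>V)" using c by (intro rho_mult)
  have "1 \<le> rho n A p" "1 \<le> rho n A (\<Prod>V)" using insert by auto
  hence "1 * 1 \<le> rho n A p * rho n A (\<Prod>V)" by (rule mult_le_mono)
  thus ?case using insert eq by simp
qed

text \<open>Only squarefree moduli are counted, namely a product of \<open>k - 1\<close> primes up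
  to \<open>z\<close> times one prime above \<open>z\<close>; the position of \<open>z\<close> makes
  the representation unique. The density hypothesis supplies the large prime, and
  \<open>elem_sym_ge\<close> the small ones, where \<open>ln (real k)\<close> allows for the primes
  already chosen.\<close>

lemma card_QQ_k_ge:
  fixes \<alpha> x0 x z :: real
  assumes hyp: "\<And>y. y \<ge> x0 \<Longrightarrow> (\<Sum>p | prime p \<and> real p \<le> y \<and> rho n A p \<ge> 1. ln (real p)) \<ge> \<alpha> * y"
    and \<alpha>: "\<alpha> > 0" and x0: "x0 \<ge> 2" "sqrt x \<ge> x0" and k: "k \<ge> 1"
    and z: "z \<ge> 1" "z ^ (k - 1) \<le> sqrt x" "z \<le> \<alpha> * sqrt x / (2 * ln x)"
  defines "T \<equiv> {p. prime p \<and> rho n A p \<ge> 1 \<and> real p \<le> z}"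
  assumes E: "ln (real k) \<le> (\<Sum>p\<in>T. 1 / real p)"
  shows "real (card (QQ_k_upto n A k x)) \<ge> \<alpha> / 2 * (x / ln x) * (((\<Sum>p\<in>T. 1 / real p) - ln (real k)) ^ (k - 1) / fact (k - 1))"
proof -
  have x1: "x > 1"
  proof -
    have "sqrt x > 1" using x0 by linarith
    thus ?thesis by simp
  qed
  have lnx: "ln x > 0" using x1 by simp
  have fin: "finite {p::nat. P p \<and> real p \<le> Y}" for P Y by (rule finite_nat_le_real)
  have finT: "finite T" unfolding T_def by (rule finite_subset[OF _ fin[of "\<lambda>_. True" z]]) auto
  define \<U> where "\<U> = {U. U \<subseteq> T \<and> card U = k - 1}"
  have finU: "finite \<U>" unfolding \<U>_def using finT by simp
  define P where "P U = {p. prime p \<and> rho n A p \<ge> 1 \<and> z < real p \<and> real p \<le> x / real (\<Prod>U)}" for U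
  have finP: "finite (P U)" for U unfolding P_def
    by (rule finite_subset[OF _ fin[of "\<lambda>_. True" "x / real (\<Prod>U)"]]) auto
  have U: "finite U" "\<And>p. p \<in> U \<Longrightarrow> prime p \<and> rho n A p \<ge> 1 \<and> real p \<le> z" "card U = k - 1" if "U \<in> \<U>" for U
    using that finT finite_subset by (auto simp: \<U>_def T_def)
  have Upos: "real (\<Prod>U) > 0" if "U \<in> \<U>" for U
  proof -
    have "\<Prod>U > 0" using U(2)[OF that] by (intro prod_pos) (auto simp: prime_gt_0_nat)
    thus ?thesis by linarith
  qed
  have cardP: "real (card (P U)) \<ge> \<alpha> / 2 * (x / ln x) * (\<Prod>p\<in>U. 1 / real p)" if UU: "U \<in> \<U>" for U
  proof -
    define Y where "Y = x / real (\<Prod>U)"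
    have "real (\<Prod>U) = (\<Prod>p\<in>U. real p)" by simp
    also have "\<dots> \<le> (\<Prod>p\<in>U. z)" using U(2)[OF UU] by (intro prod_mono) auto
    also have "\<dots> = z ^ (k - 1)" using U(3)[OF UU] by simp
    also have "\<dots> \<le> sqrt x" by (rule z(2))
    finally have le: "real (\<Prod>U) \<le> sqrt x" .
    have "sqrt x = x / sqrt x" using x1 by (simp add: real_div_sqrt)
    also have "\<dots> \<le> Y" unfolding Y_def using le Upos[OF UU] x1 by (intro divide_left_mono mult_pos_pos) auto
    finally have Y: "sqrt x \<le> Y" .
    have "\<Prod>U \<ge> 1" using Upos[OF UU] by linarith
    hence "1 \<le> real (\<Prod>U)" by linarith
    hence "x / real (\<Prod>U) \<le> x / 1" using x1 by (intro divide_left_mono) auto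
    hence Yx: "Y \<le> x" unfolding Y_def by simp
    have Y2: "Y \<ge> 2" using Y x0 by linarith
    define PY where "PY = {p. prime p \<and> real p \<le> Y \<and> rho n A p \<ge> 1}"
    have finPY: "finite PY" unfolding PY_def by (rule finite_subset[OF _ fin[of "\<lambda>_. True" Y]]) auto
    have "\<alpha> * Y \<le> (\<Sum>p\<in>PY. ln (real p))" unfolding PY_def using Y x0 by (intro hyp) linarith
    also have "\<dots> \<le> (\<Sum>p\<in>PY. ln x)"
      using Yx by (intro sum_mono ln_mono) (auto simp: PY_def prime_gt_0_nat)
    also have "\<dots> = real (card PY) * ln x" by simp
    finally have c1: "\<alpha> * Y / ln x \<le> real (card PY)" using lnx by (simp add: divide_le_eq)
    have "PY \<subseteq> P U \<union> {1..nat \<lfloor>z\<rfloor>}"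
    proof
      fix p assume p: "p \<in> PY"
      have "p \<ge> 1" using p by (simp add: PY_def Suc_le_eq prime_gt_0_nat)
      show "p \<in> P U \<union> {1..nat \<lfloor>z\<rfloor>}"
      proof (cases "real p \<le> z")
        case True
        thus ?thesis using \<open>p \<ge> 1\<close> le_nat_floor[of p z] by simp
      next
        case False
        hence "p \<in> P U" using p unfolding PY_def P_def Y_def by simp
        thus ?thesis by blast
      qed
    qed
    hence "card PY \<le> card (P U \<union> {1..nat \<lfloor>z\<rfloor>})" using finP by (intro card_mono) auto
    also have "\<dots> \<le> card (P U) + nat \<lfloor>z\<rfloor>" using card_Un_le[of "P U" "{1..nat \<lfloor>z\<rfloor>}"] by simp
    finally have "real (card PY) \<le> real (card (P U)) + z" using z(1) by linarith
    \<comment> \<open>The primes up to \<open>z\<close> take away at most half of the primes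
      guaranteed by the density hypothesis; hence the factor \<alpha> / 2.\<close>
    moreover have "z \<le> \<alpha> * Y / ln x / 2"
    proof -
      have "\<alpha> * sqrt x / (2 * ln x) \<le> \<alpha> * Y / (2 * ln x)"
        using Y \<alpha> lnx by (intro divide_right_mono mult_left_mono) auto
      thus ?thesis using z(3) by (simp add: mult.commute)
    qed
    ultimately have "\<alpha> * Y / ln x / 2 \<le> real (card (P U))" using c1 by linarith
    moreover have "(\<Prod>p\<in>U. 1 / real p) = 1 / real (\<Prod>U)" by (simp add: prod_dividef)
    ultimately show ?thesis by (simp add: Y_def mult_ac)
  qed
  define \<phi> where "\<phi> = (\<lambda>(U,p). \<Prod>U * p :: nat)"
  have ins: "\<phi> (U,p) = \<Prod>(insert p U)" "p \<notin> U" if "U \<in> \<U>" "p \<in> P U" for U p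
  proof -
    show "p \<notin> U" using U(2)[OF that(1), of p] that(2) by (auto simp: P_def)
    thus "\<phi> (U,p) = \<Prod>(insert p U)" using U(1)[OF that(1)] by (simp add: \<phi>_def mult.commute)
  qed
  have pf: "prime_factors (\<phi> (U,p)) = insert p U" if "U \<in> \<U>" "p \<in> P U" for U p
    unfolding ins(1)[OF that]
    by (rule prod_primes_prime_factors) (use U(1,2)[OF that(1)] that(2) in \<open>auto simp: P_def\<close>)
  have inj: "inj_on \<phi> (SIGMA U:\<U>. P U)"
  proof (rule inj_onI)
    fix a b assume a: "a \<in> (SIGMA U:\<U>. P U)" and b: "b \<in> (SIGMA U:\<U>. P U)" and eq: "\<phi> a = \<phi> b"
    obtain U p where Up: "a = (U,p)" "U \<in> \<U>" "p \<in> P U" using a by auto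
    obtain V q where Vq: "b = (V,q)" "V \<in> \<U>" "q \<in> P V" using b by auto
    have e: "insert p U = insert q V" using pf[OF Up(2,3)] pf[OF Vq(2,3)] eq unfolding Up(1) Vq(1) by metis
    have "p \<notin> V" using U(2)[OF Vq(2), of p] Up(3) by (auto simp: P_def)
    hence pq: "p = q" using e by blast
    hence "U = V" using e ins(2)[OF Up(2,3)] ins(2)[OF Vq(2,3)] by (metis insert_ident)
    thus "a = b" using pq Up Vq by simp
  qed
  have img: "\<phi> ` (SIGMA U:\<U>. P U) \<subseteq> QQ_k_upto n A k x"
  proof
    fix q assume "q \<in> \<phi> ` (SIGMA U:\<U>. P U)"
    then obtain U p where Up: "q = \<phi> (U,p)" "U \<in> \<U>" "p \<in> P U" by auto
    have V: "finite (insert p U)" "\<And>r. r \<in> insert p U \<Longrightarrow> prime r \<and> rho n A r \<ge> 1"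
      using U(1,2)[OF Up(2)] Up(3) by (auto simp: P_def)
    have "rho n A q \<ge> 1" unfolding Up(1) ins(1)[OF Up(2,3)] by (rule rho_prod_primes[OF V])
    moreover have "q \<ge> 1"
    proof -
      have "\<Prod>(insert p U) > 0" using V(2) by (intro prod_pos) (auto simp: prime_gt_0_nat)
      thus ?thesis unfolding Up(1) ins(1)[OF Up(2,3)] by linarith
    qed
    moreover have "real q \<le> x"
    proof -
      have "real p \<le> x / real (\<Prod>U)" using Up(3) by (simp only: P_def mem_Collect_eq)
      hence "real p * real (\<Prod>U) \<le> x" using Upos[OF Up(2)] by (simp only: pos_le_divide_eq)
      moreover have "real q = real p * real (\<Prod>U)" unfolding Up(1) \<phi>_def by (simp only: prod.case of_nat_mult mult.commute)
      ultimately show ?thesis by simp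
    qed
    moreover have "card (prime_factors q) = k"
      unfolding Up(1) pf[OF Up(2,3)] using ins(2)[OF Up(2,3)] U(1,3)[OF Up(2)] k by simp
    ultimately show "q \<in> QQ_k_upto n A k x" by (simp add: QQ_k_upto_def QQ_upto_def QQ_def)
  qed
  have finQ: "finite (QQ_k_upto n A k x)"
    by (rule finite_subset[OF _ fin[of "\<lambda>_. True" x]]) (auto simp: QQ_k_upto_def QQ_upto_def)
  define L where "L = (\<Sum>p\<in>T. 1 / real p)"
  have "(L - ln (real k)) ^ (k - 1) / fact (k - 1) \<le> elem_sym T (\<lambda>p. 1 / real p) (k - 1)"
    unfolding L_def
  proof (rule elem_sym_ge[OF finT _ E])
    fix U assume U: "U \<subseteq> T" "card U < k - 1"
    have fU: "finite U" using U finT finite_subset by auto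
    have "(\<Sum>p\<in>U. 1 / real p) \<le> ln (real (card U) + 1)"
      using U by (intro sum_reciprocals_le_ln fU) (auto simp: T_def prime_ge_2_nat)
    also have "\<dots> \<le> ln (real k)" using U by (intro ln_mono) auto
    finally show "(\<Sum>p\<in>U. 1 / real p) \<le> ln (real k)" .
  qed auto
  hence "\<alpha> / 2 * (x / ln x) * ((L - ln (real k)) ^ (k - 1) / fact (k - 1)) \<le> \<alpha> / 2 * (x / ln x) * elem_sym T (\<lambda>p. 1 / real p) (k - 1)"
    using \<alpha> x1 lnx by (intro mult_left_mono) auto
  also have "\<dots> = (\<Sum>U\<in>\<U>. \<alpha> / 2 * (x / ln x) * (\<Prod>p\<in>U. 1 / real p))"
    by (simp only: elem_sym_def \<U>_def sum_distrib_left)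
  also have "\<dots> \<le> (\<Sum>U\<in>\<U>. real (card (P U)))" by (intro sum_mono cardP)
  also have "\<dots> = real (card (SIGMA U:\<U>. P U))" using finU finP by (simp add: card_SigmaI)
  also have "\<dots> = real (card (\<phi> ` (SIGMA U:\<U>. P U)))" by (simp add: card_image[OF inj])
  also have "\<dots> \<le> real (card (QQ_k_upto n A k x))" by (intro of_nat_mono card_mono finQ img)
  finally show ?thesis by (simp add: L_def)
qed

section \<open>The main estimate\<close>

text \<open>The three summands belong to the moduli up to \<open>sqrt x\<close>, the truncation
  error, and the Weyl sums. The 33 comes from \<alpha> \<le> 33, which supplies the factor
  1/\<alpha> missing in the truncation error; 264 is 2 * 132; and 20 comes from 8 + 4 ln H \<le> 20
  (1 + u) with u = (k - 1) ln(1/\<delta>).\<close>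

definition disc_const :: "nat \<Rightarrow> real" where
  "disc_const n = 1 + 33 * (real n * 2 ^ n + 4 * real n * (20 ^ n * (10 * real (n + 1)) ^ (n + 1)))
      + 264 * (20 ^ n * (10 * real (n + 1)) ^ (n + 1))"

lemma power_le_exp_tenth:
  assumes "u \<ge> (0::real)"
  shows "(1 + u) ^ (n + 1) \<le> (10 * real (n + 1)) ^ (n + 1) * exp (u / 10)"
proof -
  have "(1 + u) ^ (n + 1) \<le> (10 * real (n + 1) * (1 + u / (10 * real (n + 1)))) ^ (n + 1)"
  proof (rule power_mono)
    have "10 * real (n + 1) * (1 + u / (10 * real (n + 1))) = 10 * real (n + 1) + u" by (simp add: field_simps)
    thus "1 + u \<le> 10 * real (n + 1) * (1 + u / (10 * real (n + 1)))" by simp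
  qed (use assms in auto)
  also have "\<dots> = (10 * real (n + 1)) ^ (n + 1) * (1 + (u / 10) / real (n + 1)) ^ (n + 1)"
    by (simp only: power_mult_distrib divide_divide_eq_left)
  also have "\<dots> \<le> (10 * real (n + 1)) ^ (n + 1) * exp (u / 10)"
  proof (intro mult_left_mono)
    have "(1 + (u / 10) / real (n + 1)) ^ (n + 1) \<le> exp ((u / 10) / real (n + 1)) ^ (n + 1)"
      using assms by (intro power_mono exp_ge_add_one_self) auto
    also have "\<dots> = exp (real (n + 1) * ((u / 10) / real (n + 1)))" by (rule exp_of_nat_mult[symmetric])
    also have "real (n + 1) * ((u / 10) / real (n + 1)) = u / 10"
      by (rule nonzero_mult_div_cancel_left[of "real (n + 1)" "u / 10", unfolded times_divide_eq_right[symmetric]]) simp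
    finally show "(1 + (u / 10) / real (n + 1)) ^ (n + 1) \<le> exp (u / 10)" .
  qed auto
  finally show ?thesis .
qed

text \<open>With u = (k - 1) ln(1/\<delta>), both \<open>k\<close> and ln H are at most linear in u,
  and the target is e = exp(-u/10). Each non-trivial term carries e^2 times a polynomial in u of
  degree at most n + 1; one factor e pays for the polynomial, the other remains.\<close>

lemma final_numeric_bound:
  fixes \<delta> \<alpha> :: real and k n :: nat
  assumes \<delta>: "0 < \<delta>" "\<delta> \<le> 1 / exp 1" and \<alpha>: "0 < \<alpha>" "\<alpha> \<le> 33" and k: "k \<ge> 2"
  defines "H \<equiv> nat \<lceil>(1 / \<delta>) ^ k\<rceil>"
  shows "1 / \<alpha> * \<delta> ^ k + (real n * 2 ^ n + 4 * real n * (8 + 4 * ln (real H)) ^ n) / real H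
     + 132 * real k / \<alpha> * \<delta> powr ((real k - 1) / 5) * (4 + 2 * ln (real (H\<^sup>2))) ^ n
    \<le> disc_const n * (1 / \<alpha>) * \<delta> powr ((real k - 1) / 10)"
    and "H \<ge> 1" "1 / real H \<le> \<delta> ^ k" "ln (real H) \<le> real k * ln (1 / \<delta>) + 1"
proof -
  define D where "D = ln (1 / \<delta>)"
  define u where "u = (real k - 1) * D"
  have ed: "exp 1 \<le> 1 / \<delta>" using \<delta> by (simp add: field_simps)
  have D1: "D \<ge> 1" unfolding D_def using ed \<delta> by (subst ln_ge_iff) auto
  have k1: "real k - 1 \<ge> 1" using k by simp
  have u1: "u \<ge> 1" unfolding u_def using mult_mono[of 1 "real k - 1" 1 D] k1 D1 by simp
  have k2u: "real k \<le> 2 * u"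
  proof -
    have "real k \<le> 2 * (real k - 1) * 1" using k1 by simp
    also have "\<dots> \<le> 2 * (real k - 1) * D" using D1 k1 by (intro mult_left_mono) auto
    finally show ?thesis unfolding u_def by (simp only: mult.assoc)
  qed
  have kD: "real k * D \<le> 2 * u" unfolding u_def using k1 D1 mult_right_mono[of "real k" "2 * (real k - 1)" D] by simp
  have b1: "1 / \<delta> \<ge> 1" using ed exp_ge_add_one_self[of 1] by linarith
  have p1: "(1 / \<delta>) ^ k \<ge> 1" using b1 by (rule one_le_power)
  have H: "(1 / \<delta>) ^ k \<le> real H" "real H \<le> (1 / \<delta>) ^ k + 1" unfolding H_def using p1 by linarith+
  show H1: "H \<ge> 1" using H p1 by linarith
  have "1 / real H \<le> 1 / (1 / \<delta>) ^ k" using H p1 by (intro divide_left_mono mult_pos_pos) linarith+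
  also have "\<dots> = \<delta> ^ k" using \<delta> by (simp add: power_one_over)
  finally show Hk: "1 / real H \<le> \<delta> ^ k" .
  have "ln (real H) \<le> ln (exp 1 * (1 / \<delta>) ^ k)"
  proof (rule ln_mono)
    have "real H \<le> 2 * (1 / \<delta>) ^ k" using H p1 by linarith
    also have "\<dots> \<le> exp 1 * (1 / \<delta>) ^ k" using p1 exp_ge_add_one_self[of 1] by (intro mult_right_mono) auto
    finally show "real H \<le> exp 1 * (1 / \<delta>) ^ k" .
  qed (use H1 in auto)
  also have "\<dots> = real k * D + 1" using \<delta> by (simp add: ln_mult ln_realpow D_def)
  finally show lnH: "ln (real H) \<le> real k * ln (1 / \<delta>) + 1" by (simp add: D_def)
  have lnH0: "ln (real H) \<ge> 0" using H1 by simp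
  have lnHu: "ln (real H) \<le> 2 * u + 1" using lnH kD unfolding D_def by linarith
  define e where "e = exp (- u / 10)"
  have pw: "\<delta> powr s = exp (- (s * D))" for s
    using \<delta> by (simp add: powr_def D_def ln_div)
  have e: "\<delta> powr ((real k - 1) / 10) = e" unfolding pw e_def u_def by simp
  have e5: "\<delta> powr ((real k - 1) / 5) = e * e" unfolding pw e_def u_def exp_add[symmetric] by (simp add: field_simps)
  have dk: "\<delta> ^ k \<le> e * e"
  proof -
    have "\<delta> ^ k = \<delta> powr (real k)" using \<delta> by (simp add: powr_realpow)
    also have "\<dots> \<le> \<delta> powr ((real k - 1) / 5)"
    proof -
      have "(real k - 1) / 5 * D \<le> real k * D" using k1 D1 by (intro mult_right_mono) auto
      thus ?thesis unfolding pw by simp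
    qed
    finally show ?thesis unfolding e5 .
  qed
  have e01: "0 < e" "e \<le> 1" using u1 by (auto simp: e_def)
  define Kn where "Kn = 20 ^ n * (10 * real (n + 1)) ^ (n + 1)"
  have Kn: "Kn \<ge> 0" by (simp add: Kn_def)
  have poly: "(8 + 4 * ln (real H)) ^ n * (1 + u) * e \<le> Kn"
  proof -
    have "(8 + 4 * ln (real H)) ^ n \<le> (20 * (1 + u)) ^ n" using lnH0 lnHu by (intro power_mono) auto
    hence "(8 + 4 * ln (real H)) ^ n * (1 + u) * e \<le> (20 * (1 + u)) ^ n * (1 + u) * e"
      using u1 e01 by (intro mult_right_mono) auto
    also have "\<dots> = 20 ^ n * ((1 + u) ^ (n + 1) * e)"
      by (simp only: power_mult_distrib power_add power_one_right mult.assoc)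
    also have "\<dots> \<le> 20 ^ n * (((10 * real (n + 1)) ^ (n + 1) * exp (u / 10)) * e)"
      using power_le_exp_tenth[of u n] u1 e01 by (intro mult_left_mono mult_right_mono) auto
    also have "exp (u / 10) * e = 1" unfolding e_def exp_add[symmetric] by simp
    hence "20 ^ n * (((10 * real (n + 1)) ^ (n + 1) * exp (u / 10)) * e) = Kn" unfolding Kn_def by (simp only: mult.assoc mult_1_right)
    finally show ?thesis .
  qed
  have P0: "(8 + 4 * ln (real H)) ^ n \<ge> 0" using lnH0 by simp
  have inva: "1 / \<alpha> > 0" using \<alpha> by simp
  have t1: "1 / \<alpha> * \<delta> ^ k \<le> 1 / \<alpha> * e"
  proof -
    have "e * e \<le> e" using e01 by (intro mult_left_le) auto
    thus ?thesis using dk inva by (intro mult_left_mono) linarith+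
  qed
  have t2: "(real n * 2 ^ n + 4 * real n * (8 + 4 * ln (real H)) ^ n) / real H \<le> 33 * (real n * 2 ^ n + 4 * real n * Kn) * (1 / \<alpha>) * e"
  proof -
    have nn: "0 \<le> real n * 2 ^ n + 4 * real n * (8 + 4 * ln (real H)) ^ n" using P0 by simp
    have "(real n * 2 ^ n + 4 * real n * (8 + 4 * ln (real H)) ^ n) / real H
      = (real n * 2 ^ n + 4 * real n * (8 + 4 * ln (real H)) ^ n) * (1 / real H)" by simp
    also have "\<dots> \<le> (real n * 2 ^ n + 4 * real n * (8 + 4 * ln (real H)) ^ n) * (e * e)"
      using Hk dk nn by (intro mult_left_mono) auto
    also have "\<dots> = (real n * 2 ^ n * e + 4 * real n * ((8 + 4 * ln (real H)) ^ n * 1 * e)) * e" by (simp add: algebra_simps)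
    also have "\<dots> \<le> (real n * 2 ^ n * 1 + 4 * real n * ((8 + 4 * ln (real H)) ^ n * (1 + u) * e)) * e"
      using e01 u1 P0 by (intro mult_right_mono add_mono mult_left_mono) auto
    also have "\<dots> \<le> (real n * 2 ^ n * 1 + 4 * real n * Kn) * e"
      using poly e01 by (intro mult_right_mono add_mono mult_left_mono) auto
    also have "\<dots> \<le> (33 * (1 / \<alpha>)) * ((real n * 2 ^ n * 1 + 4 * real n * Kn) * e)"
    proof -
      have "1 \<le> 33 * (1 / \<alpha>)" using \<alpha> by (simp add: field_simps)
      hence "1 * ((real n * 2 ^ n * 1 + 4 * real n * Kn) * e) \<le> (33 * (1 / \<alpha>)) * ((real n * 2 ^ n * 1 + 4 * real n * Kn) * e)"
        using e01 Kn by (intro mult_right_mono) auto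
      thus ?thesis by simp
    qed
    finally show ?thesis by (simp add: mult_ac)
  qed
  have t3: "132 * real k / \<alpha> * \<delta> powr ((real k - 1) / 5) * (4 + 2 * ln (real (H\<^sup>2))) ^ n \<le> 264 * Kn * (1 / \<alpha>) * e"
  proof -
    have "ln (real (H\<^sup>2)) = 2 * ln (real H)" using H1 by (simp add: ln_realpow)
    hence "(4 + 2 * ln (real (H\<^sup>2))) ^ n \<le> (8 + 4 * ln (real H)) ^ n" using lnH0 by (intro power_mono) auto
    hence "132 * real k / \<alpha> * (e * e) * (4 + 2 * ln (real (H\<^sup>2))) ^ n \<le> 132 * real k / \<alpha> * (e * e) * (8 + 4 * ln (real H)) ^ n"
      using \<alpha> e01 by (intro mult_left_mono) auto
    also have "\<dots> = (132 * (1 / \<alpha>) * e) * (real k * ((8 + 4 * ln (real H)) ^ n * e))" by (simp add: mult_ac)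
    also have "\<dots> \<le> (132 * (1 / \<alpha>) * e) * ((2 * (1 + u)) * ((8 + 4 * ln (real H)) ^ n * e))"
      using k2u \<alpha> e01 P0 by (intro mult_left_mono mult_right_mono) auto
    also have "\<dots> = (264 * (1 / \<alpha>) * e) * ((8 + 4 * ln (real H)) ^ n * (1 + u) * e)" by (simp add: mult_ac)
    also have "\<dots> \<le> (264 * (1 / \<alpha>) * e) * Kn" using poly \<alpha> e01 by (intro mult_left_mono) auto
    finally show ?thesis unfolding e5 by (simp add: mult_ac)
  qed
  have "disc_const n * (1 / \<alpha>) * e = 1 / \<alpha> * e + 33 * (real n * 2 ^ n + 4 * real n * Kn) * (1 / \<alpha>) * e + 264 * Kn * (1 / \<alpha>) * e"
    unfolding disc_const_def Kn_def by (simp add: algebra_simps)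
  thus "1 / \<alpha> * \<delta> ^ k + (real n * 2 ^ n + 4 * real n * (8 + 4 * ln (real H)) ^ n) / real H
     + 132 * real k / \<alpha> * \<delta> powr ((real k - 1) / 5) * (4 + 2 * ln (real (H\<^sup>2))) ^ n
    \<le> disc_const n * (1 / \<alpha>) * \<delta> powr ((real k - 1) / 10)"
    unfolding e using t1 t2 t3 by linarith
qed

section \<open>Thresholds and choice of parameters\<close>

text \<open>With l = ln ln x, the conditions secure in turn:
  \<open>z ^ (k - 1) \<le> y powr (1/4)\<close> (8712 is 8 * 33^2), L \<ge> \<alpha> l / 2,
  \<open>z\<close> and \<open>y\<close> above their thresholds, \<open>x\<close> beyond the range of
  the density hypothesis (two conditions), few primes up to \<open>z\<close>,
  \<open>2 * H \<le> sqrt x\<close>, few primes dividing a frequency, the comparison of the two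
  bases, a lower base of at least \<alpha> l / 2, and negligible moduli up to \<open>sqrt x\<close>.
  None involves \<open>n\<close>, the sets, \<open>k\<close> or \<delta>.\<close>

definition large_enough :: "real \<Rightarrow> real \<Rightarrow> real \<Rightarrow> real \<Rightarrow> real \<Rightarrow> real \<Rightarrow> bool" where
  "large_enough \<alpha> x0 B0 B1 c0 x \<longleftrightarrow> 8712 \<le> ln (ln x) \<and> 2 * c0 \<le> ln (ln x) \<and> B1 \<le> ln x / (ln (ln x)) ^ 3
     \<and> B0 \<le> ln x / (66 * ln (ln x)) \<and> x0\<^sup>2 \<le> x \<and> x0 + 1 \<le> x
     \<and> 2 * ln x * x powr (1/4) \<le> \<alpha> * sqrt x
     \<and> 33 * ln (ln x) * ln (ln (ln x)) + 3 \<le> ln x / 2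
     \<and> 3 * (33 * ln (ln x) * ln (ln (ln x)) + 1) + 1 \<le> (ln (ln x))\<^sup>2
     \<and> (2 * ln (ln (ln x)) + 100 * (1 + 3 * ln (ln (ln x))) + 10) + (100 * (1 + 3 * ln (ln (ln x))) + ln (33 * ln (ln x)))
          \<le> \<alpha> / 8 * (ln (ln x)) powr (4/5)
     \<and> 100 * (1 + 3 * ln (ln (ln x))) + ln (33 * ln (ln x)) + \<alpha> * c0 \<le> \<alpha> / 2 * ln (ln x)
     \<and> ln 2 + ln (ln x) + 33 * ln (ln x) * ln (ln (ln x)) \<le> ln x / 2"

lemma eventually_large_enough:
  fixes \<alpha> x0 B0 B1 c0 :: real
  assumes "\<alpha> > 0"
  shows "eventually (large_enough \<alpha> x0 B0 B1 c0) at_top"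
  unfolding large_enough_def[abs_def]
proof (intro eventually_conj)
  have ge: "eventually (\<lambda>x. B \<le> f x) at_top" if "filterlim f at_top at_top" for f :: "real \<Rightarrow> real" and B
    using that by (simp add: filterlim_at_top)
  show "eventually (\<lambda>x. 8712 \<le> ln (ln (x::real))) at_top" by (rule ge) real_asymp
  show "eventually (\<lambda>x. 2 * c0 \<le> ln (ln (x::real))) at_top" by (rule ge) real_asymp
  show "eventually (\<lambda>x. B1 \<le> ln x / (ln (ln x)) ^ 3) at_top" by (rule ge) real_asymp
  show "eventually (\<lambda>x. B0 \<le> ln x / (66 * ln (ln x))) at_top" by (rule ge) real_asymp
  show "eventually (\<lambda>x. x0\<^sup>2 \<le> x) at_top" by (rule eventually_ge_at_top)
  show "eventually (\<lambda>x. x0 + 1 \<le> x) at_top" by (rule eventually_ge_at_top)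
  show "eventually (\<lambda>x. 2 * ln x * x powr (1/4) \<le> \<alpha> * sqrt x) at_top" using assms by real_asymp
  show "eventually (\<lambda>x::real. 33 * ln (ln x) * ln (ln (ln x)) + 3 \<le> ln x / 2) at_top" by real_asymp
  show "eventually (\<lambda>x::real. 3 * (33 * ln (ln x) * ln (ln (ln x)) + 1) + 1 \<le> (ln (ln x))\<^sup>2) at_top" by real_asymp
  show "eventually (\<lambda>x. (2 * ln (ln (ln x)) + 100 * (1 + 3 * ln (ln (ln x))) + 10) + (100 * (1 + 3 * ln (ln (ln x))) + ln (33 * ln (ln x)))
          \<le> \<alpha> / 8 * (ln (ln x)) powr (4/5)) at_top" using assms by real_asymp
  show "eventually (\<lambda>x. 100 * (1 + 3 * ln (ln (ln x))) + ln (33 * ln (ln x)) + \<alpha> * c0 \<le> \<alpha> / 2 * ln (ln x)) at_top" using assms by real_asymp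
  show "eventually (\<lambda>x::real. ln 2 + ln (ln x) + 33 * ln (ln x) * ln (ln (ln x)) \<le> ln x / 2) at_top" by real_asymp
qed

text \<open>Chebyshev's upper bound limits any density \<alpha>. This bounds \<open>k\<close> by 33
  ln ln x uniformly in \<alpha> and gives 1 \<le> 33/\<alpha>.\<close>

lemma prime_density_le_33:
  fixes \<alpha> x0 :: real
  assumes "\<And>y. y \<ge> x0 \<Longrightarrow> (\<Sum>p | prime p \<and> real p \<le> y \<and> P p. ln (real p)) \<ge> \<alpha> * y"
  shows "\<alpha> \<le> 33"
proof -
  obtain Y0 where Y0: "Y0 \<ge> 2" "\<And>Y. Y \<ge> Y0 \<Longrightarrow> real (card {p. prime p \<and> real p \<le> Y}) \<le> 33 * (Y / ln Y)"
    using prime_count_le by blast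
  define y where "y = max x0 Y0"
  have y: "y \<ge> x0" "y \<ge> Y0" "y \<ge> 2" "ln y > 0" using Y0(1) by (auto simp: y_def)
  have fin: "finite {p::nat. prime p \<and> real p \<le> y}" by (rule finite_nat_le_real)
  have "\<alpha> * y \<le> (\<Sum>p | prime p \<and> real p \<le> y \<and> P p. ln (real p))" by (rule assms[OF y(1)])
  also have "\<dots> \<le> (\<Sum>p | prime p \<and> real p \<le> y \<and> P p. ln y)"
    by (intro sum_mono ln_mono) (auto simp: prime_gt_0_nat)
  also have "\<dots> \<le> (\<Sum>p | prime p \<and> real p \<le> y. ln y)"
    using y by (intro sum_mono2 fin) auto
  also have "\<dots> = real (card {p. prime p \<and> real p \<le> y}) * ln y" by simp
  also have "\<dots> \<le> 33 * (y / ln y) * ln y" using Y0(2)[OF y(2)] y(4) by (intro mult_right_mono) auto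
  also have "\<dots> = 33 * y" using y(4) by simp
  finally show ?thesis using y(3) by simp
qed

lemma power_div_fact_ge_1:
  assumes "real j \<le> D"
  shows "1 \<le> D ^ j / fact j"
proof -
  have "fact j \<le> real j ^ j" using fact_le_power[of j, where ?'a = real] by simp
  also have "\<dots> \<le> D ^ j" using assms by (intro power_mono) auto
  finally show ?thesis by simp
qed

text \<open>The exponents differ by 1/2 - 1/5 = 3/10, and exp(-3/10) \<le> 3/4. The remaining
  quarter of \<delta>^(1/5) is reserved for the error terms.\<close>

lemma delta_powr_gap:
  fixes \<delta> :: real
  assumes "0 < \<delta>" "\<delta> \<le> 1 / exp 1"
  shows "sqrt \<delta> \<le> 3 / 4 * \<delta> powr (1/5)"
proof -
  have "\<delta> powr (3/10) \<le> (1 / exp 1) powr (3/10)" using assms by (intro powr_mono2) auto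
  also have "\<dots> = 1 / exp (3/10 :: real)" by (simp add: powr_def ln_div exp_minus inverse_eq_divide)
  also have "\<dots> \<le> 3 / 4"
    using exp_lower_Taylor_quadratic[of "3/10 :: real"] by (simp add: divide_simps power2_eq_square)
  finally have "\<delta> powr (3/10) * \<delta> powr (1/5) \<le> 3 / 4 * \<delta> powr (1/5)" by (intro mult_right_mono) auto
  moreover have "\<delta> powr (3/10) * \<delta> powr (1/5) = sqrt \<delta>"
    using assms by (simp add: powr_add[symmetric] powr_half_sqrt)
  ultimately show ?thesis by simp
qed

lemma average_disc_bound:
  fixes n k :: nat and \<alpha> x0 x \<delta> Y0 Y1 c0 :: real
  defines "l \<equiv> ln (ln x)"
  assumes pb: "progression_bound Y0"
    and Y1: "Y1 \<ge> 2" "\<And>z x. Y1 \<le> z \<Longrightarrow> z \<le> x \<Longrightarrow> (\<Sum>p | prime p \<and> z < real p \<and> real p \<le> x. 1 / real p)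
     \<le> 100 * (1 + ln (ln x) - ln (ln z))"
    and c0: "c0 = ln (ln (x0 + 2))"
    and n: "n \<ge> 1" and \<alpha>: "\<alpha> > 0" and x0: "x0 \<ge> 2"
    and dens: "\<And>y. y \<ge> x0 \<Longrightarrow> (\<Sum>p | prime p \<and> real p \<le> y \<and> rho n A p \<ge> 1. ln (real p)) \<ge> \<alpha> * y"
    and large: "large_enough \<alpha> x0 (ln Y0) (ln Y1) c0 x"
    and \<delta>: "1 / l \<le> \<delta>" "\<delta> \<le> 1 / exp 1"
    and hyp: "(\<Sum>p | prime p \<and> p \<in> QQ_upto n A x. 1 / real p * (real (lam n A p) / real (rho n A p)))
         \<le> \<delta> * (\<Sum>p | prime p \<and> p \<in> QQ_upto n A x. 1 / real p)"
    and k: "2 \<le> k" "real k \<le> \<alpha> * \<delta> * l"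
  shows "1 / real (card (QQ_k_upto n A k x)) * (\<Sum>q\<in>QQ_k_upto n A k x. disc n (Delta n A q))
            \<le> disc_const n * (1 / \<alpha>) * \<delta> powr ((real k - 1) / 10)"
proof -
  note Y0 = progression_boundD[OF pb]
  have \<alpha>33: "\<alpha> \<le> 33" by (rule prime_density_le_33[OF dens])
  have c: "8712 \<le> l" "2 * c0 \<le> l" "ln Y1 \<le> ln x / l ^ 3" "ln Y0 \<le> ln x / (66 * l)" "x0\<^sup>2 \<le> x" "x0 + 1 \<le> x"
      "2 * ln x * x powr (1/4) \<le> \<alpha> * sqrt x" "33 * l * ln l + 3 \<le> ln x / 2"
      "3 * (33 * l * ln l + 1) + 1 \<le> l\<^sup>2"
      "(2 * ln l + 100 * (1 + 3 * ln l) + 10) + (100 * (1 + 3 * ln l) + ln (33 * l)) \<le> \<alpha> / 8 * l powr (4/5)"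
      "100 * (1 + 3 * ln l) + ln (33 * l) + \<alpha> * c0 \<le> \<alpha> / 2 * l"
      "ln 2 + l + 33 * l * ln l \<le> ln x / 2"
    using large unfolding large_enough_def l_def by blast+
  have l0: "l > 0" using c(1) by simp
  have lnl: "ln l \<ge> 0" using c(1) by simp
  have x1: "x \<ge> 4"
  proof -
    have "2\<^sup>2 \<le> x0\<^sup>2" using x0 by (intro power_mono) auto
    thus ?thesis using c(5) by simp
  qed
  have lnx: "ln x > 0" using x1 by simp
  have expl: "exp l = ln x" using lnx by (simp add: l_def)
  have \<delta>0: "\<delta> > 0" using \<delta>(1) l0 by (meson divide_pos_pos less_le_trans zero_less_one)
  have e2: "exp 1 \<ge> (2.5::real)" using exp_lower_Taylor_quadratic[of "1::real"] by simp
  \<comment> \<open>A bound strictly below 1/2: it makes \<open>k\<close> at most (2/5) \<alpha> l,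
    below the value \<alpha> l / 2 guaranteed for the lower base \<open>D\<close>.\<close>
  have \<delta>25: "\<delta> \<le> 2/5"
  proof -
    have "1 / exp 1 \<le> 1 / (2.5::real)" using e2 by (intro divide_left_mono) auto
    thus ?thesis using \<delta>(2) by simp
  qed
  have k\<alpha>: "real k \<le> 2/5 * \<alpha> * l"
  proof -
    have "\<alpha> * \<delta> * l \<le> \<alpha> * (2/5) * l" using \<delta>25 \<alpha> l0 by (intro mult_right_mono mult_left_mono) auto
    thus ?thesis using k(2) by (simp add: mult_ac)
  qed
  have k33: "real k \<le> 33 * l"
  proof -
    have "2/5 * \<alpha> * l \<le> 33 * l" using \<alpha>33 \<alpha> l0 by (intro mult_right_mono) auto
    thus ?thesis using k\<alpha> by linarith
  qed
  have id: "1 / \<delta> \<le> l" using \<delta>(1) \<delta>0 l0 by (simp add: field_simps)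
  have kD: "real k * ln (1 / \<delta>) \<le> 33 * l * ln l"
  proof (intro mult_mono k33)
    show "ln (1 / \<delta>) \<le> ln l" using id \<delta>0 by (intro ln_mono) auto
    have "1 / \<delta> \<ge> 1" using \<delta>25 \<delta>0 by (simp add: field_simps)
    thus "0 \<le> ln (1 / \<delta>)" by simp
  qed (use l0 in auto)
  define z where "z = exp (ln x / l ^ 3)"
  \<comment> \<open>The \<open>k\<close>-th root of \<open>sqrt x\<close>, so that a modulus above
    \<open>sqrt x\<close> has a component of at least this size; passing from ln x to ln y costs
    only a factor \<open>2 * k\<close>.\<close>
  define y where "y = exp (ln x / (2 * real k))"
  have k0: "real k > 0" using k by simp
  have l3: "l ^ 3 \<ge> 4"
  proof -
    have "(2::real) ^ 3 \<le> l ^ 3" using c(1) by (intro power_mono) auto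
    thus ?thesis by simp
  qed
  have zY: "Y1 \<le> z"
  proof -
    have "exp (ln Y1) \<le> z" unfolding z_def using c(3) by simp
    thus ?thesis using Y1(1) by simp
  qed
  have z14: "z \<le> x powr (1/4)"
  proof -
    have "ln x / l ^ 3 \<le> ln x / 4" using l3 lnx l0 by (intro divide_left_mono) auto
    thus ?thesis using x1 by (simp add: z_def powr_def)
  qed
  have zx: "z \<le> x"
  proof -
    have "x powr (1/4) \<le> x powr 1" using x1 by (intro powr_mono) auto
    thus ?thesis using z14 x1 by simp
  qed
  have z1: "z \<ge> 1" using lnx l0 by (simp add: z_def)
  have lnlnz: "ln (ln z) = l - 3 * ln l"
    using lnx l0 by (simp add: z_def ln_div ln_realpow l_def)
  have yY: "y \<ge> Y0"
  proof -
    have "ln x / (66 * l) \<le> ln x / (2 * real k)" using k33 k0 l0 lnx by (intro divide_left_mono) auto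
    hence "exp (ln Y0) \<le> y" unfolding y_def using c(4) by simp
    thus ?thesis using Y0(1) by simp
  qed
  have yk: "y ^ k = sqrt x"
  proof -
    have "y ^ k = exp (real k * (ln x / (2 * real k)))" unfolding y_def by (rule exp_of_nat_mult[symmetric])
    also have "real k * (ln x / (2 * real k)) = 1/2 * ln x" using k0 by simp
    also have "exp (1/2 * ln x) = x powr (1/2)" using x1 by (simp add: powr_def)
    finally show ?thesis using x1 by (simp add: powr_half_sqrt)
  qed
  have zpow: "z ^ (k - 1) = exp (real (k - 1) * (ln x / l ^ 3))" unfolding z_def by (rule exp_of_nat_mult[symmetric])
  have zk: "z ^ (k - 1) \<le> y powr (1/4)"
  proof -
    \<comment> \<open>Taking logarithms, the requirement is 8 k (k - 1) \<le> l^3. As k \<le> 33 l,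
      the cube in the definition of \<open>z\<close> leaves one factor l to beat the constant 8 *
      33^2.\<close>
    have "real (k - 1) * 8 * real k \<le> (33 * l) * 8 * (33 * l)" using k33 k0 by (intro mult_mono) auto
    also have "\<dots> = 8712 * l ^ 2" by (simp add: power2_eq_square)
    also have "\<dots> \<le> l * l ^ 2" using c(1) by (intro mult_right_mono) auto
    finally have "real (k - 1) * 8 * real k \<le> l ^ 3" by (simp add: power3_eq_cube power2_eq_square)
    hence "real (k - 1) / l ^ 3 \<le> 1 / (8 * real k)" using k0 l0 by (simp add: field_simps)
    hence "real (k - 1) / l ^ 3 * ln x \<le> 1 / (8 * real k) * ln x" using lnx by (intro mult_right_mono) auto
    thus ?thesis unfolding zpow by (simp add: y_def powr_def)
  qed
  have zks: "z ^ (k - 1) \<le> sqrt x"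
  proof -
    have y1: "y \<ge> 1" using Y0(1) yY by linarith
    have "y powr (1/4) \<le> y powr real k" using y1 k by (intro powr_mono) auto
    also have "\<dots> = sqrt x" using y1 yk by (simp add: powr_realpow)
    finally show ?thesis using zk by linarith
  qed
  have sx: "sqrt x \<ge> x0" using c(5) x0 by (intro real_le_rsqrt) auto
  have zc: "z \<le> \<alpha> * sqrt x / (2 * ln x)"
  proof -
    have "2 * ln x * z \<le> \<alpha> * sqrt x" using c(7) mult_left_mono[OF z14, of "2 * ln x"] lnx by linarith
    thus ?thesis using lnx by (simp add: field_simps)
  qed
  define Q where "Q = {p. prime p \<and> p \<in> QQ_upto n A x}"
  define T where "T = {p. prime p \<and> rho n A p \<ge> 1 \<and> real p \<le> z}"
  define L where "L = (\<Sum>p\<in>Q. 1 / real p)"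
  define Lz where "Lz = (\<Sum>p\<in>T. 1 / real p)"
  have Qeq: "Q = {p. p \<in> {p. prime p \<and> rho n A p \<ge> 1} \<and> real p \<le> x}"
    by (auto simp: Q_def QQ_upto_def QQ_def Suc_le_eq prime_gt_0_nat)
  have L: "L \<ge> \<alpha> * (l - c0)"
  proof -
    have "\<alpha> * (ln (ln x) - ln (ln (x0 + 2))) \<le> (\<Sum>p | p \<in> {p. prime p \<and> rho n A p \<ge> 1} \<and> real p \<le> x. 1 / real p)"
    proof (rule sum_reciprocals_ge[OF _ \<alpha> x0])
      fix t assume "x0 \<le> t"
      hence "\<alpha> * t \<le> (\<Sum>p | prime p \<and> real p \<le> t \<and> rho n A p \<ge> 1. ln (real p))" by (rule dens)
      also have "{p. prime p \<and> real p \<le> t \<and> rho n A p \<ge> 1} = {p. p \<in> {p. prime p \<and> rho n A p \<ge> 1} \<and> real p \<le> t}" by auto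
      finally show "\<alpha> * t \<le> (\<Sum>p | p \<in> {p. prime p \<and> rho n A p \<ge> 1} \<and> real p \<le> t. ln (real p))" .
    qed (use c(6) in \<open>auto simp: prime_ge_2_nat\<close>)
    thus ?thesis unfolding L_def Qeq l_def c0 by simp
  qed
  have Lz: "L \<le> Lz + 100 * (1 + 3 * ln l)"
  proof -
    have finx: "finite {p::nat. P p \<and> real p \<le> x}" for P by (rule finite_nat_le_real)
    have "Q \<subseteq> T \<union> {p. prime p \<and> z < real p \<and> real p \<le> x}" unfolding Qeq T_def by auto
    moreover have fT: "finite T" unfolding T_def
      by (rule finite_subset[OF _ finite_nat_le_real[of "\<lambda>_. True" z]]) auto
    moreover have fR: "finite {p::nat. prime p \<and> z < real p \<and> real p \<le> x}" by (rule finite_subset[OF _ finx[of "\<lambda>_. True"]]) auto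
    ultimately have "L \<le> (\<Sum>p\<in>T \<union> {p. prime p \<and> z < real p \<and> real p \<le> x}. 1 / real p)"
      unfolding L_def by (intro sum_mono2) auto
    also have "\<dots> = Lz + (\<Sum>p | prime p \<and> z < real p \<and> real p \<le> x. 1 / real p)"
      unfolding Lz_def using fT fR by (intro sum.union_disjoint) (auto simp: T_def)
    also have "\<dots> \<le> Lz + 100 * (1 + ln (ln x) - ln (ln z))" using Y1(2)[OF zY zx] by simp
    finally show ?thesis unfolding lnlnz l_def[symmetric] by simp
  qed
  \<comment> \<open>The base of the lower bound for the number of moduli; it differs from
    \<open>L\<close> only by terms of order ln l.\<close>
  define D where "D = Lz - ln (real k)"
  have lnk: "ln (real k) \<le> ln (33 * l)" using k33 k0 by (intro ln_mono) auto
  have D: "D \<ge> L - (100 * (1 + 3 * ln l) + ln (33 * l))" using Lz lnk by (simp add: D_def)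
  have L2: "L \<ge> \<alpha> / 2 * l"
  proof -
    have "\<alpha> * (l / 2) \<le> \<alpha> * (l - c0)" using c(2) \<alpha> by (intro mult_left_mono) auto
    thus ?thesis using L by simp
  qed
  have Dk: "D \<ge> real k"
  proof -
    have "D \<ge> \<alpha> * l - \<alpha> * c0 - (100 * (1 + 3 * ln l) + ln (33 * l))" using D L by (simp add: right_diff_distrib)
    hence "D \<ge> \<alpha> / 2 * l" using c(11) by simp
    moreover have "2/5 * \<alpha> * l \<le> \<alpha> / 2 * l" using \<alpha> l0 by simp
    ultimately show ?thesis using k\<alpha> by linarith
  qed
  define d5 where "d5 = \<delta> powr (1/5)"
  have d5: "0 < d5" "d5 \<le> 1" "l powr (- 1/5) \<le> d5"
  proof -
    show "0 < d5" using \<delta>0 by (simp add: d5_def)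
    show "d5 \<le> 1" unfolding d5_def using \<delta>0 \<delta>25 by (intro powr_le1) auto
    have "(1 / l) powr (1/5) \<le> d5" unfolding d5_def using \<delta>(1) l0 by (intro powr_mono2) auto
    thus "l powr (- 1/5) \<le> d5" using l0 by (simp add: powr_minus_divide powr_divide)
  qed
  \<comment> \<open>The base-to-base comparison: of \<delta>^(1/5) L, three quarters cover the main
    term, and one quarter covers the errors of both bounds.\<close>
  have SD: "sqrt \<delta> * L + (2 * ln l + 100 * (1 + 3 * ln l) + 10) \<le> d5 * D"
  proof -
    define e1 where "e1 = 2 * ln l + 100 * (1 + 3 * ln l) + 10"
    define e2 where "e2 = 100 * (1 + 3 * ln l) + ln (33 * l)"
    have e20: "e2 \<ge> 0" using lnl c(1) by (simp add: e2_def)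
    have "e1 + e2 \<le> \<alpha> / 8 * l powr (4/5)" using c(10) by (simp add: e1_def e2_def)
    \<comment> \<open>The assumption \<delta> \<ge> 1/l enters here: it gives l^(-1/5) \<le>
      \<delta>^(1/5), so an error below \<alpha>/8 times l^(4/5) is at most a quarter of
      \<delta>^(1/5) L.\<close>
    also have "l powr (4/5) = l powr (- 1/5) * l" using l0 powr_add[of l "- 1/5" 1] by simp
    also have "\<alpha> / 8 * (l powr (- 1/5) * l) \<le> \<alpha> / 8 * (d5 * l)" using d5 \<alpha> l0 by (intro mult_left_mono mult_right_mono) auto
    also have "\<dots> = d5 / 4 * (\<alpha> / 2 * l)" by simp
    also have "\<dots> \<le> d5 / 4 * L" using L2 d5 by (intro mult_left_mono) auto
    finally have e12: "e1 + e2 \<le> d5 / 4 * L" .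
    have L0: "L \<ge> 0" by (simp add: L_def sum_nonneg)
    have "sqrt \<delta> * L \<le> 3 / 4 * d5 * L" unfolding d5_def using L0 by (intro mult_right_mono delta_powr_gap \<delta>0 \<delta>(2))
    moreover have "d5 * (L - e2) \<le> d5 * D" using D d5 by (intro mult_left_mono) (auto simp: e2_def)
    moreover have "d5 * e2 \<le> e2" using d5 e20 by (intro mult_left_le_one_le) auto
    moreover have "d5 * (L - e2) = 3 / 4 * d5 * L + d5 / 4 * L - d5 * e2" by (simp add: algebra_simps)
    ultimately show ?thesis using e12 unfolding e1_def[symmetric] by linarith
  qed
  \<comment> \<open>Chosen so that the truncation error, essentially 1/H, is at most \<delta>^k up
    to logarithms, while ln H is only of order l ln l.\<close>
  define H where "H = nat \<lceil>(1 / \<delta>) ^ k\<rceil>"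
  note num = final_numeric_bound[OF \<delta>0 \<delta>(2) \<alpha> \<alpha>33 k(1), folded H_def]
  have H1: "H \<ge> 1" by (rule num(2))
  have lnH: "ln (real H) \<le> 33 * l * ln l + 1" using num(4) kD by linarith
  define M where "M = H\<^sup>2"
  have M1: "M \<ge> 1" using H1 by (simp add: M_def)
  have qH: "q \<ge> 2 * H" if "sqrt x < real q" for q
  proof -
    have "ln (real (2 * H)) = ln 2 + ln (real H)" using H1 by (simp add: ln_mult)
    also have "\<dots> \<le> ln x / 2" using lnH c(8) ln_2_less_1 by linarith
    also have "\<dots> = ln (sqrt x)" using x1 by (simp add: ln_sqrt)
    finally have "real (2 * H) \<le> sqrt x" using H1 x1 by (subst (asm) ln_le_cancel_iff) auto
    thus ?thesis using that by linarith
  qed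
  have logM: "ln (log 2 (real M) + 1) \<le> 2 * ln l"
  proof -
    have "ln (real M) = 2 * ln (real H)" using H1 by (simp add: M_def ln_realpow)
    hence "log 2 (real M) = ln (real H) * (2 / ln 2)" by (simp add: log_def)
    also have "\<dots> \<le> ln (real H) * 3" using ln2_ge_two_thirds H1 by (intro mult_left_mono) (auto simp: divide_simps)
    also have "\<dots> \<le> (33 * l * ln l + 1) * 3" using lnH by simp
    finally have "log 2 (real M) + 1 \<le> l\<^sup>2" using c(9) by linarith
    moreover have "log 2 (real M) \<ge> 0" using M1 by simp
    ultimately have "ln (log 2 (real M) + 1) \<le> ln (l\<^sup>2)" by (intro ln_mono) auto
    thus ?thesis using l0 by (simp add: ln_realpow)
  qed
  define X where "X = QQ_k_upto n A k x"
  define N where "N = real (card X)"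
  define F where "F = x / ln x * (D ^ (k - 1) / fact (k - 1))"
  have NF: "N \<ge> \<alpha> / 2 * F"
  proof -
    have "ln (real k) \<le> (\<Sum>p\<in>T. 1 / real p)" using Dk k0 by (simp add: D_def Lz_def)
    hence "\<alpha> / 2 * (x / ln x) * (D ^ (k - 1) / fact (k - 1)) \<le> N"
      unfolding N_def X_def D_def Lz_def T_def
      using k by (intro card_QQ_k_ge[OF dens \<alpha> x0 sx _ z1 zks zc]) auto
    thus ?thesis by (simp add: F_def)
  qed
  \<comment> \<open>As \<open>k - 1 \<le> D\<close>, the factor D^(k-1)/(k-1)! is at least 1, so at
    least of order \<alpha> x / ln x moduli are available, far more than
    \<open>sqrt x\<close>.\<close>
  have F1: "F \<ge> x / ln x"
  proof -
    have "real (k - 1) \<le> D" using Dk by linarith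
    hence "x / ln x * 1 \<le> F" unfolding F_def using x1 lnx by (intro mult_left_mono power_div_fact_ge_1) auto
    thus ?thesis by simp
  qed
  have F0: "F > 0" using F1 x1 lnx by (meson divide_pos_pos less_le_trans zero_less_numeral)
  have N0: "N > 0" using NF F0 \<alpha> by (meson half_gt_zero less_le_trans mult_pos_pos)
  have finX: "finite X" unfolding X_def
    by (rule finite_subset[OF _ finite_nat_le_real[of "\<lambda>_. True" x]]) (auto simp: QQ_k_upto_def QQ_upto_def)
  define X1 where "X1 = {q\<in>X. real q \<le> sqrt x}"
  define X2 where "X2 = {q\<in>X. sqrt x < real q}"
  have XX: "X = X1 \<union> X2" "X1 \<inter> X2 = {}" "finite X1" "finite X2" using finX by (auto simp: X1_def X2_def)
  define tail where "tail = (real n * 2 ^ n + 4 * real n * (8 + 4 * ln (real H)) ^ n) / real H"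
  have tail0: "tail \<ge> 0"
  proof -
    have "ln (real H) \<ge> 0" using H1 by simp
    thus ?thesis by (simp add: tail_def)
  qed
  define W where "W = (4 + 2 * ln (real M)) ^ n"
  have s1: "(\<Sum>q\<in>X1. disc n (Delta n A q)) \<le> sqrt x"
  proof -
    have "(\<Sum>q\<in>X1. disc n (Delta n A q)) \<le> (\<Sum>q\<in>X1. 1)" by (intro sum_mono disc_Delta_le_1)
    also have "\<dots> = real (card X1)" by simp
    also have "\<dots> \<le> real (card {1..nat \<lfloor>sqrt x\<rfloor>})"
      by (intro of_nat_mono card_mono) (auto simp: X1_def X_def QQ_k_upto_def QQ_upto_def QQ_def intro: le_nat_floor)
    also have "\<dots> \<le> sqrt x" using x1 by simp
    finally show ?thesis .
  qed
  have wsum: "(\<Sum>q\<in>X2. norm (weyl n A q h 1)) \<le> 66 * real k * F * d5 ^ (k - 1)" if h: "h \<in> freqs n M" for h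
  proof -
    obtain i where i: "i < n" "h i \<noteq> 0" "\<bar>h i\<bar> \<le> int M"
      using h by (auto simp: freqs_def PiE_def Pi_def abs_le_iff)
    define S where "S = sum (comp_weight n A h z) (QQ_primepows n A x)"
    have S0: "S \<ge> 0" unfolding S_def by (intro sum_nonneg comp_weight_nonneg)
    have "S \<le> sqrt \<delta> * L + ln (log 2 (real M) + 1) + 100 * (1 + ln (ln x) - ln (ln z)) + 10"
      unfolding S_def L_def Q_def
      by (rule sum_comp_weight_le[where ?Y1.0 = Y1])
        (assumption | rule Y1(2) zY zx i hyp less_imp_le[OF \<delta>0])+
    hence S: "S \<le> d5 * D" using SD logM unfolding lnlnz l_def[symmetric] by simp
    have finT: "finite (QQ_primepows n A x)" unfolding QQ_primepows_def
      by (rule finite_subset[OF _ finite_nat_le_real[of "\<lambda>_. True" x]]) auto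
    have "(\<Sum>q\<in>X2. norm (weyl n A q h 1)) = (\<Sum>q | q \<in> QQ_k_upto n A k x \<and> sqrt x < real q. norm (weyl n A q h 1))"
      by (simp add: X2_def X_def)
    also have "\<dots> \<le> 33 * (x / ln y) * elem_sym (QQ_primepows n A x) (comp_weight n A h z) (k - 1)"
      by (rule sum_weyl_QQ_k_le[where ?Y0.0 = Y0 and y = y])
        (assumption | rule pb order.trans[OF one_le_numeral k(1)] z1 zk yY eq_refl[OF yk] order.trans[OF one_le_numeral x1])+
    also have "\<dots> \<le> 33 * (x / ln y) * (S ^ (k - 1) / fact (k - 1))"
      unfolding S_def using x1 k0 lnx
      by (intro mult_left_mono elem_sym_le finT comp_weight_nonneg) (auto simp: y_def)
    also have "\<dots> \<le> 33 * (x / ln y) * ((d5 * D) ^ (k - 1) / fact (k - 1))"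
      using x1 k0 lnx S S0 by (intro mult_left_mono divide_right_mono power_mono) (auto simp: y_def)
    \<comment> \<open>Here 66 k = 33 * 2k because ln y = ln x / (2k); the power of \<open>D\<close>
      is the same as in the lower bound and will cancel in the quotient.\<close>
    also have "\<dots> = 66 * real k * F * d5 ^ (k - 1)"
      using k0 lnx by (simp add: y_def F_def power_mult_distrib)
    finally show ?thesis .
  qed
  have s2: "(\<Sum>q\<in>X2. disc n (Delta n A q)) \<le> N * tail + W * (66 * real k * F * d5 ^ (k - 1))"
  proof -
    have "(\<Sum>q\<in>X2. disc n (Delta n A q)) \<le> (\<Sum>q\<in>X2. tail + (\<Sum>h\<in>freqs n M. (\<Prod>i<n. freq_weight (h i)) * norm (weyl n A q h 1)))"
    proof (rule sum_mono)
      fix q assume q: "q \<in> X2"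
      have "rho n A q \<ge> 1" using q by (simp add: X2_def X_def QQ_k_upto_def QQ_upto_def QQ_def)
      moreover have "q \<ge> 2 * H" using q by (intro qH) (simp add: X2_def)
      ultimately show "disc n (Delta n A q) \<le> tail + (\<Sum>h\<in>freqs n M. (\<Prod>i<n. freq_weight (h i)) * norm (weyl n A q h 1))"
        unfolding tail_def M_def by (intro disc_Delta_le n H1)
    qed
    also have "\<dots> = real (card X2) * tail + (\<Sum>q\<in>X2. \<Sum>h\<in>freqs n M. (\<Prod>i<n. freq_weight (h i)) * norm (weyl n A q h 1))"
      by (simp add: sum.distrib)
    also have "(\<Sum>q\<in>X2. \<Sum>h\<in>freqs n M. (\<Prod>i<n. freq_weight (h i)) * norm (weyl n A q h 1))
      = (\<Sum>h\<in>freqs n M. (\<Prod>i<n. freq_weight (h i)) * (\<Sum>q\<in>X2. norm (weyl n A q h 1)))"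
      by (subst sum.swap) (simp add: sum_distrib_left)
    also have "\<dots> \<le> (\<Sum>h\<in>freqs n M. (\<Prod>i<n. freq_weight (h i)) * (66 * real k * F * d5 ^ (k - 1)))"
      by (intro sum_mono mult_left_mono wsum prod_nonneg) (auto simp: freq_weight_nonneg)
    also have "\<dots> = (\<Sum>h\<in>freqs n M. \<Prod>i<n. freq_weight (h i)) * (66 * real k * F * d5 ^ (k - 1))"
      by (simp only: sum_distrib_right)
    also have "\<dots> \<le> W * (66 * real k * F * d5 ^ (k - 1))"
      unfolding W_def using F0 d5 by (intro mult_right_mono sum_freqs_weight_le M1) auto
    also have "real (card X2) * tail \<le> N * tail"
      unfolding N_def using tail0 finX by (intro mult_right_mono of_nat_mono card_mono) (auto simp: X2_def)
    finally show ?thesis by simp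
  qed
  have b1: "sqrt x / N \<le> 1 / \<alpha> * \<delta> ^ k"
  proof -
    have "sqrt x * (2 * ln x) \<le> x * \<delta> ^ k"
    proof -
      have "ln (2 * ln x) = ln 2 + l" using lnx by (simp add: ln_mult l_def)
      also have "\<dots> \<le> ln x / 2 - real k * ln (1 / \<delta>)" using c(12) kD by linarith
      also have "\<dots> = ln (sqrt x * \<delta> ^ k)" using x1 \<delta>0 by (simp add: ln_mult ln_sqrt ln_realpow ln_div)
      finally have "2 * ln x \<le> sqrt x * \<delta> ^ k" using lnx x1 \<delta>0 by (subst (asm) ln_le_cancel_iff) auto
      hence "sqrt x * (2 * ln x) \<le> sqrt x * (sqrt x * \<delta> ^ k)" using x1 by (intro mult_left_mono) auto
      thus ?thesis using x1 by (simp add: mult.assoc[symmetric])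
    qed
    hence "sqrt x \<le> (\<alpha> / 2 * (x / ln x)) * (1 / \<alpha> * \<delta> ^ k)" using lnx \<alpha> by (simp add: field_simps)
    also have "\<dots> \<le> N * (1 / \<alpha> * \<delta> ^ k)"
    proof (intro mult_right_mono)
      have "\<alpha> / 2 * (x / ln x) \<le> \<alpha> / 2 * F" using F1 \<alpha> by (intro mult_left_mono) auto
      thus "\<alpha> / 2 * (x / ln x) \<le> N" using NF by linarith
    qed (use \<alpha> \<delta>0 in auto)
    finally show ?thesis using N0 by (simp add: divide_le_eq mult.commute)
  qed
  have b2: "W * (66 * real k * F * d5 ^ (k - 1)) / N \<le> 132 * real k / \<alpha> * \<delta> powr ((real k - 1) / 5) * W"
  proof -
    have W0: "W \<ge> 0" using M1 by (simp add: W_def)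
    \<comment> \<open>The only place where the lower bound for the number of moduli produces the
      factor 1/\<alpha> in front of the Weyl sums.\<close>
    have FN: "F / N \<le> 2 / \<alpha>" using NF N0 \<alpha> by (simp add: field_simps)
    have dp: "d5 ^ (k - 1) = \<delta> powr ((real k - 1) / 5)"
      using k \<delta>0 by (simp add: d5_def powr_power of_nat_diff)
    have "W * (66 * real k * F * d5 ^ (k - 1)) / N = (W * 66 * real k * d5 ^ (k - 1)) * (F / N)" by simp
    also have "\<dots> \<le> (W * 66 * real k * d5 ^ (k - 1)) * (2 / \<alpha>)" using FN W0 d5 by (intro mult_left_mono) auto
    also have "\<dots> = 132 * real k / \<alpha> * \<delta> powr ((real k - 1) / 5) * W" unfolding dp by simp
    finally show ?thesis .
  qed
  have "(\<Sum>q\<in>X. disc n (Delta n A q)) = (\<Sum>q\<in>X1. disc n (Delta n A q)) + (\<Sum>q\<in>X2. disc n (Delta n A q))"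
    unfolding XX(1) using XX by (intro sum.union_disjoint) auto
  also have "\<dots> \<le> sqrt x + (N * tail + W * (66 * real k * F * d5 ^ (k - 1)))" by (intro add_mono s1 s2)
  finally have "(\<Sum>q\<in>X. disc n (Delta n A q)) / N \<le> (sqrt x + (N * tail + W * (66 * real k * F * d5 ^ (k - 1)))) / N"
    using N0 by (intro divide_right_mono) auto
  also have "\<dots> = sqrt x / N + tail + W * (66 * real k * F * d5 ^ (k - 1)) / N"
    using N0 by (simp add: add_divide_distrib)
  also have "\<dots> \<le> 1 / \<alpha> * \<delta> ^ k + tail + 132 * real k / \<alpha> * \<delta> powr ((real k - 1) / 5) * W"
    using b1 b2 by linarith
  also have "\<dots> \<le> disc_const n * (1 / \<alpha>) * \<delta> powr ((real k - 1) / 10)"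
    using num(1) by (simp only: tail_def W_def M_def)
  finally show ?thesis by (simp add: X_def N_def)
qed

theorem theorem1p4:
  "\<exists>(C :: nat \<Rightarrow> real) (X :: real \<Rightarrow> real \<Rightarrow> real).
     \<forall>(n :: nat) (A :: nat \<Rightarrow> (nat \<Rightarrow> nat) set) (\<alpha> :: real) (x0 :: real) (x :: real) (\<delta> :: real).
       n \<ge> 1 \<longrightarrow> prime_power_family n A \<longrightarrow> \<alpha> > 0 \<longrightarrow> x0 \<ge> 2 \<longrightarrow>
       (\<forall>y \<ge> x0. (\<Sum>p | prime p \<and> real p \<le> y \<and> rho n A p \<ge> 1. ln (real p)) \<ge> \<alpha> * y) \<longrightarrow>
       x \<ge> X \<alpha> x0 \<longrightarrow>
       1 / ln (ln x) \<le> \<delta> \<longrightarrow> \<delta> \<le> 1 / exp 1 \<longrightarrow>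
       (\<Sum>p | prime p \<and> p \<in> QQ_upto n A x. 1 / real p * (real (lam n A p) / real (rho n A p)))
         \<le> \<delta> * (\<Sum>p | prime p \<and> p \<in> QQ_upto n A x. 1 / real p) \<longrightarrow>
       (\<forall>k :: nat. 2 \<le> k \<longrightarrow> real k \<le> \<alpha> * \<delta> * ln (ln x) \<longrightarrow>
          1 / real (card (QQ_k_upto n A k x)) * (\<Sum>q\<in>QQ_k_upto n A k x. disc n (Delta n A q))
            \<le> C n * (1 / \<alpha>) * \<delta> powr ((real k - 1) / 10))"
proof -
  obtain Y0 where pb: "progression_bound Y0" using card_primepows_in_progression_le by blast
  obtain Y1 where Y1: "Y1 \<ge> 2" "\<And>z x. Y1 \<le> z \<Longrightarrow> z \<le> x \<Longrightarrow> (\<Sum>p | prime p \<and> z < real p \<and> real p \<le> x. 1 / real p)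
     \<le> 100 * (1 + ln (ln x) - ln (ln z))"
    using sum_prime_reciprocals_le by blast
  define good where "good \<alpha> x0 = large_enough \<alpha> x0 (ln Y0) (ln Y1) (ln (ln (x0 + 2)))" for \<alpha> x0
  \<comment> \<open>Positivity of \<alpha> is placed under the quantifier over \<open>x\<close> so
    that the threshold can be chosen as a total function of \<alpha> and \<open>x0\<close>. As
    \<open>Y0\<close> and \<open>Y1\<close> are absolute, it depends on nothing else.\<close>
  have "\<exists>X. \<forall>x\<ge>X. \<alpha> > 0 \<longrightarrow> good \<alpha> x0 x" for \<alpha> x0
  proof (cases "\<alpha> > 0")
    case True
    show ?thesis using eventually_large_enough[OF True, of x0 "ln Y0" "ln Y1" "ln (ln (x0 + 2))"]
      unfolding eventually_at_top_linorder good_def by blast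
  qed auto
  then obtain X where X: "\<And>\<alpha> x0 x. x \<ge> X \<alpha> x0 \<Longrightarrow> \<alpha> > 0 \<Longrightarrow> good \<alpha> x0 x" by metis
  show ?thesis
  proof (intro exI[of _ disc_const] exI[of _ X] allI impI)
    fix n k :: nat and A and \<alpha> x0 x \<delta> :: real
    assume a: "n \<ge> 1" "\<alpha> > 0" "x0 \<ge> 2"
      "\<forall>y \<ge> x0. (\<Sum>p | prime p \<and> real p \<le> y \<and> rho n A p \<ge> 1. ln (real p)) \<ge> \<alpha> * y"
      "x \<ge> X \<alpha> x0" "1 / ln (ln x) \<le> \<delta>" "\<delta> \<le> 1 / exp 1"
      "(\<Sum>p | prime p \<and> p \<in> QQ_upto n A x. 1 / real p * (real (lam n A p) / real (rho n A p)))
         \<le> \<delta> * (\<Sum>p | prime p \<and> p \<in> QQ_upto n A x. 1 / real p)"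
      "2 \<le> k" "real k \<le> \<alpha> * \<delta> * ln (ln x)"
    have g: "large_enough \<alpha> x0 (ln Y0) (ln Y1) (ln (ln (x0 + 2))) x" using X a unfolding good_def by blast
    show "1 / real (card (QQ_k_upto n A k x)) * (\<Sum>q\<in>QQ_k_upto n A k x. disc n (Delta n A q))
            \<le> disc_const n * (1 / \<alpha>) * \<delta> powr ((real k - 1) / 10)"
      by (rule average_disc_bound[where ?Y0.0 = Y0 and ?Y1.0 = Y1 and ?x0.0 = x0 and ?c0.0 = "ln (ln (x0 + 2))"])
        (assumption | rule pb Y1 refl a(1-3,6-10) a(4)[rule_format] g)+
  qed
qed

end
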